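(* There exist absolute constants $C,c>0$ and a deterministic online portfolio selection algorithm (taking the integers $d\ge 1$ and $T\ge 1$ as input) such that for all $d,T\ge 1$ and every sequence $x_1,\dots,x_T\in\mathbb{R}^d_+\setminus\{0\}$ of asset return vectors, the portfolios $w_1,\dots,w_T\in\Delta_d$ it produces satisfy $$\sum_{t=1}^T -\log(x_t^\top w_t)\;-\;\min_{w\in\Delta_d}\sum_{t=1}^T-\log(x_t^\top w)\;\le\; C\,d\log(T+d),$$ while the algorithm performs at most $C\,(d^2T+d^3)\,\log^{c}(e(T+d))$ arithmetic operations per round and stores at most $C\,(dT+d^2)$ real numbers. In other words, there is an algorithm for online portfolio selection which has $O(d\log(T+d))$ regret, runs in $\widetilde O(d^2T+d^3)$ time per round, and uses $O(dT+d^2)$ memory.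
   Context: $\mathbb{R}^d_+$ is the nonnegative orthant and $\Delta_d=\{w\in\mathbb{R}^d_+:\sum_{i=1}^d w[i]=1\}$ is the standard simplex. Online portfolio selection is a game over rounds $t=1,\dots,T$: in round $t$ the learner selects a portfolio $w_t\in\Delta_d$ depending only on the past $(w_\tau,x_\tau)_{\tau<t}$; then the adversary, having observed $w_t$, reveals a vector of asset returns $x_t\in\mathbb{R}^d_+$, and the learner suffers the loss $-\log(x_t^\top w_t)$, with $-\log 0=+\infty$. The displayed difference is called the regret. An algorithm is a sequence of mappings from histories to $\Delta_d$. Runtime is counted in arithmetic operations on real numbers, and memory in the number of real numbers stored. $\widetilde O(\cdot)$ hides a polylogarithmic factor in $T+d$. *)

theory Defs
  imports "HOL-Analysis.Analysis"
begin

section \<open>Online portfolio selection\<close>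

text \<open>Vectors of \<open>\<real>\<^sup>d\<close>, with \<open>d\<close> a term-level number, are functions
  \<^typ>\<open>nat \<Rightarrow> real\<close> that vanish outside \<^term>\<open>{..<d}\<close>; coordinate \<open>i\<close> of the
  mathematical text is coordinate \<open>i - 1\<close> here.  Rounds are numbered from 1.\<close>

definition orthant :: "nat \<Rightarrow> (nat \<Rightarrow> real) set" where
  "orthant d = {v. (\<forall>i<d. 0 \<le> v i) \<and> (\<forall>i\<ge>d. v i = 0)}"

definition prob_simplex :: "nat \<Rightarrow> (nat \<Rightarrow> real) set" where
  "prob_simplex d = {w \<in> orthant d. (\<Sum>i<d. w i) = 1}"

definition dot_prod :: "nat \<Rightarrow> (nat \<Rightarrow> real) \<Rightarrow> (nat \<Rightarrow> real) \<Rightarrow> real" where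
  "dot_prod d x w = (\<Sum>i<d. x i * w i)"

text \<open>The case distinction encodes \<open>-log 0 = +\<infinity>\<close> (in HOL, \<open>ln 0 = 0\<close>).\<close>

definition log_loss :: "nat \<Rightarrow> (nat \<Rightarrow> real) \<Rightarrow> (nat \<Rightarrow> real) \<Rightarrow> ereal" where
  "log_loss d x w = (if dot_prod d x w > 0 then ereal (- ln (dot_prod d x w)) else \<infinity>)"

text \<open>For nonzero returns the infimum below is finite and attained, see
  \<open>best_portfolio_exists\<close>; so no difference \<open>\<infinity> - \<infinity>\<close> occurs.\<close>

definition portfolio_regret ::
    "nat \<Rightarrow> nat \<Rightarrow> (nat \<Rightarrow> nat \<Rightarrow> real) \<Rightarrow> (nat \<Rightarrow> nat \<Rightarrow> real) \<Rightarrow> ereal" where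
  "portfolio_regret d T x w =
     (\<Sum>t = 1..T. log_loss d (x t) (w t)) -
     (INF u \<in> prob_simplex d. \<Sum>t = 1..T. log_loss d (x t) u)"


section \<open>Real random-access machine\<close>

text \<open>
  A uniform real RAM, presented as a while language.  The machine has \<open>M\<close> cells of real
  memory.  Besides, a program uses finitely many index variables for loop control and
  indirect addressing.  They hold natural numbers \<open>\<le> M\<close>, so that neither input data nor
  unbounded computations can be packed into them.  The only flow of information from
  reals to indices is through comparisons; there are no floor operation and no real
  constants other than natural numbers.  An execution that addresses a cell \<open>\<ge> M\<close>, divides
  by zero, or exceeds the range of an index variable is stuck.

  Every elementary command and every evaluation of a test costs one unit.  Thus the
  cost bounds the number of arithmetic operations on reals, and also counts comparisons,
  copies and index updates.
\<close>

datatype iexp = IConst nat | IVar nat | IPlus iexp iexp | IMinus iexp iexp | ITimes iexp iexp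

datatype arith_op = Add | Sub | Mul | Divide

datatype test = ILess iexp iexp | RLess iexp iexp | TNot test

text \<open>In \<open>RLess\<close>, \<open>RConst\<close>, \<open>RCopy\<close> and \<open>RArith\<close>, index expressions denote addresses of
  real cells, the first one being the target of an assignment; only the second argument of
  \<open>RConst\<close> is a number, to be stored as a real.\<close>

datatype com =
    Skip
  | IAssign nat iexp
  | RConst iexp iexp
  | RCopy iexp iexp
  | RArith arith_op iexp iexp iexp
  | Seq com com
  | Cond test com com
  | While test com

type_synonym ram_state = "(nat \<Rightarrow> nat) \<times> (nat \<Rightarrow> real)"

fun ival :: "iexp \<Rightarrow> (nat \<Rightarrow> nat) \<Rightarrow> nat" where
  "ival (IConst n) v = n"
| "ival (IVar k) v = v k"
| "ival (IPlus a b) v = ival a v + ival b v"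
| "ival (IMinus a b) v = ival a v - ival b v"
| "ival (ITimes a b) v = ival a v * ival b v"

fun arith_val :: "arith_op \<Rightarrow> real \<Rightarrow> real \<Rightarrow> real" where
  "arith_val Add x y = x + y"
| "arith_val Sub x y = x - y"
| "arith_val Mul x y = x * y"
| "arith_val Divide x y = x / y"

fun test_val :: "test \<Rightarrow> ram_state \<Rightarrow> bool" where
  "test_val (ILess a b) (v, m) = (ival a v < ival b v)"
| "test_val (RLess a b) (v, m) = (m (ival a v) < m (ival b v))"
| "test_val (TNot b) s = (\<not> test_val b s)"

fun test_ok :: "nat \<Rightarrow> test \<Rightarrow> ram_state \<Rightarrow> bool" where
  "test_ok M (ILess a b) s = True"
| "test_ok M (RLess a b) (v, m) = (ival a v < M \<and> ival b v < M)"
| "test_ok M (TNot b) s = test_ok M b s"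

text \<open>\<open>exec M c s n s'\<close>: on a machine with \<open>M\<close> real cells, \<open>c\<close> started in \<open>s\<close> terminates in
  \<open>s'\<close> at cost \<open>n\<close>.\<close>

inductive exec :: "nat \<Rightarrow> com \<Rightarrow> ram_state \<Rightarrow> nat \<Rightarrow> ram_state \<Rightarrow> bool" for M :: nat where
  Skip: "exec M Skip s 1 s"
| IAssign: "ival a v \<le> M \<Longrightarrow> exec M (IAssign k a) (v, m) 1 (v(k := ival a v), m)"
| RConst: "ival a v < M \<Longrightarrow> exec M (RConst a b) (v, m) 1 (v, m(ival a v := real (ival b v)))"
| RCopy: "ival a v < M \<Longrightarrow> ival b v < M \<Longrightarrow>
    exec M (RCopy a b) (v, m) 1 (v, m(ival a v := m (ival b v)))"
| RArith: "ival a v < M \<Longrightarrow> ival b v < M \<Longrightarrow> ival c v < M \<Longrightarrow>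
    (f = Divide \<Longrightarrow> m (ival c v) \<noteq> 0) \<Longrightarrow>
    exec M (RArith f a b c) (v, m) 1
      (v, m(ival a v := arith_val f (m (ival b v)) (m (ival c v))))"
| Seq: "exec M c1 s n1 s' \<Longrightarrow> exec M c2 s' n2 s'' \<Longrightarrow> exec M (Seq c1 c2) s (n1 + n2) s''"
| CondT: "test_ok M b s \<Longrightarrow> test_val b s \<Longrightarrow> exec M c1 s n s' \<Longrightarrow>
    exec M (Cond b c1 c2) s (Suc n) s'"
| CondF: "test_ok M b s \<Longrightarrow> \<not> test_val b s \<Longrightarrow> exec M c2 s n s' \<Longrightarrow>
    exec M (Cond b c1 c2) s (Suc n) s'"
| WhileF: "test_ok M b s \<Longrightarrow> \<not> test_val b s \<Longrightarrow> exec M (While b c) s 1 s"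
| WhileT: "test_ok M b s \<Longrightarrow> test_val b s \<Longrightarrow> exec M c s n1 s' \<Longrightarrow>
    exec M (While b c) s' n2 s'' \<Longrightarrow> exec M (While b c) s (Suc (n1 + n2)) s''"

inductive_cases exec_elims:
  "exec M Skip s n s'"
  "exec M (IAssign k a) s n s'"
  "exec M (RConst a b) s n s'"
  "exec M (RCopy a b) s n s'"
  "exec M (RArith f a b c) s n s'"
  "exec M (Seq c1 c2) s n s'"
  "exec M (Cond b c1 c2) s n s'"
  "exec M (While b c) s n s'"

lemma exec_deterministic:
  "exec M c s n s' \<Longrightarrow> exec M c s k r \<Longrightarrow> k = n \<and> r = s'"
proof (induction arbitrary: k r rule: exec.induct)
  case (Seq c1 s n1 s' c2 n2 s'')
  from Seq.prems obtain m1 r' m2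
    where r: "k = m1 + m2" "exec M c1 s m1 r'" "exec M c2 r' m2 r"
    by (rule exec_elims(6))
  then show ?case using Seq.IH(1)[OF r(2)] Seq.IH(2)[of m2 r] by simp
next
  case (CondT b s c1 n s' c2)
  from CondT.prems show ?case using CondT.hyps(2)
    by (cases rule: exec_elims(7)) (use CondT.IH in blast)+
next
  case (CondF b s c2 n s' c1)
  from CondF.prems show ?case using CondF.hyps(2)
    by (cases rule: exec_elims(7)) (use CondF.IH in blast)+
next
  case (WhileF b s c)
  from WhileF.prems show ?case using WhileF.hyps(2)
    by (cases rule: exec_elims(8)) auto
next
  case (WhileT b s c n1 s' n2 s'')
  from WhileT.prems obtain m1 r' m2
    where r: "k = Suc (m1 + m2)" "exec M c s m1 r'" "exec M (While b c) r' m2 r"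
    by (rule exec_elims(8)) (use WhileT.hyps(2) in blast)+
  then show ?case using WhileT.IH(1)[OF r(2)] WhileT.IH(2)[of m2 r] by simp
qed (auto elim: exec_elims(1-5))


section \<open>Portfolio selection algorithms\<close>

text \<open>
  An algorithm consists of two programs, independent of \<open>d\<close> and \<open>T\<close>.  The first one finds
  \<open>d\<close> and \<open>T\<close> in the index variables 0 and 1, all else being zero, and computes the first
  portfolio.  In every later round the second one resumes from the state the previous round
  left behind, with the latest return vector written to the cells \<open>d, \<dots>, 2 d - 1\<close>.  Portfolios are
  delivered in the cells \<open>0, \<dots>, d - 1\<close>.  Past returns are available only as far as the
  algorithm keeps them in its own \<open>M\<close> cells.
\<close>

type_synonym algorithm = "com \<times> com"

definition start_state :: "nat \<Rightarrow> nat \<Rightarrow> ram_state" where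
  "start_state d T = ((\<lambda>_. 0)(0 := d, 1 := T), \<lambda>_. 0)"

definition feed :: "nat \<Rightarrow> (nat \<Rightarrow> real) \<Rightarrow> ram_state \<Rightarrow> ram_state" where
  "feed d x s = (fst s, \<lambda>i. if d \<le> i \<and> i < 2 * d then x (i - d) else snd s i)"

definition delivered :: "nat \<Rightarrow> ram_state \<Rightarrow> nat \<Rightarrow> real" where
  "delivered d s = (\<lambda>i. if i < d then snd s i else 0)"

text \<open>\<open>plays M A d T x w k\<close>: with \<open>M\<close> real cells and returns \<open>x 1, \<dots>, x T\<close>, algorithm \<open>A\<close>
  chooses the portfolios \<open>w 1, \<dots>, w T\<close>, spending \<open>k t\<close> operations in round \<open>t\<close>.  The bounds on \<open>M\<close>
  say that the machine can hold the input and output vectors and the initial indices.\<close>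

definition plays ::
    "nat \<Rightarrow> algorithm \<Rightarrow> nat \<Rightarrow> nat \<Rightarrow> (nat \<Rightarrow> nat \<Rightarrow> real) \<Rightarrow> (nat \<Rightarrow> nat \<Rightarrow> real) \<Rightarrow> (nat \<Rightarrow> nat) \<Rightarrow> bool" where
  "plays M A d T x w k \<longleftrightarrow>
     2 * d \<le> M \<and> T \<le> M \<and>
     (\<exists>\<sigma>. exec M (fst A) (start_state d T) (k 1) (\<sigma> 1) \<and>
          (\<forall>t\<in>{1..<T}. exec M (snd A) (feed d (x t) (\<sigma> t)) (k (Suc t)) (\<sigma> (Suc t))) \<and>
          (\<forall>t\<in>{1..T}. w t = delivered d (\<sigma> t)))"

text \<open>The portfolio of round \<open>t\<close> is a function of the returns of the rounds before \<open>t\<close>.\<close>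

lemma plays_causal:
  assumes "plays M A d T x w k" "plays M A d T x' w' k'"
    and "t \<in> {1..T}" and eq: "\<And>s i. 1 \<le> s \<Longrightarrow> s < t \<Longrightarrow> i < d \<Longrightarrow> x s i = x' s i"
  shows "w t = w' t \<and> k t = k' t"
proof -
  from assms(1) obtain \<sigma> where s1: "exec M (fst A) (start_state d T) (k 1) (\<sigma> 1)"
    and s2: "\<forall>t\<in>{1..<T}. exec M (snd A) (feed d (x t) (\<sigma> t)) (k (Suc t)) (\<sigma> (Suc t))"
    and s3: "\<forall>t\<in>{1..T}. w t = delivered d (\<sigma> t)"
    unfolding plays_def by blast
  from assms(2) obtain \<tau> where r1: "exec M (fst A) (start_state d T) (k' 1) (\<tau> 1)"
    and r2: "\<forall>t\<in>{1..<T}. exec M (snd A) (feed d (x' t) (\<tau> t)) (k' (Suc t)) (\<tau> (Suc t))"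
    and r3: "\<forall>t\<in>{1..T}. w' t = delivered d (\<tau> t)"
    unfolding plays_def by blast
  have "u \<le> t \<Longrightarrow> \<sigma> u = \<tau> u \<and> k u = k' u" if "u \<ge> 1" for u
    using that
  proof (induction u rule: nat_induct_at_least)
    case base
    show ?case using exec_deterministic[OF s1 r1] by simp
  next
    case (Suc u)
    then have "x u i = x' u i" if "i < d" for i using eq that by simp
    then have "feed d (x u) (\<sigma> u) = feed d (x' u) (\<tau> u)"
      using Suc by (auto simp: feed_def fun_eq_iff)
    moreover have "u \<in> {1..<T}" using Suc assms(3) by simp
    ultimately show ?case using s2 r2 exec_deterministic by metis
  qed
  then show ?thesis using assms(3) s3 r3 by simp
qed


section \<open>The comparator of the regret is a minimum\<close>

lemma compact_prob_simplex: "compact (prob_simplex d)"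
proof -
  have "compactin (product_topology (\<lambda>i. euclidean) UNIV)
      (PiE UNIV (\<lambda>i::nat. if i < d then {0..1::real} else {0}))"
    by (subst compactin_PiE) auto
  then have c: "compact (PiE UNIV (\<lambda>i::nat. if i < d then {0..1::real} else {0}))"
    by (simp add: euclidean_product_topology)
  have le: "w i \<le> 1" if "w \<in> prob_simplex d" "i < d" for w i
  proof -
    have "w i \<le> (\<Sum>i<d. w i)"
      using that by (intro member_le_sum) (auto simp: prob_simplex_def orthant_def)
    then show ?thesis using that by (simp add: prob_simplex_def)
  qed
  have "closed {w :: nat \<Rightarrow> real. (\<Sum>i<d. w i) = 1}"
    by (intro closed_Collect_eq continuous_intros) (auto simp: continuous_on_product_coordinates)
  then have "compact (PiE UNIV (\<lambda>i::nat. if i < d then {0..1::real} else {0}) \<inter> {w. (\<Sum>i<d. w i) = 1})"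
    using c by (rule compact_Int_closed[rotated])
  moreover have "PiE UNIV (\<lambda>i::nat. if i < d then {0..1::real} else {0}) \<inter> {w. (\<Sum>i<d. w i) = 1}
      = prob_simplex d"
    using le by (auto simp: prob_simplex_def orthant_def PiE_def Pi_def split: if_splits)
  ultimately show ?thesis by simp
qed

lemma best_portfolio_exists:
  fixes d T :: nat and x :: "nat \<Rightarrow> nat \<Rightarrow> real"
  assumes d: "d \<ge> 1" and x: "\<And>t. t \<in> {1..T} \<Longrightarrow> x t \<in> orthant d - {\<lambda>_. 0}"
  obtains u where "u \<in> prob_simplex d"
    "(INF u \<in> prob_simplex d. \<Sum>t = 1..T. log_loss d (x t) u) = (\<Sum>t = 1..T. log_loss d (x t) u)"
    "\<bar>\<Sum>t = 1..T. log_loss d (x t) u\<bar> \<noteq> \<infinity>"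
proof -
  define F where "F w = (\<Prod>t = 1..T. dot_prod d (x t) w)" for w
  define e where "e = (\<lambda>i. if i < d then 1 / real d else 0)"
  have e: "e \<in> prob_simplex d"
    using d by (auto simp: e_def prob_simplex_def orthant_def)
  have pos: "dot_prod d (x t) w \<ge> 0" if "t \<in> {1..T}" "w \<in> prob_simplex d" for t w
    using x[OF that(1)] that(2)
    by (auto simp: dot_prod_def orthant_def prob_simplex_def intro!: sum_nonneg)
  have epos: "dot_prod d (x t) e > 0" if t: "t \<in> {1..T}" for t
  proof -
    obtain i where i: "x t i \<noteq> 0" using x[OF t] by fastforce
    have "i < d" using x[OF t] i by (auto simp: orthant_def not_le[symmetric])
    then have "x t i > 0" using x[OF t] i by (auto simp: orthant_def order_less_le)
    with \<open>i < d\<close> show ?thesis unfolding dot_prod_def using x[OF t] d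
      by (intro sum_pos2[of _ i]) (auto simp: e_def orthant_def)
  qed
  have "continuous_on (prob_simplex d) F" unfolding F_def dot_prod_def
    by (intro continuous_intros continuous_on_subset[OF continuous_on_product_coordinates]) auto
  with compact_prob_simplex e obtain u where u: "u \<in> prob_simplex d"
    and umax: "\<And>w. w \<in> prob_simplex d \<Longrightarrow> F w \<le> F u"
    by (metis continuous_attains_sup empty_iff)
  have "F e > 0" unfolding F_def using epos by (intro prod_pos) auto
  then have Fu: "F u > 0" using umax[OF e] by simp
  have val: "(\<Sum>t = 1..T. log_loss d (x t) w) = (if F w > 0 then ereal (- ln (F w)) else \<infinity>)"
    if w: "w \<in> prob_simplex d" for w
  proof (cases "\<forall>t\<in>{1..T}. dot_prod d (x t) w > 0")
    case True
    then have "F w > 0" unfolding F_def by (intro prod_pos) auto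
    moreover have "(\<Sum>t = 1..T. log_loss d (x t) w) = (\<Sum>t = 1..T. ereal (- ln (dot_prod d (x t) w)))"
      using True by (intro sum.cong) (auto simp: log_loss_def)
    moreover have "ln (F w) = (\<Sum>t = 1..T. ln (dot_prod d (x t) w))"
    proof -
      have "dot_prod d (x t) w \<noteq> 0" if "t \<in> {1..T}" for t using True that by fastforce
      then show ?thesis unfolding F_def by (intro ln_prod) simp_all
    qed
    ultimately show ?thesis by (simp add: sum_negf)
  next
    case False
    then obtain t where t: "t \<in> {1..T}" "dot_prod d (x t) w = 0"
      using pos[OF _ w] by force
    then have "F w = 0" unfolding F_def by (meson finite_atLeastAtMost prod_zero)
    moreover have "(\<Sum>t = 1..T. log_loss d (x t) w) = \<infinity>"
      unfolding sum_Pinfty using t by (auto simp: log_loss_def intro!: bexI[of _ t])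
    ultimately show ?thesis by simp
  qed
  have "(INF u \<in> prob_simplex d. \<Sum>t = 1..T. log_loss d (x t) u) = (\<Sum>t = 1..T. log_loss d (x t) u)"
  proof (rule antisym)
    show "(\<Sum>t = 1..T. log_loss d (x t) u) \<le> (INF u \<in> prob_simplex d. \<Sum>t = 1..T. log_loss d (x t) u)"
      using Fu umax by (intro INF_greatest) (simp only: val u, auto)
  qed (rule INF_lower[OF u])
  moreover have "\<bar>\<Sum>t = 1..T. log_loss d (x t) u\<bar> \<noteq> \<infinity>"
    unfolding val[OF u] using Fu by simp
  ultimately show thesis by (rule that[OF u])
qed

end

theory Submission imports Defs begin

text \<open>
  The algorithm is follow-the-regularised-leader with a hybrid barrier.  After \<open>n\<close> rounds it
  looks at the potential \<open>L + \<mu> V\<close> on the open orthant.  Here \<open>L w\<close> is the cumulative logarithmic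
  loss plus the logarithmic barrier \<open>- \<lambda> (\<Sum>i. ln (w i))\<close>, and \<open>V w\<close> is half the logarithm of the
  determinant of the Hessian \<open>H\<close> of \<open>L\<close> at \<open>w\<close>; the constants are \<open>\<lambda> = 400\<close> and \<open>\<mu> = 6\<close>.

  The determinant pays for the regret.  A new return \<open>x\<close> played against \<open>w\<close> has a leverage score
  \<open>\<sigma> = x\<^sup>T H\<^sup>-\<^sup>1 x / (x\<^sup>T w)\<^sup>2\<close>, which is the squared dual local norm of the gradient of the new
  loss, and it raises \<open>V w\<close> by at least \<open>\<sigma> / 2\<close> (\<open>vol_Suc\<close>).  On the other hand every leverage
  score is at most \<open>1 / \<lambda>\<close> (\<open>lev_le\<close>), so that the gradient of the whole potential changes by
  little more than \<open>sqrt \<sigma>\<close> (\<open>dpot_Suc\<close>), and re-optimising gains only a small multiple of \<open>\<sigma>\<close>.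
  With \<open>\<mu> = 6\<close> the rise of \<open>\<mu> V\<close> exceeds that gain, and the losses telescope: their sum is at
  most the final potential at the final portfolio minus the initial potential
  (\<open>iterate_invariant\<close>).  The final potential is then compared with its value at the best
  portfolio mixed with a little of the uniform one, where both barriers are of the order
  \<open>d ln (T + d)\<close> (\<open>pot_near_min\<close>, \<open>ldet_le\<close>, \<open>iterate_regret\<close>).

  The minimiser need not be computed exactly; one Newton step per round suffices.  Since the
  leverage scores are at most \<open>1 / \<lambda>\<close>, the second derivative of \<open>V\<close> is nonnegative and at most
  \<open>5 / \<lambda>\<close> times \<open>H\<close> (\<open>hess_nonneg\<close>, \<open>hess_bound\<close>).  So \<open>H\<close> alone is an excellent substitute for
  the Hessian of the potential, and a step with \<open>H\<close>, constrained to keep the sum of the coordinates,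
  divides the dual norm \<open>\<delta>\<close> of the gradient by four (\<open>newton_step_improves\<close>).  The error left
  over is amortised by a term \<open>3 \<delta>\<^sup>2\<close> in the telescoping sum.

  Determinants and inverses need no matrix theory here.  Both \<open>L\<close> and \<open>H\<close> are sums over atoms, the
  coordinate vectors and the returns seen so far, and the Sherman--Morrison formula gives the
  bilinear form of \<open>H\<^sup>-\<^sup>1\<close> by recursion over the atoms (\<open>kern\<close>).  The denominators of this
  recursion give the log-determinant (\<open>ldet\<close>), and the derivatives of both follow by induction.
  The same recursion is what the program executes, with \<open>O(d\<^sup>2)\<close> operations per past return, hence
  \<open>O(d\<^sup>2 T)\<close> per round.  The memory is read as a matrix whose rows have length \<open>d\<close>, which makes
  the returns, the portfolio and the rows of \<open>H\<^sup>-\<^sup>1\<close> equally easy to address; a cost-aware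
  weakest-precondition calculus for such memories (\<open>runs\<close>) verifies the program.
\<close>

section \<open>Inverses of sums of rank-one matrices\<close>

text \<open>
  The atoms \<open>b 0, \<dots>, b (d - 1)\<close> are the coordinate vectors, the later ones are data.  A weight
  function \<open>\<omega>\<close> stands for the matrix \<open>\<Sum>r. \<omega> r * b r (b r)\<^sup>T\<close>, whose coordinate part is diagonal
  and thus easy to invert.
\<close>

locale atoms =
  fixes d :: nat and b :: "nat \<Rightarrow> nat \<Rightarrow> real"
  assumes unit: "\<And>i j. i < d \<Longrightarrow> b i j = (if j = i then 1 else 0)"
begin

abbreviation ip :: "(nat \<Rightarrow> real) \<Rightarrow> (nat \<Rightarrow> real) \<Rightarrow> real" (infixl "\<odot>" 70) where
  "x \<odot> y \<equiv> dot_prod d x y"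

lemma ip_commute: "x \<odot> y = y \<odot> x"
  by (simp add: dot_prod_def mult.commute)

lemma ip_unit: "i < d \<Longrightarrow> b i \<odot> y = y i"
  by (simp add: dot_prod_def unit if_distrib[of "\<lambda>u. u * _"] cong: if_cong)

text \<open>
  The bilinear form of the inverse of the matrix of the coordinate atoms and the first \<open>n\<close> data
  atoms, by the Sherman--Morrison formula.
\<close>

primrec kern :: "(nat \<Rightarrow> real) \<Rightarrow> nat \<Rightarrow> (nat \<Rightarrow> real) \<Rightarrow> (nat \<Rightarrow> real) \<Rightarrow> real" where
  "kern \<omega> 0 x y = (\<Sum>i<d. x i * y i / \<omega> i)"
| "kern \<omega> (Suc n) x y = kern \<omega> n x y -
     \<omega> (d + n) * kern \<omega> n x (b (d + n)) * kern \<omega> n (b (d + n)) y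
       / (1 + \<omega> (d + n) * kern \<omega> n (b (d + n)) (b (d + n)))"

lemma kern_commute: "kern \<omega> n x y = kern \<omega> n y x"
proof (induction n arbitrary: x y)
  case 0
  show ?case by (simp add: mult.commute)
next
  case (Suc n)
  show ?case
    using Suc[of x y] Suc[of x "b (d + n)"] Suc[of "b (d + n)" y] by (simp add: mult_ac)
qed

lemma kern_expand: "kern \<omega> n x y = (\<Sum>i<d. y i * kern \<omega> n x (b i))"
proof (induction n arbitrary: x y)
  case 0
  have "(\<Sum>j<d. x j * b i j / \<omega> j) = x i / \<omega> i" if "i < d" for i
    using that by (simp add: unit if_distrib[of "\<lambda>u. _ * u"] if_distrib[of "\<lambda>u. u / _"] cong: if_cong)
  then show ?case by (simp add: mult_ac)
next
  case (Suc n)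
  let ?a = "b (d + n)"
  define c where "c = \<omega> (d + n) * kern \<omega> n x ?a / (1 + \<omega> (d + n) * kern \<omega> n ?a ?a)"
  have rec: "kern \<omega> (Suc n) x z = kern \<omega> n x z - c * kern \<omega> n ?a z" for z
    by (simp add: c_def)
  have "(\<Sum>i<d. y i * kern \<omega> (Suc n) x (b i))
      = (\<Sum>i<d. y i * kern \<omega> n x (b i)) - c * (\<Sum>i<d. y i * kern \<omega> n ?a (b i))"
    unfolding rec by (simp add: sum_subtractf sum_distrib_left algebra_simps)
  then show ?case unfolding rec using Suc[of x y] Suc[of ?a y] by simp
qed

lemma kern_unit_ip: "(\<lambda>i. kern \<omega> n (b i) y) \<odot> x = kern \<omega> n x y"
  using kern_expand[of \<omega> n y x] by (simp add: dot_prod_def kern_commute mult.commute)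

lemma kern_diff: "kern \<omega> n x (\<lambda>i. p * y i - q * z i) = p * kern \<omega> n x y - q * kern \<omega> n x z"
  by (simp add: kern_expand[of \<omega> n x "\<lambda>i. p * y i - q * z i"] kern_expand[of \<omega> n x y]
      kern_expand[of \<omega> n x z] sum_subtractf sum_distrib_left algebra_simps)

text \<open>
  The Sherman--Morrison formula is correct: an update of the inverse with a new atom \<open>a\<close> compensates the
  new summand, because the coefficient \<open>c\<close> below solves \<open>\<omega> (k(x, a) - c k(a, a)) = c\<close>.
\<close>

lemma kern_inverse:
  assumes "\<And>i. i < d \<Longrightarrow> \<omega> i \<noteq> 0"
    and "\<And>s. s < n \<Longrightarrow> 1 + \<omega> (d + s) * kern \<omega> s (b (d + s)) (b (d + s)) \<noteq> 0"
  shows "(\<Sum>r<d+n. \<omega> r * (kern \<omega> n x (b r) * (b r \<odot> h))) = x \<odot> h"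
  using assms(2)
proof (induction n arbitrary: x)
  case 0
  have "kern \<omega> 0 x (b i) = x i / \<omega> i" if "i < d" for i
    using that by (simp add: unit if_distrib[of "\<lambda>u. _ * u"] if_distrib[of "\<lambda>u. u / _"] cong: if_cong)
  then have "(\<Sum>r<d+0. \<omega> r * (kern \<omega> 0 x (b r) * (b r \<odot> h))) = (\<Sum>r<d. x r * h r)"
    using assms(1) by (intro sum.cong) (auto simp del: kern.simps simp: ip_unit)
  then show ?case by (simp add: dot_prod_def)
next
  case (Suc n)
  let ?a = "b (d + n)"
  define c where "c = \<omega> (d + n) * kern \<omega> n x ?a / (1 + \<omega> (d + n) * kern \<omega> n ?a ?a)"
  have rec: "kern \<omega> (Suc n) x z = kern \<omega> n x z - c * kern \<omega> n ?a z" for z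
    by (simp add: c_def)
  have IH: "(\<Sum>r<d+n. \<omega> r * (kern \<omega> n x (b r) * (b r \<odot> h))) = x \<odot> h" for x
    using Suc by simp
  have "1 + \<omega> (d + n) * kern \<omega> n ?a ?a \<noteq> 0" using Suc.prems[of n] by simp
  then have c: "\<omega> (d + n) * (kern \<omega> n x ?a - c * kern \<omega> n ?a ?a) = c"
    unfolding c_def by (simp add: field_simps)
  have "(\<Sum>r<d + Suc n. \<omega> r * (kern \<omega> (Suc n) x (b r) * (b r \<odot> h)))
     = (\<Sum>r<d+n. \<omega> r * (kern \<omega> n x (b r) * (b r \<odot> h)))
       - c * (\<Sum>r<d+n. \<omega> r * (kern \<omega> n ?a (b r) * (b r \<odot> h)))
       + \<omega> (d + n) * (kern \<omega> n x ?a - c * kern \<omega> n ?a ?a) * (?a \<odot> h)"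
    unfolding rec by (simp add: sum_subtractf sum_distrib_left algebra_simps)
  then show ?case unfolding IH c by simp
qed

text \<open>
  The matrix identity \<open>B H B = B\<close> for the inverse \<open>B\<close> of \<open>H\<close>.
\<close>

lemma kern_reproducing:
  assumes "\<And>i. i < d \<Longrightarrow> \<omega> i \<noteq> 0"
    and "\<And>s. s < n \<Longrightarrow> 1 + \<omega> (d + s) * kern \<omega> s (b (d + s)) (b (d + s)) \<noteq> 0"
  shows "(\<Sum>r<d+n. \<omega> r * (kern \<omega> n x (b r) * kern \<omega> n (b r) y)) = kern \<omega> n x y"
  using kern_inverse[OF assms, where x = x and h = "\<lambda>i. kern \<omega> n (b i) y"]
  by (simp add: ip_commute[of _ "\<lambda>i. kern \<omega> n (b i) y"] kern_unit_ip)

text \<open>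
  By the reproducing identity \<open>kern \<omega> n x x\<close> is a weighted sum of squares.  The identity needs
  nonzero denominators, which come from the same claim for smaller \<open>n\<close>.
\<close>

lemma kern_nonneg:
  assumes "\<And>i. i < d \<Longrightarrow> \<omega> i > 0" and "\<And>r. r < d + n \<Longrightarrow> \<omega> r \<ge> 0"
  shows "kern \<omega> n x x \<ge> 0"
  using assms(2)
proof (induction n arbitrary: x rule: less_induct)
  case (less n)
  have "1 + \<omega> (d + s) * kern \<omega> s (b (d + s)) (b (d + s)) \<noteq> 0" if "s < n" for s
  proof -
    have "0 \<le> \<omega> (d + s) * kern \<omega> s (b (d + s)) (b (d + s))"
      using less.IH[OF that] less.prems that by (intro mult_nonneg_nonneg) auto
    then show ?thesis by simp
  qed
  moreover have "\<omega> i \<noteq> 0" if "i < d" for i using assms(1)[OF that] by simp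
  ultimately have "kern \<omega> n x x = (\<Sum>r<d+n. \<omega> r * (kern \<omega> n x (b r) * kern \<omega> n (b r) x))"
    by (intro kern_reproducing[symmetric]) auto
  also have "\<dots> \<ge> 0"
    unfolding kern_commute[of \<omega> n "b _" x]
    using less.prems by (intro sum_nonneg) simp
  finally show ?case by simp
qed

end

text \<open>
  Data weights may vanish, so that a path of weights can start at a diagonal matrix.
\<close>

locale weighted_atoms = atoms +
  fixes n :: nat and \<omega> :: "nat \<Rightarrow> real"
  assumes pos: "\<And>i. i < d \<Longrightarrow> \<omega> i > 0"
    and nonneg: "\<And>r. r < d + n \<Longrightarrow> \<omega> r \<ge> 0"
begin

lemma kern_nonneg': "m \<le> n \<Longrightarrow> kern \<omega> m x x \<ge> 0"
  using pos nonneg by (intro kern_nonneg) auto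

lemma denom_pos: "s < n \<Longrightarrow> 1 + \<omega> (d + s) * kern \<omega> s (b (d + s)) (b (d + s)) > 0"
  using nonneg[of "d + s"] kern_nonneg'[of s] by (intro add_pos_nonneg mult_nonneg_nonneg) auto

lemma inverse_identity: "m \<le> n \<Longrightarrow> (\<Sum>r<d+m. \<omega> r * (kern \<omega> m x (b r) * (b r \<odot> h))) = x \<odot> h"
  using pos denom_pos by (intro kern_inverse) (metis less_irrefl, metis less_irrefl less_le_trans)

lemma reproducing:
  "m \<le> n \<Longrightarrow> (\<Sum>r<d+m. \<omega> r * (kern \<omega> m x (b r) * kern \<omega> m (b r) y)) = kern \<omega> m x y"
  using pos denom_pos by (intro kern_reproducing) (metis less_irrefl, metis less_irrefl less_le_trans)

lemma kern_le: "m \<le> n \<Longrightarrow> kern \<omega> m x x \<le> kern \<omega> 0 x x"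
proof (induction m)
  case (Suc m)
  have "\<omega> (d + m) * kern \<omega> m x (b (d + m)) * kern \<omega> m (b (d + m)) x \<ge> 0"
    using nonneg[of "d + m"] Suc.prems by (auto simp: kern_commute[of \<omega> m "b (d + m)" x] mult.assoc)
  then show ?case using Suc denom_pos[of m] by (simp del: kern.simps(1) add: kern.simps(2)) (smt (verit) divide_nonneg_pos)
qed simp

end

lemma sum_lessThan_add:
  fixes f :: "nat \<Rightarrow> real"
  shows "(\<Sum>r<d+n. f r) = (\<Sum>i<d. f i) + (\<Sum>s<n. f (d + s))"
  by (induction n) (simp_all add: add.assoc)

lemma weighted_cauchy:
  fixes W f g :: "'a \<Rightarrow> real"
  assumes "\<And>i. i \<in> I \<Longrightarrow> W i \<ge> 0"
  shows "(\<Sum>i\<in>I. W i * (f i * g i))\<^sup>2 \<le> (\<Sum>i\<in>I. W i * (f i)\<^sup>2) * (\<Sum>i\<in>I. W i * (g i)\<^sup>2)"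
proof -
  have "(\<Sum>i\<in>I. (sqrt (W i) * f i) * (sqrt (W i) * g i))\<^sup>2
      \<le> (\<Sum>i\<in>I. (sqrt (W i) * f i)\<^sup>2) * (\<Sum>i\<in>I. (sqrt (W i) * g i)\<^sup>2)"
    by (rule Cauchy_Schwarz_ineq_sum)
  moreover have "(\<Sum>i\<in>I. (sqrt (W i) * f i) * (sqrt (W i) * g i)) = (\<Sum>i\<in>I. W i * (f i * g i))"
    using assms by (intro sum.cong) (auto simp: algebra_simps)
  moreover have "(\<Sum>i\<in>I. (sqrt (W i) * f i)\<^sup>2) = (\<Sum>i\<in>I. W i * (f i)\<^sup>2)" for f
    using assms by (intro sum.cong) (auto simp: power_mult_distrib)
  ultimately show ?thesis by simp
qed

context weighted_atoms begin

text \<open>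
  The generalised Cauchy--Schwarz inequality: \<open>kern\<close> is the dual of the quadratic form of the matrix.
\<close>

lemma ip_square_le:
  assumes m: "m \<le> n"
  shows "(x \<odot> h)\<^sup>2 \<le> kern \<omega> m x x * (\<Sum>r<d+m. \<omega> r * (b r \<odot> h)\<^sup>2)"
proof -
  have "(\<Sum>r<d+m. \<omega> r * (kern \<omega> m x (b r))\<^sup>2) = kern \<omega> m x x"
    unfolding reproducing[OF m, of x x, symmetric]
    by (intro sum.cong refl) (simp add: power2_eq_square kern_commute[of \<omega> m x "b _"])
  then show ?thesis
    using weighted_cauchy[of "{..<d+m}" \<omega> "\<lambda>r. kern \<omega> m x (b r)" "\<lambda>r. b r \<odot> h"] m nonneg
      inverse_identity[OF m, of x h] by simp
qed

lemma kern_cauchy: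
  assumes m: "m \<le> n"
  shows "(kern \<omega> m x y)\<^sup>2 \<le> kern \<omega> m x x * kern \<omega> m y y"
proof -
  have "(\<Sum>r<d+m. \<omega> r * (kern \<omega> m (b r) y)\<^sup>2) = kern \<omega> m y y"
    unfolding reproducing[OF m, of y y, symmetric]
    by (intro sum.cong refl) (simp add: power2_eq_square kern_commute[of \<omega> m "b _" y])
  then show ?thesis
    using ip_square_le[OF m, of x "\<lambda>i. kern \<omega> m (b i) y"]
    by (simp add: ip_commute[of _ "\<lambda>i. kern \<omega> m (b i) y"] kern_unit_ip)
qed

end

context atoms begin

lemma sherman_morrison_derivative_identity:
  fixes q p K o' kx ky S Sx Sy Sa :: real
  assumes "q \<noteq> 0" "p * K = q - 1"
  shows "- S - ((o' * kx * ky + p * (- Sx) * ky + p * kx * (- Sy)) * q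
      - p * kx * ky * (o' * K + p * (- Sa))) / (q * q) =
    - (S - p * kx / q * Sy - p * ky / q * Sx + (p * kx / q) * (p * ky / q) * Sa + o' * (kx / q * (ky / q)))"
proof -
  have e: "p * kx * ky * (o' * K + p * (- Sa)) = kx * ky * (o' * (p * K) - p * p * Sa)"
    by (simp add: algebra_simps)
  show ?thesis unfolding e assms(2) using assms(1) by (simp add: field_simps)
qed

text \<open>
  \<open>(H\<^sup>-\<^sup>1)' = - H\<^sup>-\<^sup>1 H' H\<^sup>-\<^sup>1\<close>, by induction along the Sherman--Morrison recursion.
\<close>

lemma kern_has_derivative:
  assumes D: "\<And>r. r < d + n \<Longrightarrow> ((\<lambda>\<tau>. \<omega> \<tau> r) has_real_derivative \<omega>' r) (at t)"
    and pos: "\<And>i. i < d \<Longrightarrow> \<omega> t i > 0" and nonneg: "\<And>r. r < d + n \<Longrightarrow> \<omega> t r \<ge> 0"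
  shows "((\<lambda>\<tau>. kern (\<omega> \<tau>) n x y) has_real_derivative
     - (\<Sum>r<d+n. \<omega>' r * (kern (\<omega> t) n x (b r) * kern (\<omega> t) n (b r) y))) (at t)"
  using assms
proof (induction n arbitrary: x y)
  case 0
  have k: "kern (\<omega> t) 0 z (b i) = z i / \<omega> t i" "kern (\<omega> t) 0 (b i) z = z i / \<omega> t i" if "i < d" for i z
    using that by (simp_all add: unit if_distrib[of "\<lambda>u. _ * u"] if_distrib[of "\<lambda>u. u * _"]
        if_distrib[of "\<lambda>u. u / _"] cong: if_cong)
  have "((\<lambda>\<tau>. kern (\<omega> \<tau>) 0 x y) has_real_derivative
      (\<Sum>i<d. - (\<omega>' i * (x i / \<omega> t i * (y i / \<omega> t i))))) (at t)"
    unfolding kern.simps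
  proof (rule DERIV_sum)
    fix i assume "i \<in> {..<d}"
    then show "((\<lambda>\<tau>. x i * y i / \<omega> \<tau> i) has_real_derivative
        - (\<omega>' i * (x i / \<omega> t i * (y i / \<omega> t i)))) (at t)"
      using 0(1)[of i] 0(2)[of i]
      by (auto intro!: derivative_eq_intros simp: field_simps)
  qed
  then show ?case by (simp del: kern.simps add: k sum_negf)
next
  case (Suc n)
  let ?a = "b (d + n)" and ?p = "\<omega> t (d + n)"
  interpret weighted_atoms d b "Suc n" "\<omega> t" using Suc.prems by unfold_locales auto
  define S where "S x y = (\<Sum>r<d+n. \<omega>' r * (kern (\<omega> t) n x (b r) * kern (\<omega> t) n (b r) y))" for x y
  have IH: "((\<lambda>\<tau>. kern (\<omega> \<tau>) n x y) has_real_derivative - S x y) (at t)" for x y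
    unfolding S_def using Suc by simp
  define k where "k = kern (\<omega> t) n"
  define q where "q = 1 + ?p * k ?a ?a"
  have q: "q \<noteq> 0" using denom_pos[of n] by (simp add: q_def k_def)
  have rec: "kern (\<omega> t) (Suc n) x y = k x y - ?p * k x ?a * k ?a y / q" for x y
    by (simp add: k_def q_def)
  define u v where "u = ?p * k x ?a / q" and "v = ?p * k ?a y / q"
  have rec1: "kern (\<omega> t) (Suc n) x z = k x z - u * k ?a z"
    and rec2: "kern (\<omega> t) (Suc n) z y = k z y - v * k z ?a" for z
    unfolding rec u_def v_def by simp_all
  have "(\<Sum>r<d + Suc n. \<omega>' r * (kern (\<omega> t) (Suc n) x (b r) * kern (\<omega> t) (Suc n) (b r) y))
    = (\<Sum>r<d+n. \<omega>' r * ((k x (b r) - u * k ?a (b r)) * (k (b r) y - v * k (b r) ?a)))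
      + \<omega>' (d + n) * ((k x ?a - u * k ?a ?a) * (k ?a y - v * k ?a ?a))"
    unfolding rec1 rec2 by simp
  also have "(\<Sum>r<d+n. \<omega>' r * ((k x (b r) - u * k ?a (b r)) * (k (b r) y - v * k (b r) ?a)))
    = S x y - u * S ?a y - v * S x ?a + u * v * S ?a ?a"
    unfolding S_def k_def[symmetric] by (simp add: sum_subtractf sum.distrib sum_distrib_left algebra_simps)
  also have "k x ?a - u * k ?a ?a = k x ?a / q"
    unfolding u_def using q by (simp add: field_simps) (simp add: q_def algebra_simps)
  also have "k ?a y - v * k ?a ?a = k ?a y / q"
    unfolding v_def using q by (simp add: field_simps) (simp add: q_def algebra_simps)
  finally have "(\<Sum>r<d + Suc n. \<omega>' r * (kern (\<omega> t) (Suc n) x (b r) * kern (\<omega> t) (Suc n) (b r) y))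
    = S x y - u * S ?a y - v * S x ?a + u * v * S ?a ?a + \<omega>' (d + n) * (k x ?a / q * (k ?a y / q))" .
  then have eq: "(\<Sum>r<d + Suc n. \<omega>' r * (kern (\<omega> t) (Suc n) x (b r) * kern (\<omega> t) (Suc n) (b r) y))
    = S x y - ?p * k x ?a / q * S ?a y - ?p * k ?a y / q * S x ?a
      + (?p * k x ?a / q) * (?p * k ?a y / q) * S ?a ?a
      + \<omega>' (d + n) * (k x ?a / q * (k ?a y / q))"
    unfolding u_def v_def .
  have D: "((\<lambda>\<tau>. kern (\<omega> \<tau>) (Suc n) x y) has_real_derivative
     - S x y - ((\<omega>' (d+n) * k x ?a * k ?a y + ?p * (- S x ?a) * k ?a y + ?p * k x ?a * (- S ?a y)) * q
      - ?p * k x ?a * k ?a y * (\<omega>' (d+n) * k ?a ?a + ?p * (- S ?a ?a))) / (q * q)) (at t)"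
    unfolding kern.simps using q Suc.prems(1)[of "d + n"]
    by (auto intro!: derivative_eq_intros IH simp: k_def q_def algebra_simps)
  have "- S x y - ((\<omega>' (d+n) * k x ?a * k ?a y + ?p * (- S x ?a) * k ?a y + ?p * k x ?a * (- S ?a y)) * q
      - ?p * k x ?a * k ?a y * (\<omega>' (d+n) * k ?a ?a + ?p * (- S ?a ?a))) / (q * q) =
    - (S x y - ?p * k x ?a / q * S ?a y - ?p * k ?a y / q * S x ?a
      + (?p * k x ?a / q) * (?p * k ?a y / q) * S ?a ?a
      + \<omega>' (d + n) * (k x ?a / q * (k ?a y / q)))"
    by (rule sherman_morrison_derivative_identity[OF q]) (simp add: q_def)
  with D show ?case unfolding eq by (simp only:)
qed

section \<open>The log-determinant\<close>

text \<open>
  The logarithm of the determinant, by the matrix determinant lemma: each rank-one update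
  multiplies the determinant by the denominator of the Sherman--Morrison formula.
\<close>

definition ldet :: "(nat \<Rightarrow> real) \<Rightarrow> nat \<Rightarrow> real" where
  "ldet \<omega> n = (\<Sum>i<d. ln (\<omega> i)) + (\<Sum>s<n. ln (1 + \<omega> (d + s) * kern \<omega> s (b (d + s)) (b (d + s))))"

text \<open>
  Jacobi's formula \<open>(ln det H)' = tr (H\<^sup>-\<^sup>1 H')\<close>.
\<close>

lemma ldet_has_derivative:
  assumes D: "\<And>r. r < d + n \<Longrightarrow> ((\<lambda>\<tau>. \<omega> \<tau> r) has_real_derivative \<omega>' r) (at t)"
    and pos: "\<And>i. i < d \<Longrightarrow> \<omega> t i > 0" and nonneg: "\<And>r. r < d + n \<Longrightarrow> \<omega> t r \<ge> 0"
  shows "((\<lambda>\<tau>. ldet (\<omega> \<tau>) n) has_real_derivative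
     (\<Sum>r<d+n. \<omega>' r * kern (\<omega> t) n (b r) (b r))) (at t)"
  using assms
proof (induction n)
  case 0
  have k: "kern (\<omega> t) 0 (b i) (b i) = 1 / \<omega> t i" if "i < d" for i
    using that by (simp add: unit if_distrib[of "\<lambda>u. _ * u"] if_distrib[of "\<lambda>u. u * _"]
        if_distrib[of "\<lambda>u. u / _"] cong: if_cong)
  have "((\<lambda>\<tau>. \<Sum>i<d. ln (\<omega> \<tau> i)) has_real_derivative (\<Sum>i<d. \<omega>' i * (1 / \<omega> t i))) (at t)"
  proof (rule DERIV_sum)
    fix i assume "i \<in> {..<d}"
    then show "((\<lambda>\<tau>. ln (\<omega> \<tau> i)) has_real_derivative \<omega>' i * (1 / \<omega> t i)) (at t)"
      using 0(1)[of i] 0(2)[of i] by (auto intro!: derivative_eq_intros simp: field_simps)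
  qed
  then show ?case by (simp del: kern.simps add: k ldet_def)
next
  case (Suc n)
  let ?a = "b (d + n)" and ?p = "\<omega> t (d + n)"
  interpret weighted_atoms d b "Suc n" "\<omega> t" using Suc.prems by unfold_locales auto
  define k where "k = kern (\<omega> t) n"
  define q where "q = 1 + ?p * k ?a ?a"
  have q: "q > 0" using denom_pos[of n] by (simp add: q_def k_def)
  have k1: "((\<lambda>\<tau>. kern (\<omega> \<tau>) n ?a ?a) has_real_derivative
     - (\<Sum>r<d+n. \<omega>' r * (k ?a (b r) * k (b r) ?a))) (at t)"
    unfolding k_def by (rule kern_has_derivative) (use Suc.prems in auto)
  have rec: "kern (\<omega> t) (Suc n) x y = k x y - ?p * k x ?a * k ?a y / q" for x y
    by (simp add: k_def q_def)
  define v where "v = ?p / q"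
  have rec1: "kern (\<omega> t) (Suc n) z z = k z z - v * (k ?a z * k z ?a)" for z
    unfolding rec v_def using kern_commute[of "\<omega> t" n z ?a] by (simp add: k_def)
  have "(\<Sum>r<d + Suc n. \<omega>' r * kern (\<omega> t) (Suc n) (b r) (b r))
     = (\<Sum>r<d+n. \<omega>' r * k (b r) (b r)) - v * (\<Sum>r<d+n. \<omega>' r * (k ?a (b r) * k (b r) ?a))
       + \<omega>' (d + n) * (k ?a ?a - v * (k ?a ?a * k ?a ?a))"
    unfolding rec1 by (simp add: sum_subtractf sum_distrib_left algebra_simps)
  also have "k ?a ?a - v * (k ?a ?a * k ?a ?a) = k ?a ?a / q"
    unfolding v_def using q by (simp add: field_simps) (simp add: q_def algebra_simps)
  finally have eq: "(\<Sum>r<d + Suc n. \<omega>' r * kern (\<omega> t) (Suc n) (b r) (b r))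
     = (\<Sum>r<d+n. \<omega>' r * k (b r) (b r)) +
       (\<omega>' (d + n) * k ?a ?a + ?p * - (\<Sum>r<d+n. \<omega>' r * (k ?a (b r) * k (b r) ?a))) / q"
    unfolding v_def using q by (simp add: field_simps)
  have "ldet \<omega> (Suc n) = ldet \<omega> n + ln (1 + \<omega> (d + n) * kern \<omega> n ?a ?a)" for \<omega>
    by (simp add: ldet_def)
  moreover have "((\<lambda>\<tau>. ldet (\<omega> \<tau>) n) has_real_derivative (\<Sum>r<d+n. \<omega>' r * k (b r) (b r))) (at t)"
    unfolding k_def using Suc by simp
  moreover have "((\<lambda>\<tau>. ln (1 + \<omega> \<tau> (d + n) * kern (\<omega> \<tau>) n ?a ?a)) has_real_derivative
      (\<omega>' (d + n) * k ?a ?a + ?p * - (\<Sum>r<d+n. \<omega>' r * (k ?a (b r) * k (b r) ?a))) / q) (at t)"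
    using q Suc.prems(1)[of "d + n"] by (auto intro!: derivative_eq_intros k1 simp: k_def q_def)
  ultimately show ?case unfolding eq by (auto intro: DERIV_add)
qed

lemma ldet_no_data:
  assumes "\<And>s. s < n \<Longrightarrow> \<omega> (d + s) = 0"
  shows "ldet \<omega> n = (\<Sum>i<d. ln (\<omega> i))"
  using assms by (simp add: ldet_def)

end

lemma square_sum_convex:
  fixes p y :: "nat \<Rightarrow> real"
  assumes "\<And>i. i < d \<Longrightarrow> 0 \<le> p i"
  shows "(\<Sum>i<d. p i * y i)\<^sup>2 \<le> (\<Sum>i<d. p i) * (\<Sum>i<d. p i * (y i)\<^sup>2)"
  using weighted_cauchy[of "{..<d}" p "\<lambda>_. 1" y] assms by simp

context weighted_atoms begin

text \<open>
  In the semidefinite order, \<open>x x\<^sup>T / (x\<^sup>T w)\<^sup>2\<close> is at most the diagonal matrix with entries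
  \<open>1 / (w i)\<^sup>2\<close>, since \<open>(x\<^sup>T h) / (x\<^sup>T w)\<close> is a convex combination of the \<open>h i / w i\<close>.  This is the trace
  of that comparison against the inverse matrix.
\<close>

lemma kern_le_trace:
  assumes x: "\<And>i. i < d \<Longrightarrow> x i \<ge> 0" and w: "\<And>i. i < d \<Longrightarrow> w i > 0"
  shows "kern \<omega> n x x \<le> (x \<odot> w)\<^sup>2 * (\<Sum>i<d. kern \<omega> n (b i) (b i) / (w i)\<^sup>2)"
proof -
  define \<kappa> where "\<kappa> i = sqrt (kern \<omega> n (b i) (b i))" for i
  have \<kappa>: "(\<kappa> i)\<^sup>2 = kern \<omega> n (b i) (b i)" and \<kappa>0: "\<kappa> i \<ge> 0" for i
    using kern_nonneg'[of n "b i"] by (simp_all add: \<kappa>_def)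
  have kij: "kern \<omega> n (b i) (b j) \<le> \<kappa> i * \<kappa> j" for i j
  proof -
    have "\<bar>kern \<omega> n (b i) (b j)\<bar> \<le> \<bar>\<kappa> i * \<kappa> j\<bar>"
      using kern_cauchy[of n "b i" "b j"] by (simp only: abs_le_square_iff power_mult_distrib \<kappa>)
    then show ?thesis using \<kappa>0[of i] \<kappa>0[of j] by simp
  qed
  have "kern \<omega> n x (b j) = (\<Sum>i<d. x i * kern \<omega> n (b j) (b i))" for j
    using kern_commute[of \<omega> n x "b j"] kern_expand[of \<omega> n "b j" x] by (rule trans)
  then have "kern \<omega> n x x = (\<Sum>j<d. x j * (\<Sum>i<d. x i * kern \<omega> n (b j) (b i)))"
    using kern_expand[of \<omega> n x x] by (simp del: kern.simps)
  also have "\<dots> \<le> (\<Sum>j<d. x j * (\<Sum>i<d. x i * (\<kappa> j * \<kappa> i)))"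
    using x kij by (intro sum_mono mult_left_mono) auto
  also have "\<dots> = (\<Sum>i<d. x i * \<kappa> i)\<^sup>2"
    by (simp add: power2_eq_square sum_product sum_distrib_left mult_ac)
  also have "(\<Sum>i<d. x i * \<kappa> i) = (\<Sum>i<d. (x i * w i) * (\<kappa> i / w i))"
    using w by (intro sum.cong) (auto simp: less_le)
  also have "(\<Sum>i<d. (x i * w i) * (\<kappa> i / w i))\<^sup>2
      \<le> (\<Sum>i<d. x i * w i) * (\<Sum>i<d. (x i * w i) * (\<kappa> i / w i)\<^sup>2)"
    using x w by (intro square_sum_convex) (simp add: less_imp_le)
  also have "\<dots> \<le> (\<Sum>i<d. x i * w i) * (\<Sum>i<d. (\<Sum>i<d. x i * w i) * (\<kappa> i / w i)\<^sup>2)"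
  proof (intro mult_left_mono sum_mono mult_right_mono)
    show "0 \<le> (\<Sum>i<d. x i * w i)" using x w by (auto intro!: sum_nonneg simp: less_imp_le)
    show "x i * w i \<le> (\<Sum>i<d. x i * w i)" if "i \<in> {..<d}" for i
      using that x w by (intro member_le_sum) (auto simp: less_imp_le)
  qed auto
  also have "\<dots> = (x \<odot> w)\<^sup>2 * (\<Sum>i<d. kern \<omega> n (b i) (b i) / (w i)\<^sup>2)"
    by (simp only: sum_distrib_left[symmetric] dot_prod_def power_divide \<kappa>) (simp add: power2_eq_square)
  finally show ?thesis .
qed

end

context atoms begin

text \<open>
  The matrix is at most \<open>1 + n / l\<close> times its diagonal part, by the comparison behind
  \<open>kern_le_trace\<close>.  Monotonicity of the determinant is obtained by moving linearly from that
  multiple of the diagonal part to the matrix: by Jacobi's formula the log-determinant decreases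
  on the way.
\<close>

lemma ldet_le:
  assumes w: "\<And>i. i < d \<Longrightarrow> w i > 0" and l: "l > 0"
    and b: "\<And>s i. s < n \<Longrightarrow> i < d \<Longrightarrow> b (d + s) i \<ge> 0" "\<And>s. s < n \<Longrightarrow> b (d + s) \<odot> w > 0"
    and \<omega>: "\<And>i. i < d \<Longrightarrow> \<omega> i = l / (w i)\<^sup>2" "\<And>s. s < n \<Longrightarrow> \<omega> (d + s) = 1 / (b (d + s) \<odot> w)\<^sup>2"
  shows "ldet \<omega> n \<le> (\<Sum>i<d. ln (\<omega> i * (1 + n / l)))"
proof -
  \<comment> \<open>The path starts at this multiple of the diagonal part, which dominates the matrix.\<close>
  define \<omega>0 where "\<omega>0 r = (if r < d then \<omega> r * (1 + n / l) else 0)" for r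
  define \<phi> where "\<phi> \<tau> r = \<omega>0 r + \<tau> * (\<omega> r - \<omega>0 r)" for \<tau> :: real and r :: nat
  have \<omega>pos: "\<omega> r > 0" if "r < d + n" for r
  proof (cases "r < d")
    case False
    then have "r = d + (r - d)" "r - d < n" using that by auto
    then show ?thesis using zero_less_power[OF b(2)[of "r - d"], of 2] \<omega>(2)[of "r - d"] by simp
  qed (use w[of r] l \<omega>(1)[of r] in auto)
  have "ldet (\<phi> 1) n \<le> ldet (\<phi> 0) n"
  proof (rule DERIV_nonpos_imp_nonincreasing[of 0 1])
    fix t :: real assume t: "0 \<le> t" "t \<le> 1"
    have \<phi>: "\<phi> t r = (1 - t) * \<omega>0 r + t * \<omega> r" for r by (simp add: \<phi>_def algebra_simps)
    have p: "\<phi> t i > 0" if "i < d" for i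
    proof -
      have "\<phi> t i = \<omega> i * (1 + (1 - t) * (n / l))"
        using that l by (simp add: \<phi>_def \<omega>0_def field_simps)
      then show ?thesis using \<omega>pos[of i] that t l by (auto intro!: mult_pos_pos add_pos_nonneg)
    qed
    have nn: "\<phi> t r \<ge> 0" if "r < d + n" for r
      using \<omega>pos[OF that] p[of r] t by (cases "r < d") (auto simp: \<phi>_def \<omega>0_def)
    interpret weighted_atoms d b n "\<phi> t" using p nn by unfold_locales auto
    let ?k = "kern (\<phi> t) n"
    let ?tr = "\<Sum>i<d. ?k (b i) (b i) / (w i)\<^sup>2"
    have e1: "(\<Sum>r<d+n. (\<omega> r - \<omega>0 r) * ?k (b r) (b r))
       = (\<Sum>i<d. (\<omega> i - \<omega>0 i) * ?k (b i) (b i)) + (\<Sum>s<n. (\<omega> (d + s) - \<omega>0 (d + s)) * ?k (b (d + s)) (b (d + s)))"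
      by (rule sum_lessThan_add)
    have e2: "(\<Sum>i<d. (\<omega> i - \<omega>0 i) * ?k (b i) (b i)) = - n * ?tr"
      unfolding sum_distrib_left
    proof (intro sum.cong refl)
      fix i assume "i \<in> {..<d}"
      then have "\<omega> i - \<omega>0 i = - n / (w i)\<^sup>2" using l w[of i] by (simp add: \<omega>0_def \<omega>(1) field_simps)
      then show "(\<omega> i - \<omega>0 i) * ?k (b i) (b i) = - n * (?k (b i) (b i) / (w i)\<^sup>2)" by simp
    qed
    have e3: "(\<Sum>s<n. (\<omega> (d + s) - \<omega>0 (d + s)) * ?k (b (d + s)) (b (d + s))) \<le> (\<Sum>s<n. ?tr)"
    proof (rule sum_mono)
      fix s assume "s \<in> {..<n}"
      then have s: "s < n" by simp
      then have "?k (b (d + s)) (b (d + s)) / (b (d + s) \<odot> w)\<^sup>2 \<le> ?tr"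
        using kern_le_trace[of "b (d + s)" w] b(1)[of s] w zero_less_power[OF b(2)[of s], of 2]
        by (simp del: zero_less_power2 add: pos_divide_le_eq mult.commute)
      then show "(\<omega> (d + s) - \<omega>0 (d + s)) * ?k (b (d + s)) (b (d + s)) \<le> ?tr"
        using \<omega>(2)[OF s] by (simp add: \<omega>0_def)
    qed
    have neg: "(\<Sum>r<d+n. (\<omega> r - \<omega>0 r) * ?k (b r) (b r)) \<le> 0"
      using e3 unfolding e1 e2 by simp
    have "((\<lambda>\<tau>. ldet (\<phi> \<tau>) n) has_real_derivative (\<Sum>r<d+n. (\<omega> r - \<omega>0 r) * ?k (b r) (b r))) (at t)"
    proof (rule ldet_has_derivative)
      show "((\<lambda>\<tau>. \<phi> \<tau> r) has_real_derivative \<omega> r - \<omega>0 r) (at t)" for r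
        unfolding \<phi>_def by (auto intro!: derivative_eq_intros)
    qed (use p nn in auto)
    with neg show "\<exists>y. ((\<lambda>\<tau>. ldet (\<phi> \<tau>) n) has_real_derivative y) (at t) \<and> y \<le> 0" by blast
  qed simp
  moreover have "ldet (\<phi> 0) n = (\<Sum>i<d. ln (\<omega> i * (1 + n / l)))"
    by (subst ldet_no_data) (auto simp: \<phi>_def \<omega>0_def)
  moreover have "\<phi> 1 = \<omega>" by (auto simp: \<phi>_def)
  ultimately show ?thesis by simp
qed

end

section \<open>The hybrid barrier on the orthant\<close>

text \<open>
  Now the data are return vectors, and the coordinate atoms carry the weight \<open>l\<close> of the logarithmic
  barrier.
\<close>

locale barrier = atoms +
  fixes l :: real
  assumes l: "l > 0"
    and atom_nonneg: "\<And>r i. i < d \<Longrightarrow> b r i \<ge> 0"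
    and atom_pos: "\<And>r. \<exists>i<d. b r i > 0"
begin

definition interior :: "(nat \<Rightarrow> real) \<Rightarrow> bool" where
  "interior w \<longleftrightarrow> (\<forall>i<d. w i > 0)"

definition c :: "nat \<Rightarrow> real" where
  "c r = (if r < d then l else 1)"

text \<open>
  With these weights the matrix of the atoms is the Hessian of the regularised loss at \<open>w\<close>.
\<close>

definition wt :: "(nat \<Rightarrow> real) \<Rightarrow> nat \<Rightarrow> real" where
  "wt w r = c r / (b r \<odot> w)\<^sup>2"

text \<open>
  The logarithmic derivative of \<open>b r \<odot> w\<close> in direction \<open>h\<close>, through which all derivatives of
  the potential are expressed.
\<close>

definition rat :: "(nat \<Rightarrow> real) \<Rightarrow> nat \<Rightarrow> (nat \<Rightarrow> real) \<Rightarrow> real" where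
  "rat w r h = (b r \<odot> h) / (b r \<odot> w)"

text \<open>
  The diagonal entries are the leverage scores of the atoms, up to the factor \<open>c r\<close>.
\<close>

definition lev :: "nat \<Rightarrow> (nat \<Rightarrow> real) \<Rightarrow> nat \<Rightarrow> nat \<Rightarrow> real" where
  "lev n w r s = kern (wt w) n (b r) (b s) / ((b r \<odot> w) * (b s \<odot> w))"

text \<open>
  The squared local norm of \<open>h\<close>, that is the quadratic form of the Hessian at \<open>w\<close>.
\<close>

definition nsq :: "nat \<Rightarrow> (nat \<Rightarrow> real) \<Rightarrow> (nat \<Rightarrow> real) \<Rightarrow> real" where
  "nsq n w h = (\<Sum>r<d+n. c r * (rat w r h)\<^sup>2)"

definition cum_loss :: "nat \<Rightarrow> (nat \<Rightarrow> real) \<Rightarrow> real" where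
  "cum_loss n w = - (\<Sum>r<d+n. c r * ln (b r \<odot> w))"

definition vol :: "nat \<Rightarrow> (nat \<Rightarrow> real) \<Rightarrow> real" where
  "vol n w = ldet (wt w) n / 2"

definition dloss :: "nat \<Rightarrow> (nat \<Rightarrow> real) \<Rightarrow> (nat \<Rightarrow> real) \<Rightarrow> real" where
  "dloss n w h = - (\<Sum>r<d+n. c r * rat w r h)"

definition dvol :: "nat \<Rightarrow> (nat \<Rightarrow> real) \<Rightarrow> (nat \<Rightarrow> real) \<Rightarrow> real" where
  "dvol n w h = - (\<Sum>r<d+n. c r * (lev n w r r * rat w r h))"

lemma c_pos: "c r > 0"
  using l by (simp add: c_def)

lemma c_nonneg: "c r \<ge> 0"
  using c_pos[of r] by simp

lemma ip_pos: "interior w \<Longrightarrow> b r \<odot> w > 0"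
proof -
  assume w: "interior w"
  obtain i where "i < d" "b r i > 0" using atom_pos by blast
  then show ?thesis unfolding dot_prod_def using w atom_nonneg
    by (intro sum_pos2[of _ i]) (auto simp: interior_def less_imp_le)
qed

lemma wt_pos: "interior w \<Longrightarrow> wt w r > 0"
  using ip_pos[of w r] c_pos[of r] by (simp add: wt_def)

lemma weighted: "interior w \<Longrightarrow> weighted_atoms d b n (wt w)"
  using wt_pos[of w] by unfold_locales (simp_all add: less_imp_le)

lemma wt_rat: "interior w \<Longrightarrow> wt w r * (b r \<odot> h)\<^sup>2 = c r * (rat w r h)\<^sup>2"
  by (simp add: wt_def rat_def power_divide)

lemma nsq_nonneg: "nsq n w h \<ge> 0"
  unfolding nsq_def using c_nonneg by (intro sum_nonneg) simp

lemma nsq_mono: "m \<le> n \<Longrightarrow> nsq m w h \<le> nsq n w h"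
  unfolding nsq_def using c_nonneg by (intro sum_mono2) auto

lemma abs_rat_le:
  assumes w: "interior w" and h: "\<And>i. i < d \<Longrightarrow> \<bar>h i\<bar> \<le> e * w i"
  shows "\<bar>rat w r h\<bar> \<le> e"
proof -
  have "\<bar>b r \<odot> h\<bar> \<le> (\<Sum>i<d. \<bar>b r i * h i\<bar>)"
    unfolding dot_prod_def by (rule sum_abs)
  also have "\<dots> \<le> (\<Sum>i<d. b r i * (e * w i))"
    using h atom_nonneg by (intro sum_mono) (simp add: abs_mult mult_left_mono)
  also have "\<dots> = e * (b r \<odot> w)"
    by (simp add: dot_prod_def sum_distrib_left mult_ac)
  finally show ?thesis using ip_pos[OF w, of r] by (simp add: rat_def pos_divide_le_eq)
qed

lemma coord_le_nsq:
  assumes w: "interior w" and i: "i < d"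
  shows "\<bar>h i\<bar> \<le> sqrt (nsq n w h / l) * w i"
proof -
  have wi: "w i > 0" using w i by (simp add: interior_def)
  have "c i * (rat w i h)\<^sup>2 \<le> nsq n w h"
    unfolding nsq_def using i c_nonneg by (intro member_le_sum) auto
  then have "(h i / w i)\<^sup>2 \<le> nsq n w h / l"
    using i l by (simp add: c_def rat_def ip_unit field_simps)
  then have "\<bar>h i / w i\<bar> \<le> sqrt (nsq n w h / l)" by (intro real_le_rsqrt) (simp add: power_divide)
  then show ?thesis using wi by (simp add: pos_divide_le_eq)
qed

text \<open>
  A step that is short in the local norm changes all inner products with atoms by a small factor:
  the logarithmic barrier controls each \<open>h i / w i\<close>, and the ratio for any nonnegative vector is
  an average of these.
\<close>

lemma rat_le:
  assumes w: "interior w"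
  shows "\<bar>rat w r h\<bar> \<le> sqrt (nsq n w h / l)"
  using w coord_le_nsq[OF w] by (rule abs_rat_le)

lemma lev_commute: "lev n w r s = lev n w s r"
  by (simp add: lev_def kern_commute[of _ n "b r"] mult.commute)

lemma lev_nonneg:
  assumes w: "interior w"
  shows "lev n w r r \<ge> 0"
proof -
  interpret weighted_atoms d b n "wt w" by (rule weighted[OF w])
  show ?thesis using ip_pos[OF w, of r] kern_nonneg'[of n] by (simp add: lev_def)
qed

text \<open>
  Data only decrease the inverse, and for the logarithmic barrier alone the claim reduces to
  \<open>\<Sum>i. (b r i * w i)\<^sup>2 \<le> (\<Sum>i. b r i * w i)\<^sup>2\<close>.  A large \<open>l\<close> thus makes all leverage scores small, the
  point on which the whole analysis rests.
\<close>

lemma lev_le: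
  assumes w: "interior w"
  shows "lev n w r r \<le> 1 / l"
proof -
  interpret weighted_atoms d b n "wt w" by (rule weighted[OF w])
  have "kern (wt w) n (b r) (b r) \<le> kern (wt w) 0 (b r) (b r)" by (rule kern_le) simp
  also have "\<dots> = (\<Sum>i<d. (b r i * w i) * (b r i * w i)) / l"
    unfolding kern.simps sum_divide_distrib
    using w l by (intro sum.cong) (auto simp: wt_def c_def ip_unit interior_def power2_eq_square field_simps)
  also have "(\<Sum>i<d. (b r i * w i) * (b r i * w i)) \<le> (\<Sum>i<d. (b r i * w i) * (b r \<odot> w))"
  proof (intro sum_mono mult_left_mono)
    fix i assume "i \<in> {..<d}"
    then show "b r i * w i \<le> b r \<odot> w" "b r i * w i \<ge> 0" unfolding dot_prod_def
      using w atom_nonneg by (auto intro!: member_le_sum simp: interior_def less_imp_le)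
  qed
  also have "\<dots> = (b r \<odot> w) * (b r \<odot> w)" by (simp add: dot_prod_def sum_distrib_right)
  finally have "kern (wt w) n (b r) (b r) \<le> (b r \<odot> w) * (b r \<odot> w) / l"
    using l by (simp add: divide_right_mono)
  then show ?thesis using ip_pos[OF w, of r] l by (simp add: lev_def field_simps)
qed

lemma lev_square_sum:
  assumes w: "interior w"
  shows "(\<Sum>s<d+n. c s * (lev n w r s)\<^sup>2) = lev n w r r"
proof -
  interpret weighted_atoms d b n "wt w" by (rule weighted[OF w])
  have "(\<Sum>s<d+n. c s * (lev n w r s)\<^sup>2)
     = (\<Sum>s<d+n. wt w s * (kern (wt w) n (b r) (b s) * kern (wt w) n (b s) (b r))) / ((b r \<odot> w) * (b r \<odot> w))"
    unfolding sum_divide_distrib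
    by (intro sum.cong refl) (simp add: lev_def wt_def kern_commute[of _ n "b r" "b _"] power2_eq_square)
  then show ?thesis unfolding reproducing[OF order_refl] by (simp add: lev_def)
qed

text \<open>
  The leverage score is the squared dual local norm of the gradient of one loss.
\<close>

lemma rat_square_le_lev:
  assumes w: "interior w"
  shows "(rat w r h)\<^sup>2 \<le> lev n w r r * nsq n w h"
proof -
  interpret weighted_atoms d b n "wt w" by (rule weighted[OF w])
  have "(b r \<odot> h)\<^sup>2 \<le> kern (wt w) n (b r) (b r) * nsq n w h"
    using ip_square_le[OF order_refl, of "b r" h] wt_rat[OF w] by (simp add: nsq_def)
  then have "(b r \<odot> h)\<^sup>2 / (b r \<odot> w)\<^sup>2 \<le> kern (wt w) n (b r) (b r) * nsq n w h / (b r \<odot> w)\<^sup>2"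
    by (intro divide_right_mono) auto
  then show ?thesis by (simp add: rat_def lev_def power2_eq_square)
qed

text \<open>
  The second derivative of \<open>vol\<close> in the directions \<open>h\<close> and \<open>k\<close>.
\<close>

definition hess :: "nat \<Rightarrow> (nat \<Rightarrow> real) \<Rightarrow> (nat \<Rightarrow> real) \<Rightarrow> (nat \<Rightarrow> real) \<Rightarrow> real" where
  "hess n w h k = 3 * (\<Sum>r<d+n. c r * lev n w r r * (rat w r h * rat w r k))
     - 2 * (\<Sum>r<d+n. \<Sum>s<d+n. c r * c s * (lev n w r s)\<^sup>2 * (rat w s h * rat w r k))"

definition line :: "(nat \<Rightarrow> real) \<Rightarrow> (nat \<Rightarrow> real) \<Rightarrow> real \<Rightarrow> nat \<Rightarrow> real" where
  "line w h \<tau> = (\<lambda>i. w i + \<tau> * h i)"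

lemma ip_line: "x \<odot> line w h \<tau> = x \<odot> w + \<tau> * (x \<odot> h)"
  by (simp add: dot_prod_def line_def sum.distrib sum_distrib_left algebra_simps)

lemma ip_line_has_derivative: "((\<lambda>\<tau>. x \<odot> line w h \<tau>) has_real_derivative (x \<odot> h)) (at t)"
  unfolding ip_line by (auto intro!: derivative_eq_intros)

lemma wt_has_derivative:
  assumes w: "interior (line w h t)"
  shows "((\<lambda>\<tau>. wt (line w h \<tau>) r) has_real_derivative
      - 2 * (wt (line w h t) r * rat (line w h t) r h)) (at t)"
proof -
  have "b r \<odot> line w h t \<noteq> 0" using ip_pos[OF w, of r] by simp
  then show ?thesis unfolding wt_def rat_def
    by (auto intro!: derivative_eq_intros ip_line_has_derivative simp: field_simps power2_eq_square)
qed

lemma vol_has_derivative: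
  assumes w: "interior (line w h t)"
  shows "((\<lambda>\<tau>. vol n (line w h \<tau>)) has_real_derivative dvol n (line w h t) h) (at t)"
proof -
  let ?p = "line w h t"
  have "((\<lambda>\<tau>. ldet (wt (line w h \<tau>)) n) has_real_derivative
     (\<Sum>r<d+n. - 2 * (wt ?p r * rat ?p r h) * kern (wt ?p) n (b r) (b r))) (at t)"
    by (rule ldet_has_derivative[OF wt_has_derivative[OF w]]) (use wt_pos[OF w] less_imp_le in auto)
  also have "(\<Sum>r<d+n. - 2 * (wt ?p r * rat ?p r h) * kern (wt ?p) n (b r) (b r)) = dvol n ?p h * 2"
    unfolding dvol_def sum_distrib_right minus_mult_left sum_negf[symmetric]
    by (intro sum.cong refl) (simp add: wt_def lev_def power2_eq_square)
  finally show ?thesis unfolding vol_def by (auto intro!: derivative_eq_intros)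
qed

lemma lev_has_derivative:
  assumes w: "interior (line w h t)"
  shows "((\<lambda>\<tau>. lev n (line w h \<tau>) r r) has_real_derivative
     2 * (\<Sum>s<d+n. c s * (lev n (line w h t) r s)\<^sup>2 * rat (line w h t) s h)
       - 2 * (lev n (line w h t) r r * rat (line w h t) r h)) (at t)"
proof -
  let ?p = "line w h t"
  let ?K = "kern (wt ?p) n"
  define R where "R = b r \<odot> ?p"
  have R: "R \<noteq> 0" using ip_pos[OF w, of r] by (simp add: R_def)
  define S where "S = (\<Sum>s<d+n. - 2 * (wt ?p s * rat ?p s h) * (?K (b r) (b s) * ?K (b s) (b r)))"
  have k: "((\<lambda>\<tau>. kern (wt (line w h \<tau>)) n (b r) (b r)) has_real_derivative - S) (at t)"
    unfolding S_def by (rule kern_has_derivative[OF wt_has_derivative[OF w]])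
      (use wt_pos[OF w] less_imp_le in auto)
  have "(\<Sum>s<d+n. c s * (lev n ?p r s)\<^sup>2 * rat ?p s h) * 2 * (R * R) = - S"
    unfolding S_def sum_distrib_right sum_negf[symmetric]
    using R by (intro sum.cong refl)
      (simp add: lev_def wt_def kern_commute[of _ n "b r" "b _"] power2_eq_square R_def)
  then have S: "- S = 2 * (\<Sum>s<d+n. c s * (lev n ?p r s)\<^sup>2 * rat ?p s h) * (R * R)" by simp
  have "((\<lambda>\<tau>. lev n (line w h \<tau>) r r) has_real_derivative
     (- S * (R * R) - ?K (b r) (b r) * ((b r \<odot> h) * R + R * (b r \<odot> h))) / ((R * R) * (R * R))) (at t)"
    unfolding lev_def using R
    by (auto intro!: derivative_eq_intros k ip_line_has_derivative simp: R_def)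
  moreover have "(- S * (R * R) - ?K (b r) (b r) * ((b r \<odot> h) * R + R * (b r \<odot> h))) / ((R * R) * (R * R))
     = 2 * (\<Sum>s<d+n. c s * (lev n ?p r s)\<^sup>2 * rat ?p s h) - 2 * (lev n ?p r r * rat ?p r h)"
    unfolding S using R by (simp add: lev_def[of n ?p r r] rat_def[of ?p r h] R_def[symmetric] field_simps)
  ultimately show ?thesis by simp
qed

lemma rat_has_derivative:
  assumes w: "interior (line w h t)"
  shows "((\<lambda>\<tau>. rat (line w h \<tau>) r k) has_real_derivative
     - (rat (line w h t) r h * rat (line w h t) r k)) (at t)"
proof -
  have "b r \<odot> line w h t \<noteq> 0" using ip_pos[OF w, of r] by simp
  then show ?thesis unfolding rat_def
    by (auto intro!: derivative_eq_intros ip_line_has_derivative simp: field_simps)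
qed

lemma dvol_has_derivative:
  assumes w: "interior (line w h t)"
  shows "((\<lambda>\<tau>. dvol n (line w h \<tau>) k) has_real_derivative hess n (line w h t) h k) (at t)"
proof -
  let ?p = "line w h t"
  define L where "L r = 2 * (\<Sum>s<d+n. c s * (lev n ?p r s)\<^sup>2 * rat ?p s h)
       - 2 * (lev n ?p r r * rat ?p r h)" for r
  have "((\<lambda>\<tau>. dvol n (line w h \<tau>) k) has_real_derivative
      - (\<Sum>r<d+n. c r * (L r * rat ?p r k + lev n ?p r r * - (rat ?p r h * rat ?p r k)))) (at t)"
    unfolding dvol_def L_def
    by (rule DERIV_minus[OF DERIV_sum])
       (auto intro!: derivative_eq_intros lev_has_derivative[OF w] rat_has_derivative[OF w])
  also have "- (\<Sum>r<d+n. c r * (L r * rat ?p r k + lev n ?p r r * - (rat ?p r h * rat ?p r k)))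
      = hess n ?p h k"
    unfolding L_def hess_def
    by (simp add: sum_subtractf sum.distrib sum_distrib_left sum_distrib_right algebra_simps)
  finally show ?thesis .
qed

definition qvol :: "nat \<Rightarrow> (nat \<Rightarrow> real) \<Rightarrow> (nat \<Rightarrow> real) \<Rightarrow> real" where
  "qvol n w h = (\<Sum>r<d+n. c r * lev n w r r * (rat w r h)\<^sup>2)"

lemma qvol_nonneg: "interior w \<Longrightarrow> qvol n w h \<ge> 0"
  unfolding qvol_def using c_nonneg lev_nonneg by (intro sum_nonneg) simp

lemma qvol_le:
  assumes w: "interior w"
  shows "qvol n w h \<le> nsq n w h / l"
  unfolding qvol_def nsq_def sum_divide_distrib
proof (rule sum_mono)
  fix r
  have "c r * (rat w r h)\<^sup>2 * lev n w r r \<le> c r * (rat w r h)\<^sup>2 * (1 / l)"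
    using c_nonneg lev_le[OF w] by (intro mult_left_mono) auto
  then show "c r * lev n w r r * (rat w r h)\<^sup>2 \<le> c r * (rat w r h)\<^sup>2 / l" by (simp add: mult_ac)
qed

text \<open>
  The squared kernel has row sums \<open>lev n w r r\<close>, so the Cauchy--Schwarz inequality over pairs of
  atoms bounds its bilinear form by the diagonal form \<open>qvol\<close>.
\<close>

lemma square_kernel_bound:
  assumes w: "interior w"
  shows "(\<Sum>r<d+n. \<Sum>s<d+n. c r * c s * (lev n w r s)\<^sup>2 * (rat w s h * rat w r k))\<^sup>2
     \<le> qvol n w h * qvol n w k"
proof -
  have 1: "(\<Sum>r<d+n. \<Sum>s<d+n. c r * c s * (lev n w r s)\<^sup>2 * (rat w r k)\<^sup>2) = qvol n w k" for k
  proof -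
    have "(\<Sum>s<d+n. c r * c s * (lev n w r s)\<^sup>2 * (rat w r k)\<^sup>2) = c r * lev n w r r * (rat w r k)\<^sup>2" for r
      using lev_square_sum[OF w, of n r, symmetric] by (simp add: sum_distrib_left sum_distrib_right mult_ac)
    then show ?thesis by (simp add: qvol_def)
  qed
  have 2: "(\<Sum>r<d+n. \<Sum>s<d+n. c r * c s * (lev n w r s)\<^sup>2 * (rat w s h)\<^sup>2) = qvol n w h"
    using 1[of h] by (subst sum.swap) (simp add: mult_ac lev_commute[of n w])
  show ?thesis
    using weighted_cauchy[of "{..<d+n} \<times> {..<d+n}" "\<lambda>(r, s). c r * c s * (lev n w r s)\<^sup>2"
        "\<lambda>(r, s). rat w s h" "\<lambda>(r, s). rat w r k"] 1[of k] 2 c_nonneg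
    by (auto simp: sum.cartesian_product split_def)
qed

lemma qvol_cauchy:
  assumes w: "interior w"
  shows "(\<Sum>r<d+n. c r * lev n w r r * (rat w r h * rat w r k))\<^sup>2 \<le> qvol n w h * qvol n w k"
  unfolding qvol_def using c_nonneg lev_nonneg[OF w] by (intro weighted_cauchy) simp

lemma abs_le_sqrt_mult: "x\<^sup>2 \<le> a * a' \<Longrightarrow> \<bar>x\<bar> \<le> sqrt a * sqrt a'" for x a a' :: real
  by (simp add: real_sqrt_mult[symmetric] real_le_rsqrt)

lemma hess_bound:
  assumes w: "interior w"
  shows "\<bar>hess n w h k\<bar> \<le> 5 / l * (sqrt (nsq n w h) * sqrt (nsq n w k))"
proof -
  have "\<bar>hess n w h k\<bar> \<le> 5 * (sqrt (qvol n w h) * sqrt (qvol n w k))"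
    using abs_le_sqrt_mult[OF square_kernel_bound[OF w, of n h k]]
      abs_le_sqrt_mult[OF qvol_cauchy[OF w, of n h k]] unfolding hess_def by linarith
  also have "\<dots> \<le> 5 * (sqrt (nsq n w h / l) * sqrt (nsq n w k / l))"
    using qvol_le[OF w] qvol_nonneg[OF w] nsq_nonneg l by (intro mult_left_mono mult_mono) auto
  also have "\<dots> = 5 / l * (sqrt (nsq n w h) * sqrt (nsq n w k))"
    using l by (simp add: real_sqrt_divide field_simps)
  finally show ?thesis .
qed

text \<open>
  The volumetric barrier is convex: in \<open>hess\<close> the diagonal form has the coefficient 3 and
  dominates the squared kernel, which has the coefficient 2.
\<close>

lemma hess_nonneg:
  assumes w: "interior w"
  shows "hess n w h h \<ge> 0"
proof -
  have "\<bar>\<Sum>r<d+n. \<Sum>s<d+n. c r * c s * (lev n w r s)\<^sup>2 * (rat w s h * rat w r h)\<bar> \<le> qvol n w h"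
    using abs_le_sqrt_mult[OF square_kernel_bound[OF w, of n h h]] qvol_nonneg[OF w, of n h] by simp
  then show ?thesis using qvol_nonneg[OF w, of n h]
    unfolding hess_def by (simp add: qvol_def power2_eq_square)
qed

lemma line_0 [simp]: "line w h 0 = w"
  by (simp add: line_def)

section \<open>Convexity and stability of the potential\<close>

lemma interior_line:
  assumes "interior w" "interior (line w h 1)" "0 \<le> t" "t \<le> 1"
  shows "interior (line w h t)"
  unfolding interior_def
proof (intro allI impI)
  fix i assume i: "i < d"
  have "w i > 0" "w i + h i > 0" using assms(1,2) i by (auto simp: interior_def line_def)
  moreover have "w i + t * h i = (1 - t) * w i + t * (w i + h i)" by (simp add: algebra_simps)
  ultimately show "line w h t i > 0" using assms(3,4)
    by (cases "t = 0") (auto simp: line_def intro!: add_nonneg_pos)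
qed

lemma vol_convex:
  assumes w: "interior w" "interior (line w h 1)"
  shows "vol n w + dvol n w h \<le> vol n (line w h 1)"
proof -
  have int: "interior (line w h t)" if "0 \<le> t" "t \<le> 1" for t using interior_line w that by blast
  have mono: "dvol n (line w h 0) h \<le> dvol n (line w h t) h" if "0 \<le> t" "t \<le> 1" for t
  proof (rule DERIV_nonneg_imp_nondecreasing[OF that(1)])
    fix u assume "0 \<le> u" "u \<le> t"
    then have "interior (line w h u)" using int that by simp
    then show "\<exists>y. ((\<lambda>t. dvol n (line w h t) h) has_real_derivative y) (at u) \<and> 0 \<le> y"
      using dvol_has_derivative hess_nonneg by blast
  qed
  have "vol n (line w h 0) - 0 * dvol n w h \<le> vol n (line w h 1) - 1 * dvol n w h"
  proof (rule DERIV_nonneg_imp_nondecreasing[of 0 1 "\<lambda>t. vol n (line w h t) - t * dvol n w h"])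
    fix t :: real assume t: "0 \<le> t" "t \<le> 1"
    have "((\<lambda>t. vol n (line w h t) - t * dvol n w h) has_real_derivative
        dvol n (line w h t) h - dvol n w h) (at t)"
      by (auto intro!: derivative_eq_intros vol_has_derivative[OF int[OF t]])
    then show "\<exists>y. ((\<lambda>t. vol n (line w h t) - t * dvol n w h) has_real_derivative y) (at t) \<and> 0 \<le> y"
      using mono[OF t] by auto
  qed simp
  then show ?thesis by simp
qed

definition pot :: "real \<Rightarrow> nat \<Rightarrow> (nat \<Rightarrow> real) \<Rightarrow> real" where
  "pot \<mu> n w = cum_loss n w + \<mu> * vol n w"

definition dpot :: "real \<Rightarrow> nat \<Rightarrow> (nat \<Rightarrow> real) \<Rightarrow> (nat \<Rightarrow> real) \<Rightarrow> real" where
  "dpot \<mu> n w h = dloss n w h + \<mu> * dvol n w h"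

lemma ip_line_rat:
  assumes "interior w"
  shows "b r \<odot> line w h t = (b r \<odot> w) * (1 + t * rat w r h)"
  using ip_pos[OF assms, of r] by (simp add: ip_line rat_def field_simps)

text \<open>
  For the losses the remainder after the linear term is explicit, for the volumetric barrier it is
  nonnegative by convexity.  Keeping the remainder of the losses is what allows a comparison with
  portfolios that are far away in the local norm.
\<close>

lemma pot_lower:
  assumes w: "interior w" "interior (line w h 1)" and \<mu>: "\<mu> \<ge> 0"
  shows "pot \<mu> n w + dpot \<mu> n w h + (\<Sum>r<d+n. c r * (rat w r h - ln (1 + rat w r h)))
     \<le> pot \<mu> n (line w h 1)"
proof -
  have "ln (b r \<odot> line w h 1) = ln (b r \<odot> w) + ln (1 + rat w r h)" for r
  proof -
    have "0 < 1 + rat w r h"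
      using ip_pos[OF w(2), of r] ip_pos[OF w(1), of r] ip_line_rat[OF w(1), of r h 1]
      by (simp add: zero_less_mult_iff)
    then show ?thesis
      using ip_pos[OF w(1), of r] ip_line_rat[OF w(1), of r h 1] by (simp add: ln_mult)
  qed
  then have "cum_loss n (line w h 1) = cum_loss n w + dloss n w h + (\<Sum>r<d+n. c r * (rat w r h - ln (1 + rat w r h)))"
    by (simp add: cum_loss_def dloss_def sum_subtractf sum.distrib algebra_simps)
  moreover have "\<mu> * (vol n w + dvol n w h) \<le> \<mu> * vol n (line w h 1)"
    using vol_convex[OF w] \<mu> by (rule mult_left_mono)
  ultimately show ?thesis by (simp add: pot_def dpot_def algebra_simps)
qed

lemma rat_gt:
  assumes w: "interior w" "interior (line w h 1)"
  shows "rat w r h > -1"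
  using ip_pos[OF w(2), of r] ip_pos[OF w(1), of r] ip_line_rat[OF w(1), of r h 1]
  by (simp add: zero_less_mult_iff)

lemma pot_convex:
  assumes w: "interior w" "interior (line w h 1)" and \<mu>: "\<mu> \<ge> 0"
  shows "pot \<mu> n w + dpot \<mu> n w h \<le> pot \<mu> n (line w h 1)"
proof -
  have "(\<Sum>r<d+n. c r * (rat w r h - ln (1 + rat w r h))) \<ge> 0"
    using ln_add_one_self_le_self2 rat_gt[OF w] c_nonneg by (intro sum_nonneg mult_nonneg_nonneg) (simp_all)
  then show ?thesis using pot_lower[OF w \<mu>, of n] by simp
qed

end

lemma ln_one_plus_gap:
  fixes z :: real
  assumes "z > -1"
  shows "z\<^sup>2 / (2 * (1 + \<bar>z\<bar>)) \<le> z - ln (1 + z)"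
proof -
  show ?thesis
  proof (cases "z \<ge> 0")
    case True
    have "0 - ln (1 + 0) - 0\<^sup>2 / (2 * (1 + 0)) \<le> z - ln (1 + z) - z\<^sup>2 / (2 * (1 + z))"
    proof (rule DERIV_nonneg_imp_nondecreasing[OF True, of "\<lambda>z. z - ln (1 + z) - z\<^sup>2 / (2 * (1 + z))"])
      fix x :: real assume x: "0 \<le> x" "x \<le> z"
      have "((\<lambda>z. z - ln (1 + z) - z\<^sup>2 / (2 * (1 + z))) has_real_derivative x\<^sup>2 / (2 * (1 + x)\<^sup>2)) (at x)"
      proof -
        have "((\<lambda>z. z - ln (1 + z) - z\<^sup>2 / (2 * (1 + z))) has_real_derivative
           (1 - 1 / (1 + x) - (2 * x * (2 * (1 + x)) - x\<^sup>2 * 2) / ((2 * (1 + x)) * (2 * (1 + x))))) (at x)"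
          using x by (auto intro!: derivative_eq_intros)
        also have "1 - 1 / (1 + x) - (2 * x * (2 * (1 + x)) - x\<^sup>2 * 2) / ((2 * (1 + x)) * (2 * (1 + x)))
          = x\<^sup>2 / (2 * (1 + x)\<^sup>2)"
          using x by (simp add: divide_simps) (simp add: power2_eq_square algebra_simps)
        finally show ?thesis .
      qed
      then show "\<exists>y. ((\<lambda>z. z - ln (1 + z) - z\<^sup>2 / (2 * (1 + z))) has_real_derivative y) (at x) \<and> 0 \<le> y"
        by (intro exI[of _ "x\<^sup>2 / (2 * (1 + x)\<^sup>2)"]) simp
    qed
    then show ?thesis using True by simp
  next
    case False
    then have z: "z \<le> 0" by simp
    have "z - ln (1 + z) - z\<^sup>2 / 2 \<ge> 0 - ln (1 + 0) - 0\<^sup>2 / 2"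
    proof (rule DERIV_nonpos_imp_nonincreasing[OF z, of "\<lambda>z. z - ln (1 + z) - z\<^sup>2 / 2"])
      fix x :: real assume x: "z \<le> x" "x \<le> 0"
      have "((\<lambda>z. z - ln (1 + z) - z\<^sup>2 / 2) has_real_derivative - (x\<^sup>2 / (1 + x))) (at x)"
        using x assms by (auto intro!: derivative_eq_intros simp: divide_simps) (simp add: power2_eq_square algebra_simps)
      then show "\<exists>y. ((\<lambda>z. z - ln (1 + z) - z\<^sup>2 / 2) has_real_derivative y) (at x) \<and> y \<le> 0"
        using x assms by (intro exI[of _ "- (x\<^sup>2 / (1 + x))"]) simp
    qed
    then have "z\<^sup>2 / 2 \<le> z - ln (1 + z)" by simp
    moreover have "z\<^sup>2 / (2 * (1 + \<bar>z\<bar>)) \<le> z\<^sup>2 / 2" by (intro divide_left_mono) auto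
    ultimately show ?thesis by (rule order_trans[rotated])
  qed
qed

context barrier begin

text \<open>
  A small gradient \<open>\<delta>\<close> forces a nearly minimal value, even at distance \<open>N\<close> far beyond one:
  the remainder of the losses grows like \<open>N\<^sup>2 / (2 (1 + N))\<close> and absorbs the linear term \<open>- \<delta> N\<close>.
\<close>

lemma pot_near_min:
  assumes w: "interior w" "interior (line w h 1)" and \<mu>: "\<mu> \<ge> 0" and l1: "l \<ge> 1"
    and \<delta>: "\<bar>dpot \<mu> n w h\<bar> \<le> \<delta> * sqrt (nsq n w h)" "\<delta> \<le> 1/4"
  shows "pot \<mu> n w - 1/4 \<le> pot \<mu> n (line w h 1)"
proof -
  define N where "N = sqrt (nsq n w h)"
  have N: "N \<ge> 0" "N\<^sup>2 = nsq n w h" using nsq_nonneg[of n w h] by (simp_all add: N_def)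
  have z: "\<bar>rat w r h\<bar> \<le> N" for r
  proof -
    have "nsq n w h / l \<le> nsq n w h" using l1 nsq_nonneg[of n w h] by (simp add: pos_divide_le_eq mult_le_cancel_left1)
    then have "sqrt (nsq n w h / l) \<le> N" by (simp add: N_def)
    then show ?thesis using rat_le[OF w(1), of r h n] by simp
  qed
  have "N\<^sup>2 / (2 * (1 + N)) = (\<Sum>r<d+n. c r * ((rat w r h)\<^sup>2 / (2 * (1 + N))))"
    unfolding N(2) nsq_def sum_divide_distrib by simp
  also have "\<dots> \<le> (\<Sum>r<d+n. c r * (rat w r h - ln (1 + rat w r h)))"
  proof (intro sum_mono mult_left_mono c_nonneg)
    fix r
    have "(rat w r h)\<^sup>2 / (2 * (1 + N)) \<le> (rat w r h)\<^sup>2 / (2 * (1 + \<bar>rat w r h\<bar>))"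
      using z[of r] by (intro divide_left_mono) auto
    then show "(rat w r h)\<^sup>2 / (2 * (1 + N)) \<le> rat w r h - ln (1 + rat w r h)"
      using ln_one_plus_gap[OF rat_gt[OF w, of r]] by simp
  qed
  finally have "N\<^sup>2 / (2 * (1 + N)) \<le> (\<Sum>r<d+n. c r * (rat w r h - ln (1 + rat w r h)))" .
  moreover have "N\<^sup>2 / (2 * (1 + N)) \<ge> N / 4 - 1 / 4"
  proof -
    have "(N / 4 - 1 / 4) * (2 * (1 + N)) \<le> N\<^sup>2" by (simp add: power2_eq_square field_simps)
    then show ?thesis using N(1) by (simp add: pos_le_divide_eq)
  qed
  moreover have "dpot \<mu> n w h \<ge> - N / 4"
    using \<delta> N(1) mult_right_mono[OF \<delta>(2) N(1)] unfolding N_def[symmetric] by linarith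
  ultimately show ?thesis using pot_lower[OF w \<mu>, of n] by simp
qed

lemma interior_small_step:
  assumes w: "interior w" and e: "sqrt (nsq n w h / l) \<le> e" "e < 1"
  shows "interior (line w h 1)"
  unfolding interior_def
proof (intro allI impI)
  fix i assume i: "i < d"
  have wi: "w i > 0" using w i by (simp add: interior_def)
  have "\<bar>h i\<bar> \<le> e * w i"
    using wi by (intro order_trans[OF coord_le_nsq[OF w i, of h n] mult_right_mono[OF e(1)]]) simp
  also have "\<dots> < w i" using e wi by simp
  finally show "line w h 1 i > 0" by (simp add: line_def)
qed

lemma rat_line:
  assumes w: "interior w" and e: "sqrt (nsq n w h / l) \<le> e" "e < 1" and t: "0 \<le> t" "t \<le> 1"
  shows "\<bar>rat (line w h t) r k\<bar> \<le> \<bar>rat w r k\<bar> / (1 - e)"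
    and "\<bar>rat w r k\<bar> \<le> (1 + e) * \<bar>rat (line w h t) r k\<bar>"
proof -
  have z: "\<bar>rat w r h\<bar> \<le> e" using rat_le[OF w, of r h n] e by simp
  have "\<bar>t * rat w r h\<bar> \<le> 1 * e" unfolding abs_mult using z t by (intro mult_mono) auto
  then have f: "1 - e \<le> 1 + t * rat w r h" "1 + t * rat w r h \<le> 1 + e" by auto
  then have f0: "1 + t * rat w r h > 0" using e by simp
  have eq: "rat (line w h t) r k = rat w r k / (1 + t * rat w r h)"
    by (simp add: rat_def[of _ r k] ip_line_rat[OF w])
  show "\<bar>rat (line w h t) r k\<bar> \<le> \<bar>rat w r k\<bar> / (1 - e)"
    unfolding eq abs_divide using f f0 e by (intro divide_left_mono) auto
  have "\<bar>rat w r k\<bar> = (1 + t * rat w r h) * \<bar>rat (line w h t) r k\<bar>"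
    unfolding eq abs_divide using f0 by simp
  also have "\<dots> \<le> (1 + e) * \<bar>rat (line w h t) r k\<bar>" using f by (intro mult_right_mono) auto
  finally show "\<bar>rat w r k\<bar> \<le> (1 + e) * \<bar>rat (line w h t) r k\<bar>" .
qed

lemma sqrt_nsq_mono:
  assumes "\<And>r. \<bar>rat w r k\<bar> \<le> a * \<bar>rat w' r k\<bar>" "a \<ge> 0"
  shows "sqrt (nsq n w k) \<le> a * sqrt (nsq n w' k)"
proof -
  have "(rat w r k)\<^sup>2 \<le> a\<^sup>2 * (rat w' r k)\<^sup>2" for r
    using power_mono[OF assms(1)[of r], of 2] by (simp add: power_mult_distrib)
  then have "nsq n w k \<le> a\<^sup>2 * nsq n w' k"
    unfolding nsq_def sum_distrib_left
    by (intro sum_mono) (metis c_nonneg mult.left_commute mult_left_mono)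
  then have "sqrt (nsq n w k) \<le> sqrt (a\<^sup>2 * nsq n w' k)" by simp
  then show ?thesis using assms(2) by (simp add: real_sqrt_mult)
qed

text \<open>
  The mean value theorem along the step, with the bound on the second derivative at an
  intermediate point, where local norms are larger by at most \<open>1 / (1 - e)\<close>.
\<close>

lemma dvol_change:
  assumes w: "interior w" and e: "sqrt (nsq n w h / l) \<le> e" "e < 1"
  shows "\<bar>dvol n (line w h 1) k - dvol n w k\<bar>
     \<le> 5 / l / (1 - e)\<^sup>2 * (sqrt (nsq n w h) * sqrt (nsq n w k))"
proof -
  have int: "interior (line w h t)" if "0 \<le> t" "t \<le> 1" for t
    using interior_line[OF w interior_small_step[OF w e] that] .
  have "\<exists>z>0. z < 1 \<and> dvol n (line w h 1) k - dvol n (line w h 0) k = (1 - 0) * hess n (line w h z) h k"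
    by (rule MVT2) (use dvol_has_derivative[OF int] in auto)
  then obtain t where t: "0 < t" "t < 1"
    and eq: "dvol n (line w h 1) k - dvol n w k = hess n (line w h t) h k"
    by auto
  have m: "sqrt (nsq n (line w h t) k) \<le> 1 / (1 - e) * sqrt (nsq n w k)" for k
    by (rule sqrt_nsq_mono) (use rat_line(1)[OF w e, of t] t e in auto)
  have "\<bar>hess n (line w h t) h k\<bar>
      \<le> 5 / l * (sqrt (nsq n (line w h t) h) * sqrt (nsq n (line w h t) k))"
    using hess_bound[OF int] t by simp
  also have "\<dots> \<le> 5 / l * ((1 / (1 - e) * sqrt (nsq n w h)) * (1 / (1 - e) * sqrt (nsq n w k)))"
    using m l e nsq_nonneg by (intro mult_left_mono mult_mono) auto
  also have "\<dots> = 5 / l / (1 - e)\<^sup>2 * (sqrt (nsq n w h) * sqrt (nsq n w k))"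
    by (simp add: power2_eq_square)
  finally show ?thesis unfolding eq .
qed

text \<open>
  The inner product of the local norm, that is the bilinear form of the Hessian of the loss.
\<close>

definition hip :: "nat \<Rightarrow> (nat \<Rightarrow> real) \<Rightarrow> (nat \<Rightarrow> real) \<Rightarrow> (nat \<Rightarrow> real) \<Rightarrow> real" where
  "hip n w h k = (\<Sum>r<d+n. c r * (rat w r h * rat w r k))"

lemma dloss_change:
  assumes w: "interior w" and e: "sqrt (nsq n w h / l) \<le> e" "e < 1"
  shows "\<bar>dloss n (line w h 1) k - dloss n w k - hip n w h k\<bar>
     \<le> e / (1 - e) * (sqrt (nsq n w h) * sqrt (nsq n w k))"
proof -
  let ?z = "\<lambda>r. rat w r h"
  have z: "\<bar>?z r\<bar> \<le> e" for r using rat_le[OF w, of r h n] e by simp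
  have eq: "rat (line w h 1) r k = rat w r k / (1 + ?z r)" for r
    by (simp add: rat_def[of _ r k] ip_line_rat[OF w])
  have sum: "dloss n (line w h 1) k - dloss n w k - hip n w h k
      = (\<Sum>r<d+n. c r * (- (?z r / (1 + ?z r)) * (?z r * rat w r k)))"
  proof -
    have "- rat (line w h 1) r k + rat w r k - ?z r * rat w r k = - (?z r / (1 + ?z r)) * (?z r * rat w r k)" for r
      unfolding eq using z[of r] e by (simp add: field_simps)
    moreover have "dloss n (line w h 1) k - dloss n w k - hip n w h k
      = (\<Sum>r<d+n. c r * (- rat (line w h 1) r k + rat w r k - ?z r * rat w r k))"
      by (simp add: dloss_def hip_def right_diff_distrib distrib_left sum_subtractf sum.distrib sum_negf)
    ultimately show ?thesis by simp
  qed
  have "\<bar>dloss n (line w h 1) k - dloss n w k - hip n w h k\<bar>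
      \<le> (\<Sum>r<d+n. e / (1 - e) * (c r * (\<bar>?z r\<bar> * \<bar>rat w r k\<bar>)))"
    unfolding sum
  proof (rule order_trans[OF sum_abs], rule sum_mono)
    fix r
    have "\<bar>?z r\<bar> / \<bar>1 + ?z r\<bar> \<le> e / (1 - e)"
      using z[of r] e by (intro frac_le) auto
    then have "\<bar>?z r\<bar> / \<bar>1 + ?z r\<bar> * (c r * (\<bar>?z r\<bar> * \<bar>rat w r k\<bar>)) \<le> e / (1 - e) * (c r * (\<bar>?z r\<bar> * \<bar>rat w r k\<bar>))"
      using c_nonneg by (intro mult_right_mono) auto
    then show "\<bar>c r * (- (?z r / (1 + ?z r)) * (?z r * rat w r k))\<bar> \<le> e / (1 - e) * (c r * (\<bar>?z r\<bar> * \<bar>rat w r k\<bar>))"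
      using c_nonneg[of r] by (simp add: abs_mult mult_ac)
  qed
  also have "\<dots> = e / (1 - e) * (\<Sum>r<d+n. c r * (\<bar>?z r\<bar> * \<bar>rat w r k\<bar>))" by (simp add: sum_distrib_left)
  also have "\<dots> \<le> e / (1 - e) * (sqrt (nsq n w h) * sqrt (nsq n w k))"
  proof (rule mult_left_mono)
    have "(\<Sum>r<d+n. c r * (\<bar>?z r\<bar> * \<bar>rat w r k\<bar>))\<^sup>2 \<le> nsq n w h * nsq n w k"
      using weighted_cauchy[of "{..<d+n}" c "\<lambda>r. \<bar>?z r\<bar>" "\<lambda>r. \<bar>rat w r k\<bar>"] c_nonneg by (simp add: nsq_def)
    then show "(\<Sum>r<d+n. c r * (\<bar>?z r\<bar> * \<bar>rat w r k\<bar>)) \<le> sqrt (nsq n w h) * sqrt (nsq n w k)"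
      using abs_le_sqrt_mult by fastforce
    have "0 \<le> e" using z[of 0] by simp
    then show "0 \<le> e / (1 - e)" using e by simp
  qed
  finally show ?thesis .
qed

text \<open>
  After a short step the gradient of the potential is nearly the one predicted by the Hessian of
  the loss alone; this is why the Newton step can ignore the second derivative of \<open>vol\<close>.
\<close>

lemma dpot_change:
  assumes w: "interior w" and e: "sqrt (nsq n w h / l) \<le> e" "e < 1" and \<mu>: "\<mu> \<ge> 0"
  shows "\<bar>dpot \<mu> n (line w h 1) k - dpot \<mu> n w k - hip n w h k\<bar>
     \<le> (e / (1 - e) + \<mu> * (5 / l / (1 - e)\<^sup>2)) * (sqrt (nsq n w h) * sqrt (nsq n w k))"
proof -
  have "\<bar>\<mu> * (dvol n (line w h 1) k - dvol n w k)\<bar> \<le> \<mu> * (5 / l / (1 - e)\<^sup>2 * (sqrt (nsq n w h) * sqrt (nsq n w k)))"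
    unfolding abs_mult using mult_left_mono[OF dvol_change[OF w e, of k] \<mu>] \<mu> by simp
  then show ?thesis using dloss_change[OF w e, of k] unfolding dpot_def
    by (simp add: algebra_simps abs_le_iff)
qed

section \<open>One round: new data and a Newton step\<close>

lemma lev_Suc:
  assumes w: "interior w"
  shows "lev (Suc n) w r s = lev n w r s - lev n w r (d + n) * lev n w (d + n) s / (1 + lev n w (d + n) (d + n))"
proof -
  define R where "R = b (d + n) \<odot> w"
  define Q where "Q = 1 + lev n w (d + n) (d + n)"
  have R: "R \<noteq> 0" using ip_pos[OF w, of "d + n"] by (simp add: R_def)
  have Q: "1 + wt w (d + n) * kern (wt w) n (b (d + n)) (b (d + n)) = Q"
    by (simp add: Q_def lev_def wt_def c_def power2_eq_square)
  have "Q \<noteq> 0" using lev_nonneg[OF w, of n "d + n"] by (simp add: Q_def)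
  moreover have "wt w (d + n) = 1 / (R * R)" by (simp add: wt_def c_def R_def power2_eq_square)
  ultimately show ?thesis using R ip_pos[OF w, of r] ip_pos[OF w, of s]
    unfolding lev_def[of "Suc n"] kern.simps Q Q_def[symmetric]
    by (simp add: lev_def[of n w r s] lev_def[of n w r "d + n"] lev_def[of n w "d + n" s]
        R_def[symmetric] field_simps)
qed

lemma lev_Suc_new:
  assumes w: "interior w"
  shows "lev (Suc n) w (d + n) (d + n) = lev n w (d + n) (d + n) / (1 + lev n w (d + n) (d + n))"
proof -
  have "1 + lev n w (d + n) (d + n) \<noteq> 0" using lev_nonneg[OF w, of n "d + n"] by simp
  then show ?thesis unfolding lev_Suc[OF w] by (simp add: field_simps)
qed

text \<open>
  The income of a round: the volumetric barrier rises by \<open>ln (1 + q) / 2\<close>, and the new leverage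
  score is \<open>q / (1 + q) \<le> ln (1 + q)\<close>.
\<close>

lemma vol_Suc:
  assumes w: "interior w"
  shows "vol n w + lev (Suc n) w (d + n) (d + n) / 2 \<le> vol (Suc n) w"
proof -
  define q where "q = lev n w (d + n) (d + n)"
  have q: "q \<ge> 0" using lev_nonneg[OF w, of n "d + n"] by (simp add: q_def)
  have "vol (Suc n) w = vol n w + ln (1 + q) / 2"
    by (simp add: vol_def ldet_def q_def lev_def wt_def c_def power2_eq_square add_divide_distrib)
  moreover have "q / (1 + q) \<le> ln (1 + q)"
    using ln_le_minus_one[of "1 / (1 + q)"] q by (simp add: ln_div field_simps)
  then have "q / (1 + q) / 2 \<le> ln (1 + q) / 2" by (rule divide_right_mono) simp
  ultimately show ?thesis unfolding lev_Suc_new[OF w] q_def[symmetric] by (simp only: add_left_mono)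
qed

text \<open>
  New data lower the old leverage scores by \<open>(lev n w (d + n) r)\<^sup>2 / (1 + q)\<close>, and these decrements,
  weighted, add up to the new leverage score.
\<close>

lemma dvol_Suc:
  assumes w: "interior w"
  defines "\<sigma> n \<equiv> lev (Suc n) w (d + n) (d + n)"
  shows "\<bar>dvol (Suc n) w k - dvol n w k\<bar> \<le> 2 * \<sigma> n * sqrt (nsq (Suc n) w k / l)"
proof -
  define q where "q = lev n w (d + n) (d + n)"
  have q: "q \<ge> 0" using lev_nonneg[OF w, of n "d + n"] by (simp add: q_def)
  have \<sigma>: "\<sigma> n = q / (1 + q)" unfolding \<sigma>_def q_def lev_Suc_new[OF w] ..
  have \<sigma>0: "\<sigma> n \<ge> 0" using q by (simp add: \<sigma>)
  define M where "M = sqrt (nsq (Suc n) w k / l)"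
  have M: "\<bar>rat w r k\<bar> \<le> M" for r unfolding M_def using rat_le[OF w] .
  have ldiff: "lev n w r r - lev (Suc n) w r r = (lev n w (d + n) r)\<^sup>2 / (1 + q)" for r
    unfolding lev_Suc[OF w] q_def by (simp add: power2_eq_square lev_commute[of n w r "d + n"])
  have "dvol (Suc n) w k - dvol n w k
     = (\<Sum>r<d+n. c r * ((lev n w r r - lev (Suc n) w r r) * rat w r k)) - \<sigma> n * rat w (d + n) k"
    unfolding dvol_def by (simp add: \<sigma>_def c_def[of "d + n"] left_diff_distrib right_diff_distrib sum_subtractf)
  moreover have "\<bar>\<Sum>r<d+n. c r * ((lev n w r r - lev (Suc n) w r r) * rat w r k)\<bar> \<le> \<sigma> n * M"
  proof -
    have "\<bar>\<Sum>r<d+n. c r * ((lev n w r r - lev (Suc n) w r r) * rat w r k)\<bar>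
        \<le> (\<Sum>r<d+n. c r * (lev n w (d + n) r)\<^sup>2 * (M / (1 + q)))"
    proof (rule order_trans[OF sum_abs], rule sum_mono)
      fix r
      have "c r * (lev n w (d + n) r)\<^sup>2 / (1 + q) * \<bar>rat w r k\<bar> \<le> c r * (lev n w (d + n) r)\<^sup>2 / (1 + q) * M"
        using M c_nonneg q by (intro mult_left_mono) auto
      then show "\<bar>c r * ((lev n w r r - lev (Suc n) w r r) * rat w r k)\<bar> \<le> c r * (lev n w (d + n) r)\<^sup>2 * (M / (1 + q))"
        unfolding ldiff using c_nonneg[of r] q by (simp add: abs_mult)
    qed
    also have "\<dots> = q * (M / (1 + q))"
      unfolding sum_distrib_right[symmetric] lev_square_sum[OF w] q_def ..
    finally show ?thesis by (simp add: \<sigma>)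
  qed
  moreover have "\<bar>\<sigma> n * rat w (d + n) k\<bar> \<le> \<sigma> n * M"
    unfolding abs_mult using M \<sigma>0 by (simp add: mult_left_mono)
  ultimately show ?thesis unfolding M_def by linarith
qed

text \<open>
  The expense of a round: the dual local norm of the gradient grows by little more than the
  square root of the new leverage score.
\<close>

lemma dpot_Suc:
  assumes w: "interior w" and \<mu>: "\<mu> \<ge> 0"
    and \<delta>: "\<bar>dpot \<mu> n w k\<bar> \<le> \<delta> * sqrt (nsq n w k)" "\<delta> \<ge> 0"
  defines "\<sigma> \<equiv> lev (Suc n) w (d + n) (d + n)"
  shows "\<bar>dpot \<mu> (Suc n) w k\<bar> \<le> (\<delta> + (1 + 2 * \<mu> / l) * sqrt \<sigma>) * sqrt (nsq (Suc n) w k)"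
proof -
  define N where "N = sqrt (nsq (Suc n) w k)"
  have N: "N \<ge> 0" by (simp add: N_def nsq_nonneg)
  have "\<delta> * sqrt (nsq n w k) \<le> \<delta> * N"
    unfolding N_def using \<delta>(2) nsq_mono[of n "Suc n" w k] by (intro mult_left_mono) auto
  then have 1: "\<bar>dpot \<mu> n w k\<bar> \<le> \<delta> * N" using \<delta>(1) by simp
  have \<sigma>: "\<sigma> \<ge> 0" "sqrt \<sigma> \<le> 1 / sqrt l" unfolding \<sigma>_def
    using lev_nonneg[OF w, of "Suc n"] real_sqrt_le_mono[OF lev_le[OF w, of "Suc n" "d + n"]]
    by (simp_all add: real_sqrt_divide)
  have r: "\<bar>rat w (d + n) k\<bar> \<le> sqrt \<sigma> * N"
    unfolding \<sigma>_def N_def by (rule abs_le_sqrt_mult[OF rat_square_le_lev[OF w]])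
  have "dpot \<mu> (Suc n) w k = dpot \<mu> n w k - rat w (d + n) k + \<mu> * (dvol (Suc n) w k - dvol n w k)"
    by (simp add: dpot_def dloss_def c_def[of "d + n"] algebra_simps)
  moreover have "\<bar>\<mu> * (dvol (Suc n) w k - dvol n w k)\<bar> \<le> \<mu> * (2 / l * sqrt \<sigma> * N)"
  proof -
    have "\<bar>dvol (Suc n) w k - dvol n w k\<bar> \<le> 2 * (sqrt \<sigma> * sqrt \<sigma>) * (N / sqrt l)"
      using dvol_Suc[OF w, of n k] \<sigma>(1) by (simp add: \<sigma>_def N_def real_sqrt_divide)
    also have "\<dots> \<le> 2 * (sqrt \<sigma> * (1 / sqrt l)) * (N / sqrt l)"
      using \<sigma> N l by (intro mult_right_mono mult_left_mono) auto
    also have "\<dots> = 2 / l * sqrt \<sigma> * N" using l by (simp add: field_simps)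
    finally show ?thesis unfolding abs_mult abs_of_nonneg[OF \<mu>] by (rule mult_left_mono[OF _ \<mu>])
  qed
  ultimately have "\<bar>dpot \<mu> (Suc n) w k\<bar> \<le> \<delta> * N + sqrt \<sigma> * N + \<mu> * (2 / l * sqrt \<sigma> * N)"
    using 1 r by linarith
  also have "\<dots> = (\<delta> + (1 + 2 * \<mu> / l) * sqrt \<sigma>) * N" by (simp add: algebra_simps)
  finally show ?thesis unfolding N_def .
qed

definition one :: "nat \<Rightarrow> real" where "one = (\<lambda>_. 1)"

definition neg_grad :: "real \<Rightarrow> nat \<Rightarrow> (nat \<Rightarrow> real) \<Rightarrow> nat \<Rightarrow> real" where
  "neg_grad \<mu> n w i = (\<Sum>r<d+n. c r * (1 + \<mu> * lev n w r r) / (b r \<odot> w) * b r i)"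

text \<open>
  The minimiser of the quadratic model with the matrix of the loss, among the directions that
  keep the sum of the coordinates; \<open>\<kappa>\<close> is the multiplier of that constraint.
\<close>

definition newton_dir :: "real \<Rightarrow> nat \<Rightarrow> (nat \<Rightarrow> real) \<Rightarrow> nat \<Rightarrow> real" where
  "newton_dir \<mu> n w = (let k = kern (wt w) n; g = neg_grad \<mu> n w; \<kappa> = k one g / k one one in
     (\<lambda>i. if i < d then k (b i) g - \<kappa> * k (b i) one else 0))"

lemma dpot_neg_grad: "dpot \<mu> n w k = - (neg_grad \<mu> n w \<odot> k)"
proof -
  have "neg_grad \<mu> n w \<odot> k = (\<Sum>r<d+n. c r * (1 + \<mu> * lev n w r r) / (b r \<odot> w) * (b r \<odot> k))"
    unfolding dot_prod_def[of d _ k] neg_grad_def sum_distrib_right sum_distrib_left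
    by (subst sum.swap) (simp only: mult.assoc)
  then show ?thesis
    by (simp add: dpot_def dloss_def dvol_def rat_def sum_distrib_left sum.distrib[symmetric] algebra_simps
       add_divide_distrib flip: sum_negf)
qed

text \<open>
  The divisor of the multiplier in \<open>newton_dir\<close>.
\<close>

lemma kern_one_one_pos:
  assumes w: "interior w" and d: "d \<ge> 1"
  shows "kern (wt w) n one one > 0"
proof -
  interpret weighted_atoms d b n "wt w" by (rule weighted[OF w])
  have "(one \<odot> one)\<^sup>2 \<le> kern (wt w) n one one * (\<Sum>r<d+n. wt w r * (b r \<odot> one)\<^sup>2)"
    by (rule ip_square_le) simp
  moreover have "(one \<odot> one)\<^sup>2 > 0" using d by (simp add: one_def dot_prod_def)
  ultimately have "kern (wt w) n one one \<noteq> 0" by (intro notI) simp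
  with kern_nonneg'[of n one] show ?thesis by simp
qed

lemma
  assumes w: "interior w" and d: "d \<ge> 1"
  shows newton_dir_tangent: "one \<odot> newton_dir \<mu> n w = 0"
    and hip_newton_dir: "one \<odot> k = 0 \<Longrightarrow> hip n w (newton_dir \<mu> n w) k = - dpot \<mu> n w k"
proof -
  interpret weighted_atoms d b n "wt w" by (rule weighted[OF w])
  define K where "K = kern (wt w) n"
  define g where "g = neg_grad \<mu> n w"
  define \<kappa> where "\<kappa> = K one g / K one one"
  define p where "p = (\<lambda>i. 1 * g i - \<kappa> * one i)"
  have K: "K x p = K x g - \<kappa> * K x one" for x
    unfolding K_def p_def kern_diff by simp
  have h: "newton_dir \<mu> n w = (\<lambda>i. if i < d then K (b i) p else 0)"
    unfolding K unfolding newton_dir_def K_def g_def \<kappa>_def Let_def by (rule refl)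
  have ip: "x \<odot> newton_dir \<mu> n w = K x p" for x
  proof -
    have "x \<odot> newton_dir \<mu> n w = (\<lambda>i. K (b i) p) \<odot> x"
      unfolding h by (simp add: dot_prod_def mult.commute)
    then show ?thesis unfolding K_def kern_unit_ip .
  qed
  show "one \<odot> newton_dir \<mu> n w = 0"
    unfolding ip K \<kappa>_def using kern_one_one_pos[OF w d, of n] by (simp add: K_def)
  assume k: "one \<odot> k = 0"
  have "hip n w (newton_dir \<mu> n w) k = (\<Sum>r<d+n. wt w r * (kern (wt w) n p (b r) * (b r \<odot> k)))"
    unfolding hip_def rat_def ip K_def
    by (intro sum.cong refl) (simp add: wt_def kern_commute[of _ n p "b _"] power2_eq_square)
  also have "\<dots> = p \<odot> k" by (rule inverse_identity) simp
  also have "\<dots> = g \<odot> k - \<kappa> * (one \<odot> k)"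
    by (simp add: p_def dot_prod_def left_diff_distrib sum_subtractf sum_distrib_left mult.assoc)
  finally show "hip n w (newton_dir \<mu> n w) k = - dpot \<mu> n w k"
    unfolding dpot_neg_grad g_def k by simp
qed

lemma hip_self: "hip n w h h = nsq n w h"
  by (simp add: hip_def nsq_def power2_eq_square)

text \<open>
  The dual local norm of the gradient, restricted to the tangent space of the simplex, is at most \<open>\<delta>\<close>.
\<close>

definition near_stationary :: "real \<Rightarrow> nat \<Rightarrow> (nat \<Rightarrow> real) \<Rightarrow> real \<Rightarrow> bool" where
  "near_stationary \<mu> n w \<delta> \<longleftrightarrow> 0 \<le> \<delta> \<and> (\<forall>k. one \<odot> k = 0 \<longrightarrow> \<bar>dpot \<mu> n w k\<bar> \<le> \<delta> * sqrt (nsq n w k))"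

definition newton_step :: "real \<Rightarrow> nat \<Rightarrow> (nat \<Rightarrow> real) \<Rightarrow> nat \<Rightarrow> real" where
  "newton_step \<mu> n w = line w (newton_dir \<mu> n w) 1"

text \<open>
  The step has local length at most \<open>\<delta> \<le> 1\<close>, so with \<open>l = 400\<close> all ratios change by at most
  \<open>1 / 20\<close>.  The prediction error of \<open>dpot_change\<close> is then at most \<open>\<delta> / 5\<close>, and passing to
  the local norm at the new point costs a factor \<open>21 / 20\<close>.  By convexity the
  potential drops by no more than the predicted \<open>\<delta>\<^sup>2\<close>.
\<close>

lemma newton_step_improves:
  assumes w: "interior w" and d: "d \<ge> 1" and \<delta>: "near_stationary \<mu> n w \<delta>" "\<delta> \<le> 1"
    and l400: "l = 400" and mu6: "\<mu> = 6"
  shows "interior (newton_step \<mu> n w)" "one \<odot> newton_step \<mu> n w = one \<odot> w"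
    "near_stationary \<mu> n (newton_step \<mu> n w) (\<delta> / 4)"
    "pot \<mu> n w \<le> pot \<mu> n (newton_step \<mu> n w) + \<delta>\<^sup>2"
proof -
  define h where "h = newton_dir \<mu> n w"
  let ?p = "line w h 1"
  have step: "newton_step \<mu> n w = ?p" by (simp add: newton_step_def h_def)
  have tan: "one \<odot> h = 0" unfolding h_def by (rule newton_dir_tangent[OF w d])
  have hip: "hip n w h k = - dpot \<mu> n w k" if "one \<odot> k = 0" for k
    unfolding h_def by (rule hip_newton_dir[OF w d that])
  define N where "N = sqrt (nsq n w h)"
  have N: "N \<ge> 0" "N * N = nsq n w h" by (simp_all add: N_def nsq_nonneg)
  have NN: "N * N = - dpot \<mu> n w h" unfolding N hip_self[symmetric] using hip[OF tan] .
  also have "\<dots> \<le> \<delta> * N" using \<delta>(1) tan unfolding near_stationary_def N_def by (simp add: abs_le_iff)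
  finally have "N \<le> \<delta>" using N(1) \<delta>(1) by (cases "N = 0") (auto simp: near_stationary_def)
  then have N1: "N \<le> 1" using \<delta>(2) by simp
  have "sqrt (nsq n w h / l) = N / 20" by (simp add: l400 N_def real_sqrt_divide)
  then have e: "sqrt (nsq n w h / l) \<le> 1/20" "(1/20 :: real) < 1" using N1 by simp_all
  have int: "interior ?p" by (rule interior_small_step[OF w e])
  show "interior (newton_step \<mu> n w)" unfolding step by (rule int)
  show "one \<odot> newton_step \<mu> n w = one \<odot> w" unfolding step ip_line by (simp add: tan)
  have "pot \<mu> n w + dpot \<mu> n w h \<le> pot \<mu> n ?p" using mu6 by (intro pot_convex[OF w int]) simp
  moreover have "- dpot \<mu> n w h \<le> \<delta>\<^sup>2"
    using NN \<open>N \<le> \<delta>\<close> N(1) mult_mono[of N \<delta> N \<delta>] by (simp add: power2_eq_square)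
  ultimately show "pot \<mu> n w \<le> pot \<mu> n (newton_step \<mu> n w) + \<delta>\<^sup>2" unfolding step by simp
  have "\<bar>dpot \<mu> n ?p k\<bar> \<le> \<delta> / 4 * sqrt (nsq n ?p k)" if k: "one \<odot> k = 0" for k
  proof -
    have "\<bar>dpot \<mu> n ?p k\<bar> \<le> ((1/20) / (1 - 1/20) + \<mu> * (5 / l / (1 - 1/20)\<^sup>2)) * (N * sqrt (nsq n w k))"
      using dpot_change[OF w e, of \<mu> k] hip[OF k] mu6 unfolding N_def by simp
    also have "\<dots> \<le> 1/5 * (N * sqrt (nsq n w k))"
      using N(1) nsq_nonneg by (intro mult_right_mono) (simp_all add: l400 mu6 power2_eq_square)
    also have "\<dots> \<le> 1/5 * (\<delta> * ((1 + 1/20) * sqrt (nsq n ?p k)))"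
    proof (intro mult_left_mono mult_mono)
      show "sqrt (nsq n w k) \<le> (1 + 1/20) * sqrt (nsq n ?p k)"
        by (rule sqrt_nsq_mono) (use rat_line(2)[OF w e, of 1] in auto)
    qed (use \<open>N \<le> \<delta>\<close> N nsq_nonneg \<delta> in \<open>auto simp: near_stationary_def\<close>)
    also have "\<dots> \<le> 1/4 * (\<delta> * sqrt (nsq n ?p k))"
      using mult_nonneg_nonneg[of \<delta> "sqrt (nsq n ?p k)"] nsq_nonneg \<delta>(1) by (simp add: near_stationary_def)
    finally show ?thesis by simp
  qed
  then show "near_stationary \<mu> n (newton_step \<mu> n w) (\<delta> / 4)"
    unfolding step near_stationary_def using \<delta>(1) by (simp add: near_stationary_def)
qed

section \<open>The regret bound\<close>

primrec iterate :: "nat \<Rightarrow> nat \<Rightarrow> real" where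
  "iterate 0 = (\<lambda>i. if i < d then 1 / real d else 0)"
| "iterate (Suc n) = newton_step 6 (Suc n) (iterate n)"

text \<open>
  At the uniform portfolio the gradient without data is a multiple of the all-ones vector, hence
  zero along the simplex.
\<close>

lemma near_stationary_start:
  assumes d: "d \<ge> 1"
  shows "near_stationary \<mu> 0 (iterate 0) 0"
proof -
  have w: "interior (iterate 0)" using d by (simp add: interior_def)
  have lev: "lev 0 (iterate 0) i i = 1 / l" if "i < d" for i
    using that d l by (simp add: lev_def wt_def c_def ip_unit unit power2_eq_square cong: if_cong)
      (simp add: if_distrib[of "\<lambda>u. u * _"] if_distrib[of "\<lambda>u. u / _"] cong: if_cong)
  have "dpot \<mu> 0 (iterate 0) k = - ((l + \<mu>) * d * (one \<odot> k))" for k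
  proof -
    have "dloss 0 (iterate 0) k = - (l * d * (one \<odot> k))"
      by (simp add: dloss_def rat_def c_def ip_unit one_def dot_prod_def[of d "\<lambda>_. 1"] sum_distrib_left mult_ac)
    moreover have "dvol 0 (iterate 0) k = - (d * (one \<odot> k))"
    proof -
      have "c r * (lev 0 (iterate 0) r r * rat (iterate 0) r k) = d * k r" if "r < d" for r
        unfolding lev[OF that] using that l by (simp add: rat_def c_def ip_unit)
      then show ?thesis by (simp add: dvol_def one_def dot_prod_def sum_distrib_left)
    qed
    ultimately show ?thesis by (simp add: dpot_def algebra_simps)
  qed
  then show ?thesis by (simp add: near_stationary_def)
qed

text \<open>
  The losses telescope.  A round with leverage score \<open>\<sigma>\<close> brings in \<open>6 * \<sigma> / 2\<close> from the
  volumetric barrier and spends at most \<open>\<epsilon>\<^sup>2 \<le> 2 \<delta>\<^sup>2 + 2.2 \<sigma>\<close> for the Newton step, where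
  \<open>\<delta>\<close> is the error inherited from the previous round.  The reserve \<open>3 \<delta>\<^sup>2\<close> covers the inherited
  part, because the error after the step is only \<open>\<epsilon> / 4\<close>.
\<close>

lemma iterate_invariant:
  assumes d: "d \<ge> 1" and l400: "l = 400"
  shows "interior (iterate n) \<and> one \<odot> iterate n = 1 \<and>
    (\<exists>\<delta>\<le>1/4. near_stationary 6 n (iterate n) \<delta> \<and>
      (\<Sum>s<n. - ln (b (d + s) \<odot> iterate s)) \<le> pot 6 n (iterate n) - pot 6 0 (iterate 0) - 3 * \<delta>\<^sup>2)"
proof (induction n)
  case 0
  have "interior (iterate 0)" using d by (simp add: interior_def)
  moreover have "one \<odot> iterate 0 = 1" using d by (simp add: one_def dot_prod_def)
  ultimately show ?case using near_stationary_start[OF d, of 6] by (intro conjI exI[of _ 0]) auto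
next
  case (Suc n)
  let ?w = "iterate n"
  from Suc obtain \<delta> where w: "interior ?w" "one \<odot> ?w = 1" and \<delta>: "\<delta> \<le> 1/4" "near_stationary 6 n ?w \<delta>"
    and bound: "(\<Sum>s<n. - ln (b (d + s) \<odot> iterate s)) \<le> pot 6 n ?w - pot 6 0 (iterate 0) - 3 * \<delta>\<^sup>2"
    by blast
  have \<delta>0: "\<delta> \<ge> 0" using \<delta>(2) by (simp add: near_stationary_def)
  define \<sigma> where "\<sigma> = lev (Suc n) ?w (d + n) (d + n)"
  have \<sigma>: "\<sigma> \<ge> 0" "\<sigma> \<le> 1/400"
    using lev_nonneg[OF w(1)] lev_le[OF w(1), of "Suc n" "d + n"] by (simp_all add: \<sigma>_def l400)
  define \<epsilon> where "\<epsilon> = \<delta> + (1 + 2 * 6 / l) * sqrt \<sigma>"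
  have "sqrt \<sigma> \<le> sqrt ((1/20)\<^sup>2)" using \<sigma>(2) by (intro real_sqrt_le_mono) (simp add: power2_eq_square)
  then have s20: "sqrt \<sigma> \<le> 1/20" by simp
  then have \<epsilon>: "\<epsilon> \<le> 1" using \<delta>(1) by (simp add: \<epsilon>_def l400)
  have st: "near_stationary 6 (Suc n) ?w \<epsilon>"
    using dpot_Suc[OF w(1), of 6 n _ \<delta>] \<delta>(2) \<delta>0 \<sigma>(1) l400
    unfolding near_stationary_def \<epsilon>_def \<sigma>_def by simp
  note step = newton_step_improves[OF w(1) d st \<epsilon> l400 refl, folded iterate.simps(2)]
  have "\<epsilon>\<^sup>2 \<le> 2 * \<delta>\<^sup>2 + 2 * (1.03 * sqrt \<sigma>)\<^sup>2"
    using sum_squares_bound[of \<delta> "1.03 * sqrt \<sigma>"] by (simp add: \<epsilon>_def l400 power2_sum)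
  also have "2 * (1.03 * sqrt \<sigma>)\<^sup>2 \<le> 2.2 * \<sigma>" using \<sigma>(1) by (simp add: power_mult_distrib power2_eq_square)
  finally have \<epsilon>2: "\<epsilon>\<^sup>2 \<le> 2 * \<delta>\<^sup>2 + 2.2 * \<sigma>" by simp
  have "- ln (b (d + n) \<odot> ?w) = pot 6 (Suc n) ?w - pot 6 n ?w - 6 * (vol (Suc n) ?w - vol n ?w)"
    by (simp add: pot_def cum_loss_def c_def[of "d + n"])
  then have "- ln (b (d + n) \<odot> ?w) \<le> pot 6 (Suc n) (iterate (Suc n)) + \<epsilon>\<^sup>2 - pot 6 n ?w - 3 * \<sigma>"
    using step(4) vol_Suc[OF w(1), of n, folded \<sigma>_def]
    by (simp only: diff_le_eq right_diff_distrib)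
  with bound have "(\<Sum>s<Suc n. - ln (b (d + s) \<odot> iterate s))
      \<le> pot 6 (Suc n) (iterate (Suc n)) - pot 6 0 (iterate 0) - 3 * \<delta>\<^sup>2 + \<epsilon>\<^sup>2 - 3 * \<sigma>"
    by (simp del: iterate.simps)
  moreover have "\<epsilon>\<^sup>2 + 3 * (\<epsilon> / 4)\<^sup>2 \<le> 3 * \<delta>\<^sup>2 + 3 * \<sigma>"
  proof -
    have "(\<epsilon> / 4)\<^sup>2 = \<epsilon>\<^sup>2 / 16" by (simp add: power_divide)
    then show ?thesis using \<epsilon>2 \<sigma>(1) zero_le_power2[of \<delta>] by linarith
  qed
  ultimately have "(\<Sum>s<Suc n. - ln (b (d + s) \<odot> iterate s))
      \<le> pot 6 (Suc n) (iterate (Suc n)) - pot 6 0 (iterate 0) - 3 * (\<epsilon> / 4)\<^sup>2" by linarith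
  then show ?case using step(1-3) w(2) \<epsilon> by (intro conjI exI[of _ "\<epsilon> / 4"]) auto
qed

text \<open>
  The comparator is \<open>v\<close>, the portfolio \<open>u\<close> mixed with the uniform one in the proportion
  \<open>\<theta> = 1 / (n + 1)\<close>.  Over all rounds the mixing costs at most one unit of loss; in return the
  coordinates of \<open>v\<close> are at least \<open>1 / (d (n + 1))\<close>, which bounds both barriers at \<open>v\<close>.
\<close>

lemma iterate_regret:
  assumes d: "d \<ge> 1" and l400: "l = 400" and n: "n \<ge> 1"
    and u: "\<And>i. i < d \<Longrightarrow> u i \<ge> 0" "one \<odot> u = 1" "\<And>s. s < n \<Longrightarrow> b (d + s) \<odot> u > 0"
  shows "(\<Sum>s<n. - ln (b (d + s) \<odot> iterate s)) \<le> (\<Sum>s<n. - ln (b (d + s) \<odot> u)) + 1000 * d * ln (real (n + d))"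
proof -
  define \<theta> where "\<theta> = 1 / (real n + 1)"
  define v where "v i = (1 - \<theta>) * u i + \<theta> * (1 / d)" for i
  define A where "A = ln (real d * (real n + 1))"
  have ci: "c i = (if i < d then 400 else 1)" for i unfolding c_def unfolding l400 by simp
  have \<theta>: "\<theta> > 0" "\<theta> < 1" "1 - \<theta> = real n / (real n + 1)" using n by (auto simp: \<theta>_def field_simps)
  have v_low: "v i \<ge> 1 / (real d * (real n + 1))" if "i < d" for i
  proof -
    have "0 \<le> (1 - \<theta>) * u i" using u(1)[OF that] \<theta> by simp
    then show ?thesis by (simp add: v_def \<theta>_def field_simps)
  qed
  have v_pos: "v i > 0" if "i < d" for i
    using less_le_trans[OF _ v_low[OF that], of 0] d by simp
  then have v: "interior v" by (simp add: interior_def)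
  have one_v: "one \<odot> v = 1"
  proof -
    have "one \<odot> v = (1 - \<theta>) * (one \<odot> u) + \<theta>"
      using d by (simp add: one_def dot_prod_def v_def sum.distrib sum_distrib_left)
    then show ?thesis using u(2) by simp
  qed
  have ln_v: "- ln (v i) \<le> A" if "i < d" for i
  proof -
    have "ln (1 / (real d * (real n + 1))) \<le> ln (v i)"
      using v_low[OF that] v_pos[OF that] d by (subst ln_le_cancel_iff) auto
    moreover have "ln (1 / (real d * (real n + 1))) = - A" using d by (simp add: A_def ln_div)
    ultimately show ?thesis by simp
  qed
  have data: "- ln (b (d + s) \<odot> v) \<le> - ln (b (d + s) \<odot> u) + 1 / n" if "s < n" for s
  proof -
    have "(1 - \<theta>) * (b (d + s) \<odot> u) \<le> b (d + s) \<odot> v"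
      unfolding dot_prod_def sum_distrib_left v_def
      using \<theta> atom_nonneg by (intro sum_mono) (simp add: algebra_simps)
    then have "ln ((1 - \<theta>) * (b (d + s) \<odot> u)) \<le> ln (b (d + s) \<odot> v)"
      using \<theta> u(3)[OF that] ip_pos[OF v] n by (subst ln_le_cancel_iff) auto
    moreover have "ln ((1 - \<theta>) * (b (d + s) \<odot> u)) = ln (1 - \<theta>) + ln (b (d + s) \<odot> u)"
      using \<theta> u(3)[OF that] by (intro ln_mult_pos) auto
    moreover have "- ln (1 - \<theta>) \<le> 1 / n"
      using ln_le_minus_one[of "1 / (1 - \<theta>)"] \<theta> n unfolding \<theta>(3) by (simp add: ln_div field_simps)
    ultimately show ?thesis by linarith
  qed
  have closs: "cum_loss n v \<le> 400 * d * A + ((\<Sum>s<n. - ln (b (d + s) \<odot> u)) + 1)"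
  proof -
    have "cum_loss n v = (\<Sum>i<d. 400 * - ln (v i)) + (\<Sum>s<n. - ln (b (d + s) \<odot> v))"
      unfolding cum_loss_def sum_lessThan_add by (simp add: ci ip_unit sum_negf)
    also have "(\<Sum>i<d. 400 * - ln (v i)) \<le> (\<Sum>i<d. 400 * A)"
      using ln_v by (intro sum_mono mult_left_mono) auto
    also have "(\<Sum>s<n. - ln (b (d + s) \<odot> v)) \<le> (\<Sum>s<n. - ln (b (d + s) \<odot> u) + 1 / n)"
      using data by (intro sum_mono) auto
    also have "\<dots> = (\<Sum>s<n. - ln (b (d + s) \<odot> u)) + 1" using n by (simp only: sum.distrib) simp
    finally show ?thesis by simp
  qed
  have vol_v: "vol n v \<le> d * (ln (400 + real n) / 2 + A)"
  proof -
    have "ldet (wt v) n \<le> (\<Sum>i<d. ln (wt v i * (1 + real n / l)))"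
    proof (rule ldet_le)
      show "0 < v i" if "i < d" for i by (rule v_pos[OF that])
    qed (use l atom_nonneg ip_pos[OF v] in \<open>simp_all add: wt_def c_def ip_unit\<close>)
    also have "\<dots> \<le> (\<Sum>i<d. ln (400 + real n) + 2 * A)"
    proof (rule sum_mono)
      fix i assume "i \<in> {..<d}"
      then have i: "i < d" by simp
      have "wt v i * (1 + real n / l) = (400 + real n) / (v i)\<^sup>2"
        using i unfolding wt_def by (simp add: ci ip_unit) (simp add: l400 field_simps)
      then have "ln (wt v i * (1 + real n / l)) = ln (400 + real n) + 2 * - ln (v i)"
        using v_pos[OF i] by (simp add: ln_div ln_realpow)
      then show "ln (wt v i * (1 + real n / l)) \<le> ln (400 + real n) + 2 * A"
        using ln_v[OF i] by simp
    qed
    finally show ?thesis by (simp add: vol_def algebra_simps)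
  qed
  have pot0: "pot 6 0 (iterate 0) \<ge> 0"
  proof -
    have "ln (400 * (real d)\<^sup>2) \<ge> 0" "ln (real d) \<ge> 0"
      using d one_le_power[of "real d" 2] by (auto intro!: ln_ge_zero simp del: one_le_power)
    then show ?thesis
      by (simp add: pot_def cum_loss_def vol_def ldet_def wt_def ci ip_unit ln_div power_divide)
  qed
  obtain \<delta> where w: "interior (iterate n)" "one \<odot> iterate n = 1" and \<delta>: "\<delta> \<le> 1/4" "near_stationary 6 n (iterate n) \<delta>"
    and bound: "(\<Sum>s<n. - ln (b (d + s) \<odot> iterate s)) \<le> pot 6 n (iterate n) - pot 6 0 (iterate 0) - 3 * \<delta>\<^sup>2"
    using iterate_invariant[OF d l400, of n] by blast
  define h where "h i = v i - iterate n i" for i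
  have line: "line (iterate n) h 1 = v" by (simp add: line_def h_def)
  have tan: "one \<odot> h = 0"
    using one_v w(2) by (simp add: one_def dot_prod_def h_def sum_subtractf)
  have "pot 6 n (iterate n) - 1/4 \<le> pot 6 n v"
    using pot_near_min[of "iterate n" h 6 n \<delta>] w(1) v \<delta> tan l400
    unfolding line near_stationary_def by simp
  also have "pot 6 n v \<le> (400 * d * A + ((\<Sum>s<n. - ln (b (d + s) \<odot> u)) + 1)) + 6 * (d * (ln (400 + real n) / 2 + A))"
    unfolding pot_def using closs vol_v by (intro add_mono mult_left_mono) auto
  finally have le: "pot 6 n (iterate n) - 1/4 \<le> (400 * d * A + ((\<Sum>s<n. - ln (b (d + s) \<odot> u)) + 1)) + 6 * (d * (ln (400 + real n) / 2 + A))" .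
  have "(\<Sum>s<n. - ln (b (d + s) \<odot> iterate s))
      \<le> (\<Sum>s<n. - ln (b (d + s) \<odot> u)) + (5/4 + d * (406 * A + 3 * ln (400 + real n)))"
  proof -
    have "(400 * d * A + ((\<Sum>s<n. - ln (b (d + s) \<odot> u)) + 1)) + 6 * (d * (ln (400 + real n) / 2 + A)) + 1/4
        = (\<Sum>s<n. - ln (b (d + s) \<odot> u)) + (5/4 + d * (406 * A + 3 * ln (400 + real n)))"
      by (simp add: algebra_simps)
    moreover have "0 \<le> 3 * \<delta>\<^sup>2" by simp
    ultimately show ?thesis using le bound pot0 by linarith
  qed
  also have "5/4 + d * (406 * A + 3 * ln (400 + real n)) \<le> 1000 * d * ln (real (n + d))"
  proof -
    define L where "L = ln (real (n + d))"
    have nd: "real n \<ge> 1" "real d \<ge> 1" using n d by auto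
    have "A \<le> ln (real (n + d) ^ 2)" unfolding A_def
    proof (subst ln_le_cancel_iff)
      show "real d * (real n + 1) \<le> real (n + d) ^ 2"
        unfolding power2_eq_square using nd by (intro mult_mono) auto
    qed (use nd in auto)
    then have A: "A \<le> 2 * L" using nd by (simp add: L_def ln_realpow)
    \<comment> \<open>Since \<open>400 \<le> 2 ^ 9\<close>, the constant is absorbed by a power of \<open>n + d\<close>.\<close>
    have "(2::real) ^ 9 \<le> real (n + d) ^ 9" using nd by (intro power_mono) auto
    then have "400 \<le> real (n + d) ^ 9" by simp
    then have "400 + real n \<le> 400 * real (n + d)" using nd by simp
    also have "\<dots> \<le> real (n + d) ^ 9 * real (n + d)" using \<open>400 \<le> real (n + d) ^ 9\<close> by (intro mult_right_mono) auto
    finally have "ln (400 + real n) \<le> ln (real (n + d) ^ 10)"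
      using nd by (subst ln_le_cancel_iff) (auto simp: power_Suc2[symmetric] eval_nat_numeral mult_ac)
    then have B: "ln (400 + real n) \<le> 10 * L" using nd by (simp add: L_def ln_realpow)
    have "1/2 \<le> ln (2::real)" using ln_le_minus_one[of "1/2"] by (simp add: ln_div)
    also have "\<dots> \<le> L" unfolding L_def using nd by (subst ln_le_cancel_iff) auto
    finally have L: "1/2 \<le> L" .
    have "1 * (1/2) \<le> d * L" using nd L by (intro mult_mono) auto
    then have "5/4 \<le> d * (3 * L)" by simp
    moreover have "d * (406 * A + 3 * ln (400 + real n)) \<le> d * (842 * L)"
      using A B by (intro mult_left_mono) auto
    moreover have "d * (3 * L) + d * (842 * L) \<le> 1000 * d * L" using \<open>1 * (1/2) \<le> d * L\<close> by (simp only: mult.assoc)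
    ultimately show ?thesis unfolding L_def by linarith
  qed
  finally show ?thesis by simp
qed

end

section \<open>Programs on a memory of rows\<close>

text \<open>
  The memory as a matrix: cell \<open>r * d + j\<close> is entry \<open>j < d\<close> of row \<open>r\<close>.  Padding by zeros
  makes the rows vectors that vanish outside \<^term>\<open>{..<d}\<close>, as returns and portfolios do.
\<close>

definition view :: "nat \<Rightarrow> (nat \<Rightarrow> real) \<Rightarrow> nat \<Rightarrow> nat \<Rightarrow> real" where
  "view d m r j = (if j < d then m (r * d + j) else 0)"

definition put :: "(nat \<Rightarrow> nat \<Rightarrow> real) \<Rightarrow> nat \<Rightarrow> nat \<Rightarrow> real \<Rightarrow> nat \<Rightarrow> nat \<Rightarrow> real" where
  "put A r j x = A(r := (A r)(j := x))"

lemma put_apply [simp]: "put A r j x r' j' = (if r' = r \<and> j' = j then x else A r' j')"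
  by (auto simp: put_def)

lemma put_row [simp]: "r' \<noteq> r \<Longrightarrow> put A r j x r' = A r'"
  by (simp add: put_def)

lemma cell_inj:
  fixes d :: nat
  assumes "j < d" "j' < d"
  shows "r' * d + j' = r * d + j \<longleftrightarrow> r' = r \<and> j' = j"
proof
  assume eq: "r' * d + j' = r * d + j"
  have "(r' * d + j') div d = r'" "(r * d + j) div d = r" using assms by simp_all
  with eq have "r' = r" by simp
  with eq show "r' = r \<and> j' = j" by simp
qed simp

lemma view_update:
  assumes "j < d"
  shows "view d (m(r * d + j := x)) = put (view d m) r j x"
  using assms cell_inj[OF assms] by (auto simp: view_def put_def fun_eq_iff)

lemma cell_bound:
  fixes d :: nat
  assumes "r < R" "j < d"
  shows "r * d + j < R * d"
proof -
  have "r * d + j < Suc r * d" using assms(2) by simp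
  also have "\<dots> \<le> R * d" using assms(1) by (intro mult_le_mono1) simp
  finally show ?thesis .
qed

text \<open>
  Index variable 0 holds \<open>d\<close> throughout.  The address is recomputed from row and column at each
  access, so the index variables only count rows and columns.
\<close>

definition cell :: "iexp \<Rightarrow> iexp \<Rightarrow> iexp" where
  "cell r j = IPlus (ITimes r (IVar 0)) j"

text \<open>
  A weakest precondition with cost: on a memory of \<open>R\<close> rows the program \<open>p\<close> terminates within
  \<open>N\<close> steps in a state satisfying \<open>Q\<close>.
\<close>

definition runs :: "nat \<Rightarrow> nat \<Rightarrow> com \<Rightarrow> nat \<Rightarrow> ((nat \<Rightarrow> nat) \<Rightarrow> (nat \<Rightarrow> nat \<Rightarrow> real) \<Rightarrow> bool) \<Rightarrow>
    (nat \<Rightarrow> nat) \<Rightarrow> (nat \<Rightarrow> nat \<Rightarrow> real) \<Rightarrow> bool" where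
  "runs d R p N Q v A \<longleftrightarrow> (\<forall>m. view d m = A \<longrightarrow>
     (\<exists>k v' m'. exec (R * d) p (v, m) k (v', m') \<and> k \<le> N \<and> Q v' (view d m')))"

lemma runsE:
  assumes "runs d R p N Q v (view d m)"
  obtains k v' m' where "exec (R * d) p (v, m) k (v', m')" "k \<le> N" "Q v' (view d m')"
  using assms unfolding runs_def by blast

lemma runs_cost:
  assumes "runs d R p N Q v A" "N \<le> N'"
  shows "runs d R p N' Q v A"
  unfolding runs_def
proof (intro allI impI)
  fix m assume "view d m = A"
  with assms(1) have "runs d R p N Q v (view d m)" by simp
  then obtain k v' m' where "exec (R * d) p (v, m) k (v', m')" "k \<le> N" "Q v' (view d m')"
    by (rule runsE)
  then show "\<exists>k v' m'. exec (R * d) p (v, m) k (v', m') \<and> k \<le> N' \<and> Q v' (view d m')"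
    using assms(2) le_trans by blast
qed

lemma runs_seq:
  assumes "runs d R p N (\<lambda>v A. runs d R q N' Q v A) v A"
  shows "runs d R (Seq p q) (N + N') Q v A"
  unfolding runs_def
proof (intro allI impI)
  fix m assume "view d m = A"
  then obtain k v' m' where 1: "exec (R * d) p (v, m) k (v', m')" "k \<le> N" "runs d R q N' Q v' (view d m')"
    using assms unfolding runs_def[of d R p] by blast
  from 1(3) obtain k' v'' m'' where "exec (R * d) q (v', m') k' (v'', m'')" "k' \<le> N'" "Q v'' (view d m'')"
    by (rule runsE)
  with 1 show "\<exists>k v' m'. exec (R * d) (Seq p q) (v, m) k (v', m') \<and> k \<le> N + N' \<and> Q v' (view d m')"
    by (meson exec.Seq add_mono)
qed

lemma runs_iassign:
  assumes "ival a v \<le> R * d" "Q (v(k := ival a v)) A"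
  shows "runs d R (IAssign k a) (Suc 0) Q v A"
  unfolding runs_def
proof (intro allI impI)
  fix m assume m: "view d m = A"
  have "exec (R * d) (IAssign k a) (v, m) 1 (v(k := ival a v), m)" by (rule exec.IAssign[OF assms(1)])
  then show "\<exists>c v' m'. exec (R * d) (IAssign k a) (v, m) c (v', m') \<and> c \<le> Suc 0 \<and> Q v' (view d m')"
    using assms(2) m by (intro exI conjI) (assumption, simp_all)
qed

lemma cell_less:
  assumes "v 0 = d" "ival r v < R" "ival j v < d"
  shows "ival (cell r j) v < R * d"
  using cell_bound[OF assms(2,3)] assms(1) by (simp add: cell_def)

lemma cell_value:
  assumes "v 0 = d" "ival j v < d"
  shows "m (ival (cell r j) v) = view d m (ival r v) (ival j v)"
  using assms by (simp add: cell_def view_def)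

lemma runs_write:
  assumes "v 0 = d" "ival r v < R" "ival j v < d"
    and p: "\<And>m. view d m = A \<Longrightarrow> exec (R * d) p (v, m) 1 (v, m(ival (cell r j) v := y))"
    and Q: "Q v (put A (ival r v) (ival j v) y)"
  shows "runs d R p (Suc 0) Q v A"
  unfolding runs_def
proof (intro allI impI)
  fix m assume m: "view d m = A"
  have "view d (m(ival (cell r j) v := y)) = put A (ival r v) (ival j v) y"
    using view_update[OF assms(3), of m "ival r v"] m assms(1) by (simp add: cell_def)
  with p[OF m] Q show "\<exists>k v' m'. exec (R * d) p (v, m) k (v', m') \<and> k \<le> Suc 0 \<and> Q v' (view d m')"
    by (intro exI conjI) (assumption, simp_all)
qed

lemma runs_const:
  assumes "v 0 = d" "ival r v < R" "ival j v < d" "Q v (put A (ival r v) (ival j v) (real (ival a v)))"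
  shows "runs d R (RConst (cell r j) a) (Suc 0) Q v A"
  by (rule runs_write[where Q = Q, OF assms(1-3) _ assms(4)]) (rule exec.RConst[OF cell_less[OF assms(1-3)]])

lemma runs_copy:
  assumes "v 0 = d" "ival r v < R" "ival j v < d" "ival r1 v < R" "ival j1 v < d"
    and "Q v (put A (ival r v) (ival j v) (A (ival r1 v) (ival j1 v)))"
  shows "runs d R (RCopy (cell r j) (cell r1 j1)) (Suc 0) Q v A"
proof (rule runs_write[where Q = Q, OF assms(1-3) _ assms(6)])
  fix m assume m: "view d m = A"
  show "exec (R * d) (RCopy (cell r j) (cell r1 j1)) (v, m) 1
      (v, m(ival (cell r j) v := A (ival r1 v) (ival j1 v)))"
    using exec.RCopy[OF cell_less[OF assms(1-3)] cell_less[OF assms(1,4,5)], of m]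
    unfolding cell_value[OF assms(1,5)] m .
qed

lemma runs_arith:
  assumes "v 0 = d" "ival r v < R" "ival j v < d" "ival r1 v < R" "ival j1 v < d" "ival r2 v < R" "ival j2 v < d"
    and "f = Divide \<Longrightarrow> A (ival r2 v) (ival j2 v) \<noteq> 0"
    and "Q v (put A (ival r v) (ival j v) (arith_val f (A (ival r1 v) (ival j1 v)) (A (ival r2 v) (ival j2 v))))"
  shows "runs d R (RArith f (cell r j) (cell r1 j1) (cell r2 j2)) (Suc 0) Q v A"
proof (rule runs_write[where Q = Q, OF assms(1-3) _ assms(9)])
  fix m assume m: "view d m = A"
  show "exec (R * d) (RArith f (cell r j) (cell r1 j1) (cell r2 j2)) (v, m) 1
      (v, m(ival (cell r j) v := arith_val f (A (ival r1 v) (ival j1 v)) (A (ival r2 v) (ival j2 v))))"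
    using exec.RArith[OF cell_less[OF assms(1-3)] cell_less[OF assms(1,4,5)] cell_less[OF assms(1,6,7)], of f m]
      assms(8)
    unfolding cell_value[OF assms(1,5)] cell_value[OF assms(1,7)] m by blast
qed

text \<open>
  The frame of the index variables: nested loops use increasing variables, so a loop over
  variable \<open>k\<close> leaves the variables below \<open>k\<close> alone.
\<close>

definition low :: "nat \<Rightarrow> (nat \<Rightarrow> nat) \<Rightarrow> (nat \<Rightarrow> nat) \<Rightarrow> bool" where
  "low k v v' \<longleftrightarrow> (\<forall>x<k. v x = v' x)"

lemma low_refl [simp]: "low k v v" by (simp add: low_def)

lemma low_trans: "low k v v' \<Longrightarrow> low k' v' v'' \<Longrightarrow> k'' \<le> k \<Longrightarrow> k'' \<le> k' \<Longrightarrow> low k'' v v''"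
  by (simp add: low_def)

lemma lowD: "low k v v' \<Longrightarrow> x < k \<Longrightarrow> v x = v' x"
  by (simp add: low_def)

definition for_loop :: "nat \<Rightarrow> iexp \<Rightarrow> com \<Rightarrow> com" where
  "for_loop k n p = Seq (IAssign k (IConst 0))
     (While (ILess (IVar k) n) (Seq p (IAssign k (IPlus (IVar k) (IConst (Suc 0))))))"

text \<open>
  The invariant speaks about the memory only, since \<open>low\<close> keeps track of the index variables.
\<close>

lemma runs_for:
  assumes bound: "\<And>v'. low k v' v \<Longrightarrow> ival n v' = B" and BM: "B \<le> R * d"
    and init: "I 0 A"
    and step: "\<And>i v' A'. i < B \<Longrightarrow> low k v' v \<Longrightarrow> v' k = i \<Longrightarrow> I i A' \<Longrightarrow>
      runs d R p N (\<lambda>v'' A''. low (Suc k) v'' v' \<and> I (Suc i) A'') v' A'"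
    and post: "\<And>v' A'. low k v' v \<Longrightarrow> I B A' \<Longrightarrow> Q v' A'"
  shows "runs d R (for_loop k n p) (2 + B * (N + 2)) Q v A"
  unfolding runs_def
proof (intro allI impI)
  let ?w = "While (ILess (IVar k) n) (Seq p (IAssign k (IPlus (IVar k) (IConst (Suc 0)))))"
  have loop: "\<exists>c v'' m''. exec (R * d) ?w (v', m') c (v'', m'') \<and> c \<le> 1 + (B - i) * (N + 2) \<and> Q v'' (view d m'')"
    if "i \<le> B" "low k v' v" "v' k = i" "I i (view d m')" for i v' m'
    using that
  proof (induction "B - i" arbitrary: i v' m')
    case 0
    then have "i = B" by simp
    then have "exec (R * d) ?w (v', m') 1 (v', m')"
      using 0 bound[OF 0(3)] by (intro exec.WhileF) simp_all
    then show ?case using post[OF 0(3)] 0 \<open>i = B\<close> by (intro exI conjI) auto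
  next
    case (Suc x)
    then have i: "i < B" by simp
    from step[OF i Suc(4,5,6)] obtain c1 v1 m1 where
      1: "exec (R * d) p (v', m') c1 (v1, m1)" "c1 \<le> N" "low (Suc k) v1 v'" "I (Suc i) (view d m1)"
      by (rule runsE) auto
    have v1k: "v1 k = i" using 1(3) Suc(5) by (simp add: low_def)
    have 2: "exec (R * d) (IAssign k (IPlus (IVar k) (IConst (Suc 0)))) (v1, m1) 1 (v1(k := Suc i), m1)"
      using exec.IAssign[of "IPlus (IVar k) (IConst (Suc 0))" v1 "R * d" k m1] i BM v1k by simp
    have low: "low k (v1(k := Suc i)) v" using 1(3) Suc(4) by (auto simp: low_def)
    have x: "x = B - Suc i" using Suc.hyps(2) by simp
    from Suc.hyps(1)[OF x Suc_leI[OF i] low fun_upd_same 1(4)] obtain c2 v2 m2 where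
      3: "exec (R * d) ?w (v1(k := Suc i), m1) c2 (v2, m2)"
      "c2 \<le> 1 + (B - Suc i) * (N + 2)" "Q v2 (view d m2)" by blast
    have "exec (R * d) ?w (v', m') (Suc ((c1 + 1) + c2)) (v2, m2)"
      using i bound[OF Suc(4)] Suc(5) by (intro exec.WhileT[OF _ _ exec.Seq[OF 1(1) 2] 3(1)]) simp_all
    moreover have "Suc ((c1 + 1) + c2) \<le> 1 + (B - i) * (N + 2)"
    proof -
      have "(B - i) * (N + 2) = (B - Suc i) * (N + 2) + (N + 2)" using i by (simp add: Suc_diff_Suc[symmetric])
      then show ?thesis using 1(2) 3(2) by linarith
    qed
    ultimately show ?case using 3(3) by blast
  qed
  fix m assume m: "view d m = A"
  have "exec (R * d) (IAssign k (IConst 0)) (v, m) 1 (v(k := 0), m)"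
    using exec.IAssign[of "IConst 0" v "R * d" k m] by simp
  moreover have "low k (v(k := 0)) v" by (simp add: low_def)
  then obtain c v2 m2 where "exec (R * d) ?w (v(k := 0), m) c (v2, m2)" "c \<le> 1 + B * (N + 2)" "Q v2 (view d m2)"
    using loop[of 0 "v(k := 0)" m] init m by auto
  ultimately show "\<exists>c v' m'. exec (R * d) (for_loop k n p) (v, m) c (v', m') \<and> c \<le> 2 + B * (N + 2) \<and> Q v' (view d m')"
    unfolding for_loop_def by (intro exI conjI) (rule exec.Seq, assumption+, simp)
qed

text \<open>
  The frame of the memory: only the rows in \<open>S\<close> have changed.
\<close>

definition agree :: "nat set \<Rightarrow> (nat \<Rightarrow> nat \<Rightarrow> real) \<Rightarrow> (nat \<Rightarrow> nat \<Rightarrow> real) \<Rightarrow> bool" where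
  "agree S A A' \<longleftrightarrow> (\<forall>r. r \<notin> S \<longrightarrow> A' r = A r)"

lemma agree_refl [simp]: "agree S A A" by (simp add: agree_def)

lemma agreeD: "agree S A A' \<Longrightarrow> r \<notin> S \<Longrightarrow> A' r = A r" by (simp add: agree_def)

lemma agree_put [simp]: "agree S A A' \<Longrightarrow> r \<in> S \<Longrightarrow> agree S A (put A' r j x)"
  by (auto simp: agree_def)

lemma agree_trans: "agree S A A' \<Longrightarrow> agree S' A' A'' \<Longrightarrow> S \<union> S' \<subseteq> S'' \<Longrightarrow> agree S'' A A''"
  unfolding agree_def by (metis UnI1 UnI2 subsetD)

text \<open>
  Row 15 holds a temporary value, whose content is never specified.
\<close>

definition tmp :: iexp where "tmp = cell (IConst 15) (IConst 0)"

definition dot_code :: "nat \<Rightarrow> iexp \<Rightarrow> iexp \<Rightarrow> iexp \<Rightarrow> iexp \<Rightarrow> com" where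
  "dot_code k r j r1 r2 = Seq (RConst (cell r j) (IConst 0))
     (for_loop k (IVar 0) (Seq (RArith Mul tmp (cell r1 (IVar k)) (cell r2 (IVar k)))
        (RArith Add (cell r j) (cell r j) tmp)))"

lemma runs_dot:
  assumes v: "v 0 = d" and d: "d \<ge> 1" and R: "R > 15" and k: "k > 0"
    and stable: "\<And>v'. low k v' v \<Longrightarrow> ival r v' = ir \<and> ival j v' = ij \<and> ival r1 v' = i1 \<and> ival r2 v' = i2"
    and ranges: "ir < R" "ij < d" "i1 < R" "i2 < R"
    and distinct: "ir \<noteq> 15" "i1 \<noteq> 15" "i2 \<noteq> 15" "ir \<noteq> i1" "ir \<noteq> i2"
    and post: "\<And>v' A'. low k v' v \<Longrightarrow> agree {15, ir} A A' \<Longrightarrow>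
      (\<And>j'. A' ir j' = (if j' = ij then dot_prod d (A i1) (A i2) else A ir j')) \<Longrightarrow> Q v' A'"
  shows "runs d R (dot_code k r j r1 r2) (4 * d + 3) Q v A"
proof -
  have sv: "ival r v = ir" "ival j v = ij" using stable[of v] by auto
  have Rd: "d \<le> R * d" using R by simp
  define I where "I i A' \<longleftrightarrow> agree {15, ir} A A' \<and>
    (\<forall>j'. A' ir j' = (if j' = ij then (\<Sum>j<i. A i1 j * A i2 j) else A ir j'))" for i A'
  have "runs d R (dot_code k r j r1 r2) (Suc 0 + (2 + d * ((Suc 0 + Suc 0) + 2))) Q v A"
    unfolding dot_code_def
  proof (rule runs_seq, rule runs_const, goal_cases)
    case 4
    show ?case unfolding sv
    proof (rule runs_for[where I = I])
      show "I 0 (put A ir ij (real (ival (IConst 0) v)))"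
        by (auto simp: I_def)
      fix i v' A' assume i: "i < d" and low: "low k v' v" and v'k: "v' k = i" and I: "I i A'"
      have v0: "v' 0 = d" using lowD[OF low k] v by simp
      have s': "ival r v' = ir" "ival j v' = ij" "ival r1 v' = i1" "ival r2 v' = i2"
        using stable[OF low] by auto
      have rows: "A' i1 = A i1" "A' i2 = A i2" using I distinct by (auto simp: I_def agree_def)
      show "runs d R (Seq (RArith Mul tmp (cell r1 (IVar k)) (cell r2 (IVar k)))
          (RArith Add (cell r j) (cell r j) tmp)) (Suc 0 + Suc 0) (\<lambda>v'' A''. low (Suc k) v'' v' \<and> I (Suc i) A'') v' A'"
        unfolding tmp_def
        by (rule runs_seq, rule runs_arith, simp_all add: v0 s' v'k ranges i R, use d in simp)
           (rule runs_arith, use I d in \<open>simp_all add: v0 s' v'k ranges i R rows I_def distinct\<close>)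
    next
      fix v' A' assume "low k v' v" "I d A'"
      then show "Q v' A'" by (intro post) (auto simp: I_def dot_prod_def)
    qed (use v Rd k in \<open>auto simp: low_def\<close>)
  qed (use v sv ranges in simp_all)
  then show ?thesis by (rule runs_cost) simp
qed

lemma dot_prod_cong:
  "(\<And>i. i < d \<Longrightarrow> x i = x' i) \<Longrightarrow> (\<And>i. i < d \<Longrightarrow> y i = y' i) \<Longrightarrow> dot_prod d x y = dot_prod d x' y'"
  by (simp add: dot_prod_def)

section \<open>The program\<close>

text \<open>
  The rows of the memory are used as follows: 0 holds the portfolio, 1 the latest return, 3 the
  all-ones vector, 2 and 5 the products of the inverse with a vector, 4 the negative gradient, 6 to 9
  and 15 hold scalars in entry 0, \<open>16, \<dots>, 15 + d\<close> the inverse, and \<open>16 + d, \<dots>\<close> the past returns.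
  Index variable 2 counts the stored returns, 3 runs over them, and 4 and 5 run over coordinates.
\<close>

definition matvec_code :: "iexp \<Rightarrow> iexp \<Rightarrow> com" where
  "matvec_code rt rb = for_loop 4 (IVar 0) (dot_code 5 rt (IVar 4) (IPlus (IConst 16) (IVar 4)) rb)"

lemma runs_matvec:
  assumes v: "v 0 = d" and d: "d \<ge> 1" and R: "R \<ge> 16 + d"
    and stable: "\<And>v'. low 4 v' v \<Longrightarrow> ival rb v' = ib"
    and ib: "ib < R" "ib \<noteq> 15" "ir \<noteq> ib" and ir: "ir < 15"
    and post: "\<And>v' A'. low 4 v' v \<Longrightarrow> agree {15, ir} A A' \<Longrightarrow>
      (\<And>i. i < d \<Longrightarrow> A' ir i = dot_prod d (A (16 + i)) (A ib)) \<Longrightarrow> Q v' A'"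
  shows "runs d R (matvec_code (IConst ir) rb) (2 + d * (4 * d + 5)) Q v A"
proof -
  have Rd: "d \<le> R * d" using R d by simp
  define I where "I i A' \<longleftrightarrow> agree {15, ir} A A' \<and> (\<forall>i'<i. A' ir i' = dot_prod d (A (16 + i')) (A ib))" for i A'
  have "runs d R (matvec_code (IConst ir) rb) (2 + d * ((4 * d + 3) + 2)) Q v A"
    unfolding matvec_code_def
  proof (rule runs_for[where I = I])
    fix i v' A' assume i: "i < d" and low: "low 4 v' v" and v'4: "v' 4 = i" and I: "I i A'"
    have v0: "v' 0 = d" using lowD[OF low, of 0] v by simp
    have rows: "A' (16 + i) = A (16 + i)" "A' ib = A ib" using I ib ir by (auto simp: I_def agree_def)
    show "runs d R (dot_code 5 (IConst ir) (IVar 4) (IPlus (IConst 16) (IVar 4)) rb) (4 * d + 3)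
        (\<lambda>v'' A''. low (Suc 4) v'' v' \<and> I (Suc i) A'') v' A'"
    proof (rule runs_dot[where ir = ir and ij = i and ?i1.0 = "16 + i" and ?i2.0 = ib])
      show "ival (IConst ir) v'' = ir \<and> ival (IVar 4) v'' = i \<and> ival (IPlus (IConst 16) (IVar 4)) v'' = 16 + i \<and> ival rb v'' = ib"
        if l: "low 5 v'' v'" for v''
        using lowD[OF l, of 4] v'4 stable[OF low_trans[OF l low]] by simp
      fix v'' A'' assume l: "low 5 v'' v'" and a: "agree {15, ir} A' A''"
        and val: "\<And>j'. A'' ir j' = (if j' = i then dot_prod d (A' (16 + i)) (A' ib) else A' ir j')"
      have "agree {15, ir} A A''" using I a by (auto simp: I_def intro: agree_trans)
      then show "low (Suc 4) v'' v' \<and> I (Suc i) A''"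
        using l I val rows by (auto simp: I_def less_Suc_eq)
    qed (use v0 d R ib ir i in auto)
  next
    fix v' A' assume "low 4 v' v" "I d A'"
    then show "Q v' A'" by (intro post) (auto simp: I_def)
  qed (use v Rd in \<open>auto simp: I_def low_def\<close>)
  then show ?thesis by (rule runs_cost) (simp add: algebra_simps)
qed

abbreviation "brow \<equiv> IPlus (IConst 16) (IVar 4)"
abbreviation "drow \<equiv> IPlus (IPlus (IConst 16) (IVar 0)) (IVar 3)"
abbreviation "s1 \<equiv> cell (IConst 6) (IConst 0)"
abbreviation "s2 \<equiv> cell (IConst 7) (IConst 0)"
abbreviation "lam \<equiv> cell (IConst 8) (IConst 0)"
abbreviation "muc \<equiv> cell (IConst 9) (IConst 0)"
abbreviation "onec \<equiv> cell (IConst 3) (IConst 0)"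

definition diag_code :: com where
  "diag_code = Seq (RConst lam (IConst 400)) (for_loop 4 (IVar 0)
     (Seq (for_loop 5 (IVar 0) (RConst (cell brow (IVar 5)) (IConst 0)))
     (Seq (RArith Mul tmp (cell (IConst 0) (IVar 4)) (cell (IConst 0) (IVar 4)))
          (RArith Divide (cell brow (IVar 4)) tmp lam))))"

definition rank_one_code :: com where
  "rank_one_code = Seq (matvec_code (IConst 2) drow)
     (Seq (dot_code 4 (IConst 6) (IConst 0) (IConst 2) drow)
     (Seq (dot_code 4 (IConst 7) (IConst 0) drow (IConst 0))
     (Seq (RArith Mul s2 s2 s2) (Seq (RArith Add s1 s1 s2)
     (for_loop 4 (IVar 0) (for_loop 5 (IVar 0)
       (Seq (RArith Mul tmp (cell (IConst 2) (IVar 4)) (cell (IConst 2) (IVar 5)))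
       (Seq (RArith Divide tmp tmp s1)
            (RArith Sub (cell brow (IVar 5)) (cell brow (IVar 5)) tmp)))))))))"

definition grad_init_code :: com where
  "grad_init_code = Seq (RConst muc (IConst 6)) (for_loop 4 (IVar 0)
     (Seq (RArith Divide tmp (cell brow (IVar 4)) (cell (IConst 0) (IVar 4)))
     (Seq (RArith Divide tmp tmp (cell (IConst 0) (IVar 4)))
     (Seq (RArith Mul tmp muc tmp)
     (Seq (RArith Add tmp onec tmp)
     (Seq (RArith Mul tmp lam tmp)
          (RArith Divide (cell (IConst 4) (IVar 4)) tmp (cell (IConst 0) (IVar 4)))))))))"

definition grad_code :: com where
  "grad_code = Seq (matvec_code (IConst 2) drow)
     (Seq (dot_code 4 (IConst 6) (IConst 0) (IConst 2) drow)
     (Seq (dot_code 4 (IConst 7) (IConst 0) drow (IConst 0))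
     (Seq (RArith Divide s1 s1 s2) (Seq (RArith Divide s1 s1 s2)
     (Seq (RArith Mul s1 muc s1) (Seq (RArith Add s1 onec s1) (Seq (RArith Divide s1 s1 s2)
     (for_loop 4 (IVar 0)
       (Seq (RArith Mul tmp s1 (cell drow (IVar 4)))
            (RArith Add (cell (IConst 4) (IVar 4)) (cell (IConst 4) (IVar 4)) tmp))))))))))"

definition move_code :: com where
  "move_code = Seq (matvec_code (IConst 2) (IConst 4)) (Seq (matvec_code (IConst 5) (IConst 3))
     (Seq (dot_code 4 (IConst 6) (IConst 0) (IConst 2) (IConst 3))
     (Seq (dot_code 4 (IConst 7) (IConst 0) (IConst 5) (IConst 3))
     (Seq (RArith Divide s1 s1 s2)
     (for_loop 4 (IVar 0)
       (Seq (RArith Mul tmp s1 (cell (IConst 5) (IVar 4)))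
       (Seq (RArith Sub tmp (cell (IConst 2) (IVar 4)) tmp)
            (RArith Add (cell (IConst 0) (IVar 4)) (cell (IConst 0) (IVar 4)) tmp))))))))"

lemma runs_diag:
  assumes v: "v 0 = d" and d: "d \<ge> 1" and R: "R \<ge> 16 + d"
    and post: "\<And>v' A'. low 4 v' v \<Longrightarrow> agree ({8, 15} \<union> {16..<16 + d}) A A' \<Longrightarrow> A' 8 0 = 400 \<Longrightarrow>
      (\<And>i j. i < d \<Longrightarrow> j < d \<Longrightarrow> A' (16 + i) j = (if j = i then A 0 i * A 0 i / 400 else 0)) \<Longrightarrow> Q v' A'"
  shows "runs d R diag_code (3 + d * (3 * d + 6)) Q v A"
proof -
  have Rd: "d \<le> R * d" using R d by simp
  define S where "S = {8, 15} \<union> {16..<16 + d}"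
  define I where "I i A' \<longleftrightarrow> agree S A A' \<and> A' 8 0 = 400 \<and>
    (\<forall>i'<i. \<forall>j<d. A' (16 + i') j = (if j = i' then A 0 i' * A 0 i' / 400 else 0))" for i A'
  have "runs d R diag_code (Suc 0 + (2 + d * (((2 + d * (Suc 0 + 2)) + (Suc 0 + Suc 0)) + 2))) Q v A"
    unfolding diag_code_def
  proof (rule runs_seq, rule runs_const, goal_cases)
    case 4
    show ?case
    proof (rule runs_for[where I = I])
      show "I 0 (put A (ival (IConst 8) v) (ival (IConst 0) v) (real (ival (IConst 400) v)))"
        by (auto simp: I_def S_def)
      fix i v' A' assume i: "i < d" and low: "low 4 v' v" and v'4: "v' 4 = i" and I: "I i A'"
      have v0: "v' 0 = d" using lowD[OF low, of 0] v by simp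
      define J where "J j A'' \<longleftrightarrow> agree {16 + i} A' A'' \<and> (\<forall>j'<j. A'' (16 + i) j' = 0)" for j A''
      show "runs d R (Seq (for_loop 5 (IVar 0) (RConst (cell brow (IVar 5)) (IConst 0)))
           (Seq (RArith Mul tmp (cell (IConst 0) (IVar 4)) (cell (IConst 0) (IVar 4)))
              (RArith Divide (cell brow (IVar 4)) tmp lam)))
          ((2 + d * (Suc 0 + 2)) + (Suc 0 + Suc 0)) (\<lambda>v'' A''. low (Suc 4) v'' v' \<and> I (Suc i) A'') v' A'"
      proof (rule runs_seq, rule runs_for[where I = J])
        fix j v'' A'' assume j: "j < d" and l: "low 5 v'' v'" and v5: "v'' 5 = j" and J: "J j A''"
        have "v'' 0 = d" "v'' 4 = i" using lowD[OF l, of 0] lowD[OF l, of 4] v0 v'4 by simp_all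
        then show "runs d R (RConst (cell brow (IVar 5)) (IConst 0)) (Suc 0)
            (\<lambda>v3 A3. low (Suc 5) v3 v'' \<and> J (Suc j) A3) v'' A''"
          using J i j v5 R by (intro runs_const) (auto simp: J_def less_Suc_eq)
      next
        fix v'' A'' assume l: "low 5 v'' v'" and J: "J d A''"
        have v: "v'' 0 = d" "v'' 4 = i" using lowD[OF l, of 0] lowD[OF l, of 4] v0 v'4 by simp_all
        have A0: "A'' 0 = A 0" "A'' 8 0 = 400" using J I by (auto simp: J_def I_def agree_def S_def)
        have ag: "agree S A A''" using J I i by (auto simp: J_def I_def S_def intro: agree_trans)
        have old: "A'' (16 + i') j = (if j = i' then A 0 i' * A 0 i' / 400 else 0)" if "i' < i" "j < d" for i' j
          using J I that by (auto simp: J_def I_def agree_def)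
        show "runs d R (Seq (RArith Mul tmp (cell (IConst 0) (IVar 4)) (cell (IConst 0) (IVar 4)))
              (RArith Divide (cell brow (IVar 4)) tmp lam)) (Suc 0 + Suc 0)
            (\<lambda>v'' A''. low (Suc 4) v'' v' \<and> I (Suc i) A'') v'' A''"
          unfolding tmp_def using i R d v A0 l J ag old
          by (intro runs_seq runs_arith) (auto simp: I_def J_def S_def less_Suc_eq)
      qed (use v0 Rd in \<open>auto simp: J_def low_def\<close>)
    next
      fix v' A' assume "low 4 v' v" "I d A'"
      then show "Q v' A'" by (intro post) (auto simp: I_def S_def)
    qed (use v Rd in \<open>auto simp: low_def\<close>)
  qed (use v d R in simp_all)
  then show ?thesis by (rule runs_cost) (simp add: algebra_simps)
qed

lemma runs_rank_one:
  assumes v: "v 0 = d" "v 3 = s" and d: "d \<ge> 1" and R: "R > 16 + d + s"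
    and y: "\<And>i. i < d \<Longrightarrow> y i = dot_prod d (A (16 + i)) (A (16 + d + s))"
    and den: "den = dot_prod d y (A (16 + d + s)) + dot_prod d (A (16 + d + s)) (A 0) * dot_prod d (A (16 + d + s)) (A 0)"
      "den \<noteq> 0"
    and post: "\<And>v' A'. low 4 v' v \<Longrightarrow> agree ({2, 6, 7, 15} \<union> {16..<16 + d}) A A' \<Longrightarrow>
      (\<And>i j. i < d \<Longrightarrow> j < d \<Longrightarrow> A' (16 + i) j = A (16 + i) j - y i * y j / den) \<Longrightarrow> Q v' A'"
  shows "runs d R rank_one_code (14 + 20 * d + 9 * d * d) Q v A"
proof -
  have Rd: "d \<le> R * d" using R d by simp
  define S where "S = {2, 6, 7, 15} \<union> {16..<16 + d}"
  let ?a = "A (16 + d + s)" and ?w = "A 0"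
  have dr: "ival drow v' = 16 + d + s" if "low 4 v' v" for v'
    using lowD[OF that, of 0] lowD[OF that, of 3] v by simp
  define F where "F = for_loop 4 (IVar 0) (for_loop 5 (IVar 0)
    (Seq (RArith Mul tmp (cell (IConst 2) (IVar 4)) (cell (IConst 2) (IVar 5)))
    (Seq (RArith Divide tmp tmp s1) (RArith Sub (cell brow (IVar 5)) (cell brow (IVar 5)) tmp))))"
  define G where "G = Seq (RArith Mul s2 s2 s2) (Seq (RArith Add s1 s1 s2) F)"
  let ?F = "2 + d * ((2 + d * ((Suc 0 + (Suc 0 + Suc 0)) + 2)) + 2)"
  have "runs d R rank_one_code ((2 + d * (4 * d + 5)) + ((4 * d + 3) + ((4 * d + 3) +
      (Suc 0 + (Suc 0 + ?F))))) Q v A"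
    unfolding rank_one_code_def F_def[symmetric] G_def[symmetric]
  proof (rule runs_seq, rule runs_matvec[where ib = "16 + d + s"])
    fix v1 A1 assume l1: "low 4 v1 v" and a1: "agree {15, 2} A A1"
      and y1: "\<And>i. i < d \<Longrightarrow> A1 2 i = dot_prod d (A (16 + i)) (A (16 + d + s))"
    have v1: "v1 0 = d" "v1 3 = s" using lowD[OF l1, of 0] lowD[OF l1, of 3] v by simp_all
    show "runs d R (Seq (dot_code 4 (IConst 6) (IConst 0) (IConst 2) drow)
     (Seq (dot_code 4 (IConst 7) (IConst 0) drow (IConst 0))
     G)) ((4 * d + 3) + ((4 * d + 3) +
      (Suc 0 + (Suc 0 + ?F)))) Q v1 A1"
    proof (rule runs_seq, rule runs_dot[where ir = 6 and ij = 0 and ?i1.0 = 2 and ?i2.0 = "16 + d + s"])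
      fix v2 A2 assume l2: "low 4 v2 v1" and a2: "agree {15, 6} A1 A2"
        and q2: "\<And>j'. A2 6 j' = (if j' = 0 then dot_prod d (A1 2) (A1 (16 + d + s)) else A1 6 j')"
      have v2: "v2 0 = d" "v2 3 = s" using lowD[OF l2, of 0] lowD[OF l2, of 3] v1 by simp_all
      show "runs d R (Seq (dot_code 4 (IConst 7) (IConst 0) drow (IConst 0))
     G) ((4 * d + 3) +
      (Suc 0 + (Suc 0 + ?F))) Q v2 A2"
      proof (rule runs_seq, rule runs_dot[where ir = 7 and ij = 0 and ?i1.0 = "16 + d + s" and ?i2.0 = 0])
        fix v3 A3 assume l3: "low 4 v3 v2" and a3: "agree {15, 7} A2 A3"
          and r3: "\<And>j'. A3 7 j' = (if j' = 0 then dot_prod d (A2 (16 + d + s)) (A2 0) else A2 7 j')"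
        have v3: "v3 0 = d" "v3 3 = s" using lowD[OF l3, of 0] lowD[OF l3, of 3] v2 by simp_all
        have l30: "low 4 v3 v" using l1 l2 l3 by (simp add: low_def)
        have A3: "A3 2 i = y i" if "i < d" for i
          using a1 a2 a3 y1[OF that] y[OF that] by (simp add: agree_def)
        have a30: "agree S A A3" using a1 a2 a3 by (auto simp: agree_def S_def)
        have A3B: "A3 (16 + i) = A (16 + i)" if "i < d" for i using a1 a2 a3 that by (auto simp: agree_def)
        have "dot_prod d (A1 2) (A1 (16 + d + s)) = dot_prod d y ?a"
          using y1 y a1 by (intro dot_prod_cong) (auto simp: agree_def)
        then have "A3 6 0 + A3 7 0 * A3 7 0 = den"
          using a1 a2 a3 q2 r3 by (auto simp: agree_def den(1))
        define I where "I i A' \<longleftrightarrow> agree S A A' \<and> (\<forall>i<d. A' 2 i = y i) \<and> A' 6 0 = den \<and>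
           (\<forall>i'<d. \<forall>j<d. A' (16 + i') j = (if i' < i then A (16 + i') j - y i' * y j / den else A (16 + i') j))" for i A'
        have I0: "I 0 (put (put A3 7 0 (A3 7 0 * A3 7 0)) 6 0 (A3 6 0 + A3 7 0 * A3 7 0))"
          using a30 A3 A3B \<open>A3 6 0 + A3 7 0 * A3 7 0 = den\<close> by (auto simp: I_def S_def)
        have loop: "runs d R F
           ?F Q v3 A4" if "I 0 A4" for A4
          unfolding F_def
        proof (rule runs_for[where I = I])
          fix i v4 A5 assume i: "i < d" and l4: "low 4 v4 v3" and v44: "v4 4 = i" and I: "I i A5"
          have v4: "v4 0 = d" using lowD[OF l4, of 0] v3 by simp
          define J where "J j A' \<longleftrightarrow> agree S A A' \<and> (\<forall>i<d. A' 2 i = y i) \<and> A' 6 0 = den \<and>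
           (\<forall>i'<d. \<forall>j'<d. A' (16 + i') j' = (if i' < i \<or> i' = i \<and> j' < j then A (16 + i') j' - y i' * y j' / den else A (16 + i') j'))" for j A'
          show "runs d R (for_loop 5 (IVar 0)
              (Seq (RArith Mul tmp (cell (IConst 2) (IVar 4)) (cell (IConst 2) (IVar 5)))
              (Seq (RArith Divide tmp tmp s1)
              (RArith Sub (cell brow (IVar 5)) (cell brow (IVar 5)) tmp))))
             (2 + d * ((Suc 0 + (Suc 0 + Suc 0)) + 2))
             (\<lambda>v'' A''. low (Suc 4) v'' v4 \<and> I (Suc i) A'') v4 A5"
          proof (rule runs_for[where I = J])
            show "J 0 A5" using I by (auto simp: I_def J_def)
            fix j v5 A6 assume j: "j < d" and l5: "low 5 v5 v4" and v55: "v5 5 = j" and J: "J j A6"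
            have v5: "v5 0 = d" "v5 4 = i" using lowD[OF l5, of 0] lowD[OF l5, of 4] v4 v44 by simp_all
            have val: "A6 2 i = y i" "A6 2 j = y j" "A6 6 0 = den" "A6 (16 + i) j = A (16 + i) j"
              using J i j by (auto simp: J_def)
            have "J (Suc j) (put (put (put A6 15 0 (y i * y j)) 15 0 (y i * y j / den)) (16 + i) j (A (16 + i) j - y i * y j / den))"
              using J i j by (auto simp: J_def S_def less_Suc_eq)
            then show "runs d R (Seq (RArith Mul tmp (cell (IConst 2) (IVar 4)) (cell (IConst 2) (IVar 5)))
              (Seq (RArith Divide tmp tmp s1)
              (RArith Sub (cell brow (IVar 5)) (cell brow (IVar 5)) tmp))) (Suc 0 + (Suc 0 + Suc 0))
               (\<lambda>v'' A''. low (Suc 5) v'' v5 \<and> J (Suc j) A'') v5 A6"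
              unfolding tmp_def using i j R d v5 v55 den(2) val
              by (intro runs_seq runs_arith) simp_all
          next
            fix v5 A6 assume "low 5 v5 v4" "J d A6"
            then show "low (Suc 4) v5 v4 \<and> I (Suc i) A6" by (auto simp: I_def J_def less_Suc_eq)
          qed (use v4 Rd in \<open>auto simp: low_def\<close>)
        next
          fix v4 A5 assume l4: "low 4 v4 v3" and "I d A5"
          moreover have "low 4 v4 v" using l4 l30 by (simp add: low_def)
          ultimately show "Q v4 A5" by (intro post) (auto simp: I_def S_def)
        qed (use v3 Rd that in \<open>auto simp: low_def\<close>)
        show "runs d R G
           (Suc 0 + (Suc 0 + ?F)) Q v3 A3"
          unfolding G_def using loop[OF I0] v3 R d by (intro runs_seq runs_arith) simp_all
      qed (use v2 d R in \<open>auto simp: low_def\<close>)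
    qed (use v1 d R in \<open>auto simp: low_def\<close>)
  qed (use v d R dr in auto)
  then show ?thesis by (rule runs_cost) (simp add: algebra_simps)
qed

lemma runs_grad_init:
  assumes v: "v 0 = d" and d: "d \<ge> 1" and R: "R \<ge> 16 + d"
    and A: "A 8 0 = 400" "A 3 0 = 1" "\<And>i. i < d \<Longrightarrow> A 0 i \<noteq> 0"
    and post: "\<And>v' A'. low 4 v' v \<Longrightarrow> agree {4, 9, 15} A A' \<Longrightarrow> A' 9 0 = 6 \<Longrightarrow>
      (\<And>i. i < d \<Longrightarrow> A' 4 i = 400 * (1 + 6 * (A (16 + i) i / A 0 i / A 0 i)) / A 0 i) \<Longrightarrow> Q v' A'"
  shows "runs d R grad_init_code (3 + 8 * d) Q v A"
proof -
  have Rd: "d \<le> R * d" using R d by simp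
  define I where "I i A' \<longleftrightarrow> agree {4, 9, 15} A A' \<and> A' 9 0 = 6 \<and>
    (\<forall>i'<i. A' 4 i' = 400 * (1 + 6 * (A (16 + i') i' / A 0 i' / A 0 i')) / A 0 i')" for i A'
  have "runs d R grad_init_code (Suc 0 + (2 + d * ((Suc 0 + (Suc 0 + (Suc 0 + (Suc 0 + (Suc 0 + Suc 0))))) + 2))) Q v A"
    unfolding grad_init_code_def
  proof (rule runs_seq, rule runs_const, goal_cases)
    case 4
    show ?case
    proof (rule runs_for[where I = I])
      show "I 0 (put A (ival (IConst 9) v) (ival (IConst 0) v) (real (ival (IConst 6) v)))"
        by (auto simp: I_def)
      fix i v' A' assume i: "i < d" and low: "low 4 v' v" and v'4: "v' 4 = i" and I: "I i A'"
      have v0: "v' 0 = d" using lowD[OF low, of 0] v by simp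
      have rows: "A' (16 + i) = A (16 + i)" "A' 0 = A 0" "A' 8 0 = 400" "A' 3 0 = 1" "A' 9 0 = 6"
        using I A by (auto simp: I_def agree_def)
      show "runs d R (Seq (RArith Divide tmp (cell brow (IVar 4)) (cell (IConst 0) (IVar 4)))
         (Seq (RArith Divide tmp tmp (cell (IConst 0) (IVar 4)))
         (Seq (RArith Mul tmp muc tmp)
         (Seq (RArith Add tmp onec tmp)
         (Seq (RArith Mul tmp lam tmp)
              (RArith Divide (cell (IConst 4) (IVar 4)) tmp (cell (IConst 0) (IVar 4))))))))
          (Suc 0 + (Suc 0 + (Suc 0 + (Suc 0 + (Suc 0 + Suc 0)))))
          (\<lambda>v'' A''. low (Suc 4) v'' v' \<and> I (Suc i) A'') v' A'"
        unfolding tmp_def using i R d v0 v'4 rows A(3)[OF i] I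
        by (intro runs_seq runs_arith) (auto simp: I_def less_Suc_eq)
    next
      fix v' A' assume "low 4 v' v" "I d A'"
      then show "Q v' A'" by (intro post) (auto simp: I_def)
    qed (use v Rd in \<open>auto simp: low_def\<close>)
  qed (use v d R in simp_all)
  then show ?thesis by (rule runs_cost) (simp add: algebra_simps)
qed

lemma runs_grad:
  assumes v: "v 0 = d" "v 3 = s" and d: "d \<ge> 1" and R: "R > 16 + d + s"
    and A: "A 9 0 = 6" "A 3 0 = 1"
    and q: "q = dot_prod d (\<lambda>i. dot_prod d (A (16 + i)) (A (16 + d + s))) (A (16 + d + s))"
    and r: "r = dot_prod d (A (16 + d + s)) (A 0)" "r \<noteq> 0"
    and post: "\<And>v' A'. low 4 v' v \<Longrightarrow> agree {2, 4, 6, 7, 15} A A' \<Longrightarrow>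
      (\<And>i. i < d \<Longrightarrow> A' 4 i = A 4 i + (1 + 6 * (q / r / r)) / r * A (16 + d + s) i) \<Longrightarrow> Q v' A'"
  shows "runs d R grad_code (15 + 17 * d + 4 * d * d) Q v A"
proof -
  have Rd: "d \<le> R * d" using R d by simp
  let ?a = "A (16 + d + s)"
  have dr: "ival drow v' = 16 + d + s" if "low 4 v' v" for v'
    using lowD[OF that, of 0] lowD[OF that, of 3] v by simp
  define F where "F = for_loop 4 (IVar 0) (Seq (RArith Mul tmp s1 (cell drow (IVar 4)))
            (RArith Add (cell (IConst 4) (IVar 4)) (cell (IConst 4) (IVar 4)) tmp))"
  define G where "G = Seq (RArith Divide s1 s1 s2) (Seq (RArith Divide s1 s1 s2)
     (Seq (RArith Mul s1 muc s1) (Seq (RArith Add s1 onec s1) (Seq (RArith Divide s1 s1 s2) F))))"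
  have "runs d R grad_code ((2 + d * (4 * d + 5)) + ((4 * d + 3) + ((4 * d + 3) +
      (Suc 0 + (Suc 0 + (Suc 0 + (Suc 0 + (Suc 0 + (2 + d * ((Suc 0 + Suc 0) + 2)))))))))) Q v A"
    unfolding grad_code_def F_def[symmetric] G_def[symmetric]
  proof (rule runs_seq, rule runs_matvec[where ib = "16 + d + s"])
    fix v1 A1 assume l1: "low 4 v1 v" and a1: "agree {15, 2} A A1"
      and y1: "\<And>i. i < d \<Longrightarrow> A1 2 i = dot_prod d (A (16 + i)) (A (16 + d + s))"
    have v1: "v1 0 = d" "v1 3 = s" using lowD[OF l1, of 0] lowD[OF l1, of 3] v by simp_all
    show "runs d R (Seq (dot_code 4 (IConst 6) (IConst 0) (IConst 2) drow)
     (Seq (dot_code 4 (IConst 7) (IConst 0) drow (IConst 0)) G)) ((4 * d + 3) + ((4 * d + 3) +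
      (Suc 0 + (Suc 0 + (Suc 0 + (Suc 0 + (Suc 0 + (2 + d * ((Suc 0 + Suc 0) + 2))))))))) Q v1 A1"
    proof (rule runs_seq, rule runs_dot[where ir = 6 and ij = 0 and ?i1.0 = 2 and ?i2.0 = "16 + d + s"])
      fix v2 A2 assume l2: "low 4 v2 v1" and a2: "agree {15, 6} A1 A2"
        and q2: "\<And>j'. A2 6 j' = (if j' = 0 then dot_prod d (A1 2) (A1 (16 + d + s)) else A1 6 j')"
      have v2: "v2 0 = d" "v2 3 = s" using lowD[OF l2, of 0] lowD[OF l2, of 3] v1 by simp_all
      show "runs d R (Seq (dot_code 4 (IConst 7) (IConst 0) drow (IConst 0)) G) ((4 * d + 3) +
        (Suc 0 + (Suc 0 + (Suc 0 + (Suc 0 + (Suc 0 + (2 + d * ((Suc 0 + Suc 0) + 2)))))))) Q v2 A2"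
      proof (rule runs_seq, rule runs_dot[where ir = 7 and ij = 0 and ?i1.0 = "16 + d + s" and ?i2.0 = 0])
        fix v3 A3 assume l3: "low 4 v3 v2" and a3: "agree {15, 7} A2 A3"
          and r3: "\<And>j'. A3 7 j' = (if j' = 0 then dot_prod d (A2 (16 + d + s)) (A2 0) else A2 7 j')"
        have v3: "v3 0 = d" "v3 3 = s" using lowD[OF l3, of 0] lowD[OF l3, of 3] v2 by simp_all
        have l30: "low 4 v3 v" using l1 l2 l3 by (simp add: low_def)
        have a30: "agree {2, 4, 6, 7, 15} A A3" using a1 a2 a3 by (auto simp: agree_def)
        have A34: "A3 4 = A 4" "A3 9 0 = 6" "A3 3 0 = 1" using a1 a2 a3 A by (auto simp: agree_def)
        have "dot_prod d (A1 2) (A1 (16 + d + s)) = q"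
          unfolding q using y1 a1 by (intro dot_prod_cong) (auto simp: agree_def)
        then have qr: "A3 6 0 = q" "A3 7 0 = r"
          using a1 a2 a3 q2 r3 by (auto simp: agree_def r(1))
        define t where "t = (1 + 6 * (q / r / r)) / r"
        define I where "I i A' \<longleftrightarrow> agree {2, 4, 6, 7, 15} A A' \<and> A' 6 0 = t \<and>
           (\<forall>i'<d. A' 4 i' = (if i' < i then A 4 i' + t * ?a i' else A 4 i'))" for i A'
        have loop: "runs d R F (2 + d * ((Suc 0 + Suc 0) + 2)) Q v3 A4" if "I 0 A4" for A4
          unfolding F_def
        proof (rule runs_for[where I = I])
          fix i v4 A5 assume i: "i < d" and l4: "low 4 v4 v3" and v44: "v4 4 = i" and I: "I i A5"
          have v4: "v4 0 = d" "v4 3 = s" using lowD[OF l4, of 0] lowD[OF l4, of 3] v3 by simp_all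
          have val: "A5 6 0 = t" "A5 (16 + d + s) = ?a" "A5 4 i = A 4 i" using I i by (auto simp: I_def agree_def)
          have "I (Suc i) (put (put A5 15 0 (t * ?a i)) 4 i (A 4 i + t * ?a i))"
            using I i by (auto simp: I_def less_Suc_eq)
          then show "runs d R (Seq (RArith Mul tmp s1 (cell drow (IVar 4)))
            (RArith Add (cell (IConst 4) (IVar 4)) (cell (IConst 4) (IVar 4)) tmp)) (Suc 0 + Suc 0)
             (\<lambda>v'' A''. low (Suc 4) v'' v4 \<and> I (Suc i) A'') v4 A5"
            unfolding tmp_def using i R d v4 v44 val
            by (intro runs_seq runs_arith) simp_all
        next
          fix v4 A5 assume l4: "low 4 v4 v3" and "I d A5"
          moreover have "low 4 v4 v" using l4 l30 by (simp add: low_def)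
          ultimately show "Q v4 A5" by (intro post) (auto simp: I_def t_def)
        qed (use v3 Rd that in \<open>auto simp: low_def\<close>)
        have I0: "I 0 (put (put (put (put (put A3 6 0 (q / r)) 6 0 (q / r / r)) 6 0 (6 * (q / r / r))) 6 0
            (1 + 6 * (q / r / r))) 6 0 t)"
          using a30 A34 by (auto simp: I_def)
        show "runs d R G
           (Suc 0 + (Suc 0 + (Suc 0 + (Suc 0 + (Suc 0 + (2 + d * ((Suc 0 + Suc 0) + 2))))))) Q v3 A3"
          unfolding G_def
          using loop[OF I0] v3 R d A34 qr r(2) by (intro runs_seq runs_arith) (simp_all add: t_def)
      qed (use v2 d R in \<open>auto simp: low_def\<close>)
    qed (use v1 d R in \<open>auto simp: low_def\<close>)
  qed (use v d R dr in auto)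
  then show ?thesis by (rule runs_cost) (simp add: algebra_simps)
qed

lemma runs_move:
  assumes v: "v 0 = d" and d: "d \<ge> 1" and R: "R \<ge> 16 + d"
    and y: "\<And>i. y i = dot_prod d (A (16 + i)) (A 4)" and z: "\<And>i. z i = dot_prod d (A (16 + i)) (A 3)"
    and \<kappa>: "\<kappa> = dot_prod d y (A 3) / dot_prod d z (A 3)" "dot_prod d z (A 3) \<noteq> 0"
    and post: "\<And>v' A'. low 4 v' v \<Longrightarrow> agree {0, 2, 5, 6, 7, 15} A A' \<Longrightarrow>
      (\<And>i. i < d \<Longrightarrow> A' 0 i = A 0 i + (y i - \<kappa> * z i)) \<Longrightarrow> Q v' A'"
  shows "runs d R move_code (13 + 23 * d + 8 * d * d) Q v A"
proof -
  have Rd: "d \<le> R * d" using R d by simp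
  define F where "F = for_loop 4 (IVar 0)
       (Seq (RArith Mul tmp s1 (cell (IConst 5) (IVar 4)))
       (Seq (RArith Sub tmp (cell (IConst 2) (IVar 4)) tmp)
            (RArith Add (cell (IConst 0) (IVar 4)) (cell (IConst 0) (IVar 4)) tmp)))"
  let ?F = "2 + d * ((Suc 0 + (Suc 0 + Suc 0)) + 2)"
  have "runs d R move_code ((2 + d * (4 * d + 5)) + ((2 + d * (4 * d + 5)) + ((4 * d + 3) + ((4 * d + 3) +
      (Suc 0 + ?F))))) Q v A"
    unfolding move_code_def F_def[symmetric]
  proof (rule runs_seq, rule runs_matvec[where ib = 4])
    fix v1 A1 assume l1: "low 4 v1 v" and a1: "agree {15, 2} A A1"
      and y1: "\<And>i. i < d \<Longrightarrow> A1 2 i = dot_prod d (A (16 + i)) (A 4)"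
    have v1: "v1 0 = d" using lowD[OF l1, of 0] v by simp_all
    show "runs d R (Seq (matvec_code (IConst 5) (IConst 3))
     (Seq (dot_code 4 (IConst 6) (IConst 0) (IConst 2) (IConst 3))
     (Seq (dot_code 4 (IConst 7) (IConst 0) (IConst 5) (IConst 3))
     (Seq (RArith Divide s1 s1 s2) F)))) ((2 + d * (4 * d + 5)) + ((4 * d + 3) + ((4 * d + 3) +
      (Suc 0 + ?F)))) Q v1 A1"
    proof (rule runs_seq, rule runs_matvec[where ib = 3])
      fix v2 A2 assume l2: "low 4 v2 v1" and a2: "agree {15, 5} A1 A2"
        and z2: "\<And>i. i < d \<Longrightarrow> A2 5 i = dot_prod d (A1 (16 + i)) (A1 3)"
      have v2: "v2 0 = d" using lowD[OF l2, of 0] v1 by simp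
      show "runs d R (Seq (dot_code 4 (IConst 6) (IConst 0) (IConst 2) (IConst 3))
       (Seq (dot_code 4 (IConst 7) (IConst 0) (IConst 5) (IConst 3))
       (Seq (RArith Divide s1 s1 s2) F))) ((4 * d + 3) + ((4 * d + 3) + (Suc 0 + ?F))) Q v2 A2"
      proof (rule runs_seq, rule runs_dot[where ir = 6 and ij = 0 and ?i1.0 = 2 and ?i2.0 = 3])
        fix v3 A3 assume l3: "low 4 v3 v2" and a3: "agree {15, 6} A2 A3"
          and q3: "\<And>j'. A3 6 j' = (if j' = 0 then dot_prod d (A2 2) (A2 3) else A2 6 j')"
        have v3: "v3 0 = d" using lowD[OF l3, of 0] v2 by simp
        show "runs d R (Seq (dot_code 4 (IConst 7) (IConst 0) (IConst 5) (IConst 3))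
         (Seq (RArith Divide s1 s1 s2) F)) ((4 * d + 3) + (Suc 0 + ?F)) Q v3 A3"
        proof (rule runs_seq, rule runs_dot[where ir = 7 and ij = 0 and ?i1.0 = 5 and ?i2.0 = 3])
          fix v4 A4 assume l4: "low 4 v4 v3" and a4: "agree {15, 7} A3 A4"
            and r4: "\<And>j'. A4 7 j' = (if j' = 0 then dot_prod d (A3 5) (A3 3) else A3 7 j')"
          have v4: "v4 0 = d" using lowD[OF l4, of 0] v3 by simp
          have l40: "low 4 v4 v" using l1 l2 l3 l4 by (simp add: low_def)
          have a40: "agree {0, 2, 5, 6, 7, 15} A A4" using a1 a2 a3 a4 by (auto simp: agree_def)
          have rows: "A4 2 i = y i" "A4 5 i = z i" if "i < d" for i
            using a1 a2 a3 a4 y1[OF that] z2[OF that] y[of i] z[of i] by (auto simp: agree_def)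
          have A40: "A4 0 = A 0" using a1 a2 a3 a4 by (simp add: agree_def)
          have "dot_prod d (A2 2) (A2 3) = dot_prod d y (A 3)"
            using y1 y a1 a2 by (intro dot_prod_cong) (auto simp: agree_def)
          moreover have "dot_prod d (A3 5) (A3 3) = dot_prod d z (A 3)"
            using z2 z a1 a2 a3 by (intro dot_prod_cong) (auto simp: agree_def)
          ultimately have qr: "A4 6 0 = dot_prod d y (A 3)" "A4 7 0 = dot_prod d z (A 3)"
            using q3 r4 a4 by (auto simp: agree_def)
          define I where "I i A' \<longleftrightarrow> agree {0, 2, 5, 6, 7, 15} A A' \<and> A' 6 0 = \<kappa> \<and>
             (\<forall>i'<d. A' 2 i' = y i' \<and> A' 5 i' = z i' \<and>
               A' 0 i' = (if i' < i then A 0 i' + (y i' - \<kappa> * z i') else A 0 i'))" for i A'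
          have loop: "runs d R F ?F Q v4 A5" if "I 0 A5" for A5
            unfolding F_def
          proof (rule runs_for[where I = I])
            fix i v5 A6 assume i: "i < d" and l5: "low 4 v5 v4" and v54: "v5 4 = i" and I: "I i A6"
            have v5: "v5 0 = d" using lowD[OF l5, of 0] v4 by simp_all
            have val: "A6 6 0 = \<kappa>" "A6 2 i = y i" "A6 5 i = z i" "A6 0 i = A 0 i"
              using I i by (auto simp: I_def)
            have "I (Suc i) (put (put (put A6 15 0 (\<kappa> * z i)) 15 0 (y i - \<kappa> * z i)) 0 i (A 0 i + (y i - \<kappa> * z i)))"
              using I i by (auto simp: I_def less_Suc_eq)
            then show "runs d R (Seq (RArith Mul tmp s1 (cell (IConst 5) (IVar 4)))
                 (Seq (RArith Sub tmp (cell (IConst 2) (IVar 4)) tmp)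
                 (RArith Add (cell (IConst 0) (IVar 4)) (cell (IConst 0) (IVar 4)) tmp)))
                (Suc 0 + (Suc 0 + Suc 0)) (\<lambda>v'' A''. low (Suc 4) v'' v5 \<and> I (Suc i) A'') v5 A6"
              unfolding tmp_def using i R d v5 v54 val
              by (intro runs_seq runs_arith) simp_all
          next
            fix v5 A6 assume l5: "low 4 v5 v4" and "I d A6"
            moreover have "low 4 v5 v" using l5 l40 by (simp add: low_def)
            ultimately show "Q v5 A6" by (intro post) (auto simp: I_def)
          qed (use v4 Rd that in \<open>auto simp: low_def\<close>)
          have I0: "I 0 (put A4 6 0 \<kappa>)" using a40 rows A40 by (auto simp: I_def)
          show "runs d R (Seq (RArith Divide s1 s1 s2) F) (Suc 0 + ?F) Q v4 A4"
            using loop[OF I0] v4 R d qr \<kappa> by (intro runs_seq runs_arith) simp_all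
        qed (use v3 d R in \<open>auto simp: low_def\<close>)
      qed (use v2 d R in \<open>auto simp: low_def\<close>)
    qed (use v1 d R in \<open>auto simp: low_def\<close>)
  qed (use v d R in auto)
  then show ?thesis by (rule runs_cost) (simp add: algebra_simps)
qed

definition update_code :: com where
  "update_code = Seq diag_code (Seq (for_loop 3 (IVar 2) rank_one_code)
     (Seq grad_init_code (Seq (for_loop 3 (IVar 2) grad_code) move_code)))"

text \<open>
  \<open>B s\<close> is the inverse after \<open>s\<close> of the stored returns.  The lemma states the arithmetic of the
  program as it is carried out; that these quantities are \<open>kern\<close>, the gradient and the Newton direction is
  shown in \<open>runs_newton_update\<close>.
\<close>

lemma runs_update:
  assumes v: "v 0 = d" "v 2 = n" and d: "d \<ge> 1" and R: "R \<ge> 16 + d + n" "n \<le> R * d"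
    and one: "\<And>i. i < d \<Longrightarrow> A 3 i = 1" and w: "\<And>i. i < d \<Longrightarrow> A 0 i \<noteq> 0"
    and y: "\<And>s i. y s i = dot_prod d (B s i) (A (16 + d + s))"
    and r: "\<And>s. r s = dot_prod d (A (16 + d + s)) (A 0)"
    and nz: "\<And>s. s < n \<Longrightarrow> r s \<noteq> 0" "\<And>s. s < n \<Longrightarrow> dot_prod d (y s) (A (16 + d + s)) + r s * r s \<noteq> 0"
    and B0: "\<And>i j. i < d \<Longrightarrow> j < d \<Longrightarrow> B 0 i j = (if j = i then A 0 i * A 0 i / 400 else 0)"
    and BS: "\<And>s i j. s < n \<Longrightarrow> i < d \<Longrightarrow> j < d \<Longrightarrow>
       B (Suc s) i j = B s i j - y s i * y s j / (dot_prod d (y s) (A (16 + d + s)) + r s * r s)"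
    and q: "\<And>s. q s = dot_prod d (\<lambda>i. dot_prod d (B n i) (A (16 + d + s))) (A (16 + d + s))"
    and g: "\<And>i. i < d \<Longrightarrow> g i = 400 * (1 + 6 * (B n i i / A 0 i / A 0 i)) / A 0 i
         + (\<Sum>s<n. (1 + 6 * (q s / r s / r s)) / r s * A (16 + d + s) i)"
    and u: "\<And>i. i < d \<Longrightarrow> u i = dot_prod d (B n i) g" and z: "\<And>i. i < d \<Longrightarrow> z i = dot_prod d (B n i) (\<lambda>_. 1)"
    and den: "dot_prod d z (\<lambda>_. 1) \<noteq> 0"
    and post: "\<And>v' A'. low 3 v' v \<Longrightarrow> agree ({0, 2, 15} \<union> {4..9} \<union> {16..<16 + d}) A A' \<Longrightarrow>
      (\<And>i. i < d \<Longrightarrow> A' 0 i = A 0 i + (u i - dot_prod d u (\<lambda>_. 1) / dot_prod d z (\<lambda>_. 1) * z i)) \<Longrightarrow> Q v' A'"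
  shows "runs d R update_code (80 * (d * d) + 100 * (n * (d * d))) Q v A"
proof -
  let ?a = "\<lambda>s. A (16 + d + s)"
  define S where "S = {2, 6, 7, 8, 15} \<union> {16..<16 + d}"
  define I where "I s A' \<longleftrightarrow> agree S A A' \<and> A' 8 0 = 400 \<and> (\<forall>i<d. \<forall>j<d. A' (16 + i) j = B s i j)" for s A'
  define S2 where "S2 = {2, 4, 6, 7, 8, 9, 15} \<union> {16..<16 + d}"
  define J where "J s A' \<longleftrightarrow> agree S2 A A' \<and> A' 9 0 = 6 \<and> (\<forall>i<d. \<forall>j<d. A' (16 + i) j = B n i j) \<and>
     (\<forall>i<d. A' 4 i = 400 * (1 + 6 * (B n i i / A 0 i / A 0 i)) / A 0 i
         + (\<Sum>s<s. (1 + 6 * (q s / r s / r s)) / r s * ?a s i))" for s A'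
  have "runs d R update_code ((3 + d * (3 * d + 6)) + ((2 + n * ((14 + 20 * d + 9 * d * d) + 2)) +
     ((3 + 8 * d) + ((2 + n * ((15 + 17 * d + 4 * d * d) + 2)) + (13 + 23 * d + 8 * d * d))))) Q v A"
    unfolding update_code_def
  proof (rule runs_seq, rule runs_diag)
    fix v1 A1 assume l1: "low 4 v1 v" and a1: "agree ({8, 15} \<union> {16..<16 + d}) A A1" and "A1 8 0 = 400"
      and "\<And>i j. i < d \<Longrightarrow> j < d \<Longrightarrow> A1 (16 + i) j = (if j = i then A 0 i * A 0 i / 400 else 0)"
    then have I0: "I 0 A1" using B0 by (auto simp: I_def S_def intro: agree_trans)
    have v1: "v1 0 = d" "v1 2 = n" using lowD[OF l1, of 0] lowD[OF l1, of 2] v by simp_all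
    show "runs d R (Seq (for_loop 3 (IVar 2) rank_one_code)
      (Seq grad_init_code (Seq (for_loop 3 (IVar 2) grad_code) move_code)))
      ((2 + n * ((14 + 20 * d + 9 * d * d) + 2)) +
     ((3 + 8 * d) + ((2 + n * ((15 + 17 * d + 4 * d * d) + 2)) + (13 + 23 * d + 8 * d * d)))) Q v1 A1"
    proof (rule runs_seq, rule runs_for[where I = I])
      fix s v2 A2 assume s: "s < n" and l2: "low 3 v2 v1" and v23: "v2 3 = s" and I: "I s A2"
      have v2: "v2 0 = d" using lowD[OF l2, of 0] v1 by simp
      have data: "A2 (16 + d + s) = ?a s" "A2 0 = A 0" using I by (auto simp: I_def S_def agree_def)
      have ys: "y s i = dot_prod d (A2 (16 + i)) (?a s)" if "i < d" for i
        unfolding y using I that by (intro dot_prod_cong) (auto simp: I_def)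
      show "runs d R rank_one_code (14 + 20 * d + 9 * d * d) (\<lambda>v'' A''. low (Suc 3) v'' v2 \<and> I (Suc s) A'') v2 A2"
      proof (rule runs_rank_one[where y = "y s" and s = s])
        fix v3 A3 assume l3: "low 4 v3 v2" and a3: "agree ({2, 6, 7, 15} \<union> {16..<16 + d}) A2 A3"
          and B3: "\<And>i j. i < d \<Longrightarrow> j < d \<Longrightarrow> A3 (16 + i) j = A2 (16 + i) j - y s i * y s j /
             (dot_prod d (y s) (A2 (16 + d + s)) + dot_prod d (A2 (16 + d + s)) (A2 0) * dot_prod d (A2 (16 + d + s)) (A2 0))"
        have "agree S A A3" using I a3 by (auto simp: I_def S_def intro: agree_trans)
        moreover have "A3 8 0 = 400" using I agreeD[OF a3, of 8] by (simp add: I_def)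
        moreover have "A3 (16 + i) j = B (Suc s) i j" if "i < d" "j < d" for i j
          using B3[OF that] BS[OF s that] I that unfolding data by (simp add: I_def r)
        ultimately show "low (Suc 3) v3 v2 \<and> I (Suc s) A3" using l3 by (simp add: I_def)
      qed (use v2 v23 d R s ys nz(2)[OF s] data in \<open>simp_all add: r\<close>)
    next
      fix v2 A2 assume l2: "low 3 v2 v1" and I: "I n A2"
      have v2: "v2 0 = d" "v2 2 = n" using lowD[OF l2, of 0] lowD[OF l2, of 2] v1 by simp_all
      have data: "A2 0 = A 0" "A2 3 = A 3" "A2 8 0 = 400" using I by (auto simp: I_def S_def agree_def)
      show "runs d R (Seq grad_init_code (Seq (for_loop 3 (IVar 2) grad_code) move_code))
        ((3 + 8 * d) + ((2 + n * ((15 + 17 * d + 4 * d * d) + 2)) + (13 + 23 * d + 8 * d * d))) Q v2 A2"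
      proof (rule runs_seq, rule runs_grad_init)
        fix v3 A3 assume l3: "low 4 v3 v2" and a3: "agree {4, 9, 15} A2 A3" and mu: "A3 9 0 = 6"
          and g3: "\<And>i. i < d \<Longrightarrow> A3 4 i = 400 * (1 + 6 * (A2 (16 + i) i / A2 0 i / A2 0 i)) / A2 0 i"
        have "agree S2 A A3" using I a3 by (auto simp: I_def S_def S2_def intro: agree_trans)
        then have J0: "J 0 A3" using I g3 a3 mu data by (auto simp: I_def J_def agree_def)
        have v3: "v3 0 = d" "v3 2 = n" using lowD[OF l3, of 0] lowD[OF l3, of 2] v2 by simp_all
        show "runs d R (Seq (for_loop 3 (IVar 2) grad_code) move_code)
          ((2 + n * ((15 + 17 * d + 4 * d * d) + 2)) + (13 + 23 * d + 8 * d * d)) Q v3 A3"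
        proof (rule runs_seq, rule runs_for[where I = J])
          fix s v4 A4 assume s: "s < n" and l4: "low 3 v4 v3" and v43: "v4 3 = s" and J: "J s A4"
          have v4: "v4 0 = d" using lowD[OF l4, of 0] v3 by simp
          have data4: "A4 (16 + d + s) = ?a s" "A4 0 = A 0" "A4 3 = A 3" "A4 9 0 = 6"
            using J by (auto simp: J_def S2_def agree_def)
          have qs: "q s = dot_prod d (\<lambda>i. dot_prod d (A4 (16 + i)) (?a s)) (?a s)"
            unfolding q using J by (intro dot_prod_cong) (auto simp: J_def)
          show "runs d R grad_code (15 + 17 * d + 4 * d * d) (\<lambda>v'' A''. low (Suc 3) v'' v4 \<and> J (Suc s) A'') v4 A4"
          proof (rule runs_grad[where s = s and q = "q s" and r = "r s"])
            fix v5 A5 assume l5: "low 4 v5 v4" and a5: "agree {2, 4, 6, 7, 15} A4 A5"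
              and g5: "\<And>i. i < d \<Longrightarrow> A5 4 i = A4 4 i + (1 + 6 * (q s / r s / r s)) / r s * A4 (16 + d + s) i"
            have "agree S2 A A5" using J a5 by (auto simp: J_def S2_def intro: agree_trans)
            moreover have "A5 9 0 = 6" "\<And>i. A5 (16 + i) = A4 (16 + i)"
              using J agreeD[OF a5] by (simp_all add: J_def)
            ultimately show "low (Suc 3) v5 v4 \<and> J (Suc s) A5"
              using l5 g5 J unfolding data4 by (simp add: J_def)
          qed (use v4 v43 d R s qs nz(1)[OF s] data4 one in \<open>simp_all add: r\<close>)
        next
          fix v4 A4 assume l4: "low 3 v4 v3" and J: "J n A4"
          have v4: "v4 0 = d" using lowD[OF l4, of 0] v3 by simp
          have data4: "A4 0 = A 0" "A4 3 = A 3" using J by (auto simp: J_def S2_def agree_def)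
          have uz: "u i = dot_prod d (A4 (16 + i)) (A4 4)" "z i = dot_prod d (A4 (16 + i)) (A4 3)" if "i < d" for i
            unfolding u[OF that] z[OF that] data4 using J that g one
            by (auto intro!: dot_prod_cong simp: J_def)
          define Y Z where "Y i = dot_prod d (A4 (16 + i)) (A4 4)" and "Z i = dot_prod d (A4 (16 + i)) (A4 3)" for i
          have YZ: "dot_prod d Y (A4 3) = dot_prod d u (\<lambda>_. 1)" "dot_prod d Z (A4 3) = dot_prod d z (\<lambda>_. 1)"
            unfolding data4 using uz one by (auto intro!: dot_prod_cong simp: Y_def Z_def data4)
          show "runs d R move_code (13 + 23 * d + 8 * d * d) Q v4 A4"
          proof (rule runs_move[where y = Y and z = Z and \<kappa> = "dot_prod d u (\<lambda>_. 1) / dot_prod d z (\<lambda>_. 1)"])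
            fix v5 A5 assume l5: "low 4 v5 v4" and a5: "agree {0, 2, 5, 6, 7, 15} A4 A5"
              and w5: "\<And>i. i < d \<Longrightarrow> A5 0 i = A4 0 i + (Y i - dot_prod d u (\<lambda>_. 1) / dot_prod d z (\<lambda>_. 1) * Z i)"
            show "Q v5 A5"
            proof (rule post)
              show "low 3 v5 v" using l1 l2 l3 l4 l5 by (simp add: low_def)
              show "agree ({0, 2, 15} \<union> {4..9} \<union> {16..<16 + d}) A A5"
                by (rule agree_trans[OF _ a5, of S2]) (use J in \<open>auto simp: J_def S2_def\<close>)
              show "A5 0 i = A 0 i + (u i - dot_prod d u (\<lambda>_. 1) / dot_prod d z (\<lambda>_. 1) * z i)" if "i < d" for i
                using w5[OF that] uz[OF that] unfolding Y_def Z_def data4 by simp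
            qed
          qed (use v4 d R YZ den in \<open>simp_all add: Y_def Z_def\<close>)
        qed (use v3 R J0 in \<open>auto simp: low_def\<close>)
      qed (use v2 d R data one w in simp_all)
    qed (use v1 R I0 in \<open>auto simp: low_def\<close>)
  qed (use v d R in simp_all)
  then show ?thesis
  proof (rule runs_cost)
    have "1 \<le> d * d" "d \<le> d * d" using d by simp_all
    moreover have "n \<le> n * (d * d)" "n * d \<le> n * (d * d)" using d by simp_all
    moreover have "(3 + d * (3 * d + 6)) + ((2 + n * ((14 + 20 * d + 9 * d * d) + 2)) +
     ((3 + 8 * d) + ((2 + n * ((15 + 17 * d + 4 * d * d) + 2)) + (13 + 23 * d + 8 * d * d))))
      = 23 + 37 * d + 11 * (d * d) + 33 * n + 37 * (n * d) + 13 * (n * (d * d))"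
      by (simp add: algebra_simps)
    ultimately show "(3 + d * (3 * d + 6)) + ((2 + n * ((14 + 20 * d + 9 * d * d) + 2)) +
     ((3 + 8 * d) + ((2 + n * ((15 + 17 * d + 4 * d * d) + 2)) + (13 + 23 * d + 8 * d * d))))
      \<le> 80 * (d * d) + 100 * (n * (d * d))"
      by linarith
  qed
qed

definition store_code :: com where
  "store_code = for_loop 4 (IVar 0)
     (RCopy (cell (IPlus (IPlus (IConst 16) (IVar 0)) (IVar 2)) (IVar 4)) (cell (IConst 1) (IVar 4)))"

lemma runs_store:
  assumes v: "v 0 = d" "v 2 = n" and d: "d \<ge> 1" and R: "R > 16 + d + n"
    and post: "\<And>v' A'. low 4 v' v \<Longrightarrow> agree {16 + d + n} A A' \<Longrightarrow>
      (\<And>i. i < d \<Longrightarrow> A' (16 + d + n) i = A 1 i) \<Longrightarrow> Q v' A'"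
  shows "runs d R store_code (2 + d * (Suc 0 + 2)) Q v A"
  unfolding store_code_def
proof (rule runs_for[where I = "\<lambda>i A'. agree {16 + d + n} A A' \<and> (\<forall>i'<i. A' (16 + d + n) i' = A 1 i')"])
  fix i v' A' assume i: "i < d" and low: "low 4 v' v" and v4: "v' 4 = i"
    and I: "agree {16 + d + n} A A' \<and> (\<forall>i'<i. A' (16 + d + n) i' = A 1 i')"
  have "v' 0 = d" "v' 2 = n" using lowD[OF low, of 0] lowD[OF low, of 2] v by simp_all
  moreover have "A' 1 = A 1" using I by (simp add: agree_def)
  ultimately show "runs d R (RCopy (cell (IPlus (IPlus (IConst 16) (IVar 0)) (IVar 2)) (IVar 4)) (cell (IConst 1) (IVar 4)))
     (Suc 0) (\<lambda>v'' A''. low (Suc 4) v'' v' \<and> agree {16 + d + n} A A'' \<and> (\<forall>i'<Suc i. A'' (16 + d + n) i' = A 1 i')) v' A'"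
    using v4 i I R by (intro runs_copy) (auto simp: less_Suc_eq)
qed (use v d R post in \<open>auto simp: low_def\<close>)

definition init_code :: com where
  "init_code = Seq (RConst s1 (IVar 0)) (Seq (RConst s2 (IConst (Suc 0)))
     (for_loop 4 (IVar 0) (Seq (RCopy (cell (IConst 3) (IVar 4)) s2)
        (RArith Divide (cell (IConst 0) (IVar 4)) s2 s1))))"

lemma runs_init:
  assumes v: "v 0 = d" and d: "d \<ge> 1" and R: "R \<ge> 16"
    and post: "\<And>v' A'. low 4 v' v \<Longrightarrow> (\<And>i. i < d \<Longrightarrow> A' 3 i = 1 \<and> A' 0 i = 1 / d) \<Longrightarrow> Q v' A'"
  shows "runs d R init_code (4 + 4 * d) Q v A"
proof -
  have Rd: "d \<le> R * d" using R by simp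
  define I where "I i A' \<longleftrightarrow> A' 6 0 = real d \<and> A' 7 0 = 1 \<and> (\<forall>i'<i. A' 3 i' = 1 \<and> A' 0 i' = 1 / d)"
    for i and A' :: "nat \<Rightarrow> nat \<Rightarrow> real"
  have loop: "runs d R (for_loop 4 (IVar 0) (Seq (RCopy (cell (IConst 3) (IVar 4)) s2)
        (RArith Divide (cell (IConst 0) (IVar 4)) s2 s1))) (2 + d * ((Suc 0 + Suc 0) + 2)) Q v A1" if "I 0 A1" for A1
  proof (rule runs_for[where I = I])
    fix i v' A' assume i: "i < d" and low: "low 4 v' v" and v4: "v' 4 = i" and I: "I i A'"
    have "v' 0 = d" using lowD[OF low, of 0] v by simp
    then show "runs d R (Seq (RCopy (cell (IConst 3) (IVar 4)) s2)
        (RArith Divide (cell (IConst 0) (IVar 4)) s2 s1)) (Suc 0 + Suc 0)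
        (\<lambda>v'' A''. low (Suc 4) v'' v' \<and> I (Suc i) A'') v' A'"
      using v4 i I R d by (intro runs_seq runs_copy runs_arith) (auto simp: less_Suc_eq I_def)
  qed (use v Rd that post in \<open>auto simp: low_def I_def\<close>)
  have "runs d R init_code (Suc 0 + (Suc 0 + (2 + d * ((Suc 0 + Suc 0) + 2)))) Q v A"
    unfolding init_code_def using v d R
    by (intro runs_seq runs_const loop) (simp_all add: I_def)
  then show ?thesis by (rule runs_cost) simp
qed

context barrier begin

text \<open>
  The arithmetic of the program is the Newton step.  Its update divides by
  \<open>k(a, a) + (a \<odot> w)\<^sup>2\<close>, which is the denominator \<open>1 + \<omega> k(a, a)\<close> of the Sherman--Morrison formula
  multiplied by \<open>1 / \<omega> = (a \<odot> w)\<^sup>2\<close>.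
\<close>

lemma runs_newton_update:
  assumes v: "v 0 = d" "v 2 = n" and d: "d \<ge> 1" and R: "R \<ge> 16 + d + n" "n \<le> R * d"
    and l400: "l = 400" and w: "interior w"
    and A: "\<And>i. i < d \<Longrightarrow> A 3 i = 1" "\<And>i. i < d \<Longrightarrow> A 0 i = w i"
      "\<And>s i. s < n \<Longrightarrow> i < d \<Longrightarrow> A (16 + d + s) i = b (d + s) i"
    and post: "\<And>v' A'. low 3 v' v \<Longrightarrow> agree ({0, 2, 15} \<union> {4..9} \<union> {16..<16 + d}) A A' \<Longrightarrow>
      (\<And>i. i < d \<Longrightarrow> A' 0 i = newton_step 6 n w i) \<Longrightarrow> Q v' A'"
  shows "runs d R update_code (80 * (d * d) + 100 * (n * (d * d))) Q v A"
proof -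
  interpret weighted_atoms d b n "wt w" by (rule weighted[OF w])
  let ?k = "\<lambda>s. kern (wt w) s"
  define B where "B s i j = ?k s (b i) (b j)" for s i j
  define g where "g = neg_grad 6 n w"
  have Bx: "dot_prod d (B s i) x = ?k s (b i) x" for s i x
    using kern_expand[of "wt w" s "b i" x] by (simp add: B_def dot_prod_def mult.commute)
  have data: "dot_prod d x (A (16 + d + s)) = x \<odot> b (d + s)" if "s < n" for s x
    using A(3)[OF that] by (intro dot_prod_cong) auto
  have rs: "dot_prod d (A (16 + d + s)) (A 0) = b (d + s) \<odot> w" if "s < n" for s
    using A(2) A(3)[OF that] by (intro dot_prod_cong) auto
  have ys: "dot_prod d (B s' i) (A (16 + d + s)) = ?k s' (b i) (b (d + s))" if "s < n" for s s' i
    unfolding data[OF that] Bx ..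
  have qs: "dot_prod d (\<lambda>i. dot_prod d (B s' i) (A (16 + d + s))) (A (16 + d + s)) = ?k s' (b (d + s)) (b (d + s))"
    if "s < n" for s s'
    unfolding data[OF that] Bx by (rule kern_unit_ip)
  have w0: "w i > 0" if "i < d" for i using w that by (simp add: interior_def)
  have wts: "wt w (d + s) = 1 / ((b (d + s) \<odot> w) * (b (d + s) \<odot> w))" for s
    by (simp add: wt_def c_def power2_eq_square)
  have wti: "wt w i = 400 / (w i * w i)" if "i < d" for i
    using that unfolding wt_def c_def by (simp add: ip_unit power2_eq_square) (simp add: l400)
  have den: "?k s (b (d + s)) (b (d + s)) + (b (d + s) \<odot> w) * (b (d + s) \<odot> w) > 0" if "s < n" for s
    using ip_pos[OF w, of "d + s"] kern_nonneg'[of s] that by (simp add: add_nonneg_pos)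
  show ?thesis
  proof (rule runs_update[where A = A and B = B and g = g and
      y = "\<lambda>s i. dot_prod d (B s i) (A (16 + d + s))" and
      r = "\<lambda>s. dot_prod d (A (16 + d + s)) (A 0)" and
      q = "\<lambda>s. dot_prod d (\<lambda>i. dot_prod d (B n i) (A (16 + d + s))) (A (16 + d + s))" and
      u = "\<lambda>i. dot_prod d (B n i) g" and z = "\<lambda>i. dot_prod d (B n i) (\<lambda>_. 1)"])
    show "A 0 i \<noteq> 0" if "i < d" for i using w0[OF that] A(2)[OF that] by simp
    show "dot_prod d (A (16 + d + s)) (A 0) \<noteq> 0" if "s < n" for s
      using ip_pos[OF w, of "d + s"] rs[OF that] by simp
    show "dot_prod d (\<lambda>i. dot_prod d (B s i) (A (16 + d + s))) (A (16 + d + s))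
        + dot_prod d (A (16 + d + s)) (A 0) * dot_prod d (A (16 + d + s)) (A 0) \<noteq> 0" if "s < n" for s
      unfolding qs[OF that] rs[OF that] using den[OF that] by simp
    show "B 0 i j = (if j = i then A 0 i * A 0 i / 400 else 0)" if "i < d" "j < d" for i j
    proof -
      have "B 0 i j = (\<Sum>m<d. (if m = i then b j m / wt w m else 0))"
        unfolding B_def kern.simps using that by (intro sum.cong) (auto simp: unit)
      also have "\<dots> = b j i / wt w i" using that by simp
      finally show ?thesis using that A(2)[OF that(1)] wti[OF that(1)] by (cases "j = i") (simp_all add: unit)
    qed
    show "B (Suc s) i j = B s i j - dot_prod d (B s i) (A (16 + d + s)) * dot_prod d (B s j) (A (16 + d + s)) /
        (dot_prod d (\<lambda>i. dot_prod d (B s i) (A (16 + d + s))) (A (16 + d + s))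
          + dot_prod d (A (16 + d + s)) (A 0) * dot_prod d (A (16 + d + s)) (A 0))"
      if "s < n" "i < d" "j < d" for s i j
      unfolding rs[OF that(1)] data[OF that(1)] unfolding Bx unfolding kern_unit_ip
      using ip_pos[OF w, of "d + s"] den[OF that(1)]
      unfolding B_def kern.simps wts kern_commute[of "wt w" s "b (d + s)" "b j"]
      by (simp add: field_simps)
    show "g i = 400 * (1 + 6 * (B n i i / A 0 i / A 0 i)) / A 0 i +
       (\<Sum>s<n. (1 + 6 * (dot_prod d (\<lambda>i. dot_prod d (B n i) (A (16 + d + s))) (A (16 + d + s)) /
          dot_prod d (A (16 + d + s)) (A 0) / dot_prod d (A (16 + d + s)) (A 0))) /
          dot_prod d (A (16 + d + s)) (A 0) * A (16 + d + s) i)" if i: "i < d" for i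
    proof -
      have "(\<Sum>r<d. c r * (1 + 6 * lev n w r r) / (b r \<odot> w) * b r i)
          = (\<Sum>r<d. if r = i then c i * (1 + 6 * lev n w i i) / (b i \<odot> w) else 0)"
        using i by (intro sum.cong) (auto simp: unit)
      also have "\<dots> = 400 * (1 + 6 * (B n i i / A 0 i / A 0 i)) / A 0 i"
        using i A(2)[OF i] unfolding lev_def c_def by (simp add: ip_unit B_def) (simp add: l400)
      finally show ?thesis
        unfolding g_def neg_grad_def sum_lessThan_add
        using i by (auto intro!: sum.cong simp: qs rs A(3) lev_def c_def)
    qed
    have z: "dot_prod d (\<lambda>i. dot_prod d (B n i) x) (\<lambda>_. 1) = ?k n one x" for x
      unfolding Bx one_def[symmetric] by (rule kern_unit_ip)
    show "dot_prod d (\<lambda>i. dot_prod d (B n i) (\<lambda>_. 1)) (\<lambda>_. 1) \<noteq> 0"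
      unfolding z using kern_one_one_pos[OF w d, of n] by (simp add: one_def)
    fix v' A' assume "low 3 v' v" "agree ({0, 2, 15} \<union> {4..9} \<union> {16..<16 + d}) A A'"
      and "\<And>i. i < d \<Longrightarrow> A' 0 i = A 0 i + (dot_prod d (B n i) g -
        dot_prod d (\<lambda>i. dot_prod d (B n i) g) (\<lambda>_. 1) / dot_prod d (\<lambda>i. dot_prod d (B n i) (\<lambda>_. 1)) (\<lambda>_. 1)
          * dot_prod d (B n i) (\<lambda>_. 1))"
    then show "Q v' A'" unfolding z Bx
      by (intro post) (auto simp: A(2) newton_step_def line_def newton_dir_def Let_def g_def one_def kern_unit_ip)
  qed (use v d R A in auto)
qed

lemma iterate_outside: "i \<ge> d \<Longrightarrow> iterate n i = 0"
  by (induction n) (simp_all add: newton_step_def line_def newton_dir_def Let_def)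

end

section \<open>Playing the game\<close>

definition next_code :: com where
  "next_code = Seq store_code (Seq (IAssign 2 (IPlus (IVar 2) (IConst (Suc 0)))) update_code)"

context barrier begin

text \<open>
  The state in which \<open>n\<close> returns have been processed and the portfolio for round \<open>n + 1\<close> is delivered.
\<close>

definition ready :: "nat \<Rightarrow> ram_state \<Rightarrow> bool" where
  "ready n s \<longleftrightarrow> fst s 0 = d \<and> fst s 2 = n \<and>
     (\<forall>i<d. view d (snd s) 3 i = 1 \<and> view d (snd s) 0 i = iterate n i) \<and>
     (\<forall>m<n. \<forall>i<d. view d (snd s) (16 + d + m) i = b (d + m) i)"

text \<open>
  The input cells \<open>d, \<dots>, 2 d - 1\<close> form row 1.
\<close>

lemma view_feed: "view d (snd (feed d x s)) r j = (if r = 1 \<and> j < d then x j else view d (snd s) r j)"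
proof (cases "j < d")
  case True
  have "d \<le> r * d + j \<and> r * d + j < 2 * d \<longleftrightarrow> r = 1"
  proof
    assume a: "d \<le> r * d + j \<and> r * d + j < 2 * d"
    have "r \<noteq> 0" using a True by (intro notI) simp
    moreover have "\<not> r \<ge> 2" using a mult_le_mono1[of 2 r d] by linarith
    ultimately show "r = 1" by simp
  qed (use True in simp)
  then show ?thesis using True by (auto simp: view_def feed_def)
qed (simp add: view_def)

lemma first_round:
  assumes d: "d \<ge> 1"
  shows "\<exists>k s. exec ((16 + d + T) * d) init_code (start_state d T) k s \<and> k \<le> 4 + 4 * d \<and> ready 0 s"
proof -
  let ?v = "(\<lambda>_. 0)(0 := d, 1 := T)" and ?m = "\<lambda>_. 0 :: real"
  have "runs d (16 + d + T) init_code (4 + 4 * d)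
      (\<lambda>v A. low 4 v ?v \<and> (\<forall>i<d. A 3 i = 1 \<and> A 0 i = 1 / d)) ?v (view d ?m)"
    using d by (intro runs_init) auto
  then obtain k v m where "exec ((16 + d + T) * d) init_code (?v, ?m) k (v, m)" "k \<le> 4 + 4 * d"
    "low 4 v ?v" "\<forall>i<d. view d m 3 i = 1 \<and> view d m 0 i = 1 / d"
    by (rule runsE) auto
  then show ?thesis
    by (intro exI[of _ k] exI[of _ "(v, m)"]) (auto simp: start_state_def ready_def low_def)
qed

lemma next_round:
  assumes d: "d \<ge> 1" and l400: "l = 400" and n: "Suc n < T" and s: "ready n s"
    and x: "\<And>i. i < d \<Longrightarrow> x i = b (d + n) i"
  shows "\<exists>k s'. exec ((16 + d + T) * d) next_code (feed d x s) k s' \<and>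
    k \<le> 200 * (d * d * T) \<and> ready (Suc n) s'"
proof -
  let ?R = "16 + d + T"
  define v m A where "v = fst s" and "m = snd (feed d x s)" and "A = view d m"
  have fs: "feed d x s = (v, m)" by (simp add: v_def m_def feed_def)
  have v: "v 0 = d" "v 2 = n" using s by (simp_all add: ready_def v_def)
  have A: "A 3 i = 1" "A 0 i = iterate n i" "A 1 i = b (d + n) i" if "i < d" for i
    using s that x[OF that] unfolding A_def m_def view_feed by (simp_all add: ready_def)
  have Adata: "A (16 + d + q) i = b (d + q) i" if "q < n" "i < d" for q i
    using s that unfolding A_def m_def view_feed by (simp add: ready_def)
  have TR: "T \<le> ?R * d" using mult_le_mono[of T ?R 1 d] d by simp
  let ?Q = "\<lambda>v' A'. v' 0 = d \<and> v' 2 = Suc n \<and> (\<forall>i<d. A' 3 i = 1 \<and> A' 0 i = iterate (Suc n) i) \<and>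
     (\<forall>m<Suc n. \<forall>i<d. A' (16 + d + m) i = b (d + m) i)"
  have "runs d ?R next_code ((2 + d * (Suc 0 + 2)) + (Suc 0 + (80 * (d * d) + 100 * (Suc n * (d * d))))) ?Q v A"
    unfolding next_code_def
  proof (rule runs_seq, rule runs_store)
    fix v1 A1 assume l1: "low 4 v1 v" and a1: "agree {16 + d + n} A A1"
      and new: "\<And>i. i < d \<Longrightarrow> A1 (16 + d + n) i = A 1 i"
    have v1: "v1 0 = d" "v1 2 = n" using lowD[OF l1, of 0] lowD[OF l1, of 2] v by simp_all
    have A1: "A1 3 = A 3" "A1 0 = A 0" using a1 by (simp_all add: agree_def)
    have data: "A1 (16 + d + q) i = b (d + q) i" if "q < Suc n" "i < d" for q i
      using that Adata[of q i] new[of i] A(3)[of i] agreeD[OF a1, of "16 + d + q"] by (cases "q = n") auto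
    show "runs d ?R (Seq (IAssign 2 (IPlus (IVar 2) (IConst (Suc 0)))) update_code)
       (Suc 0 + (80 * (d * d) + 100 * (Suc n * (d * d)))) ?Q v1 A1"
    proof (rule runs_seq, rule runs_iassign)
      show "ival (IPlus (IVar 2) (IConst (Suc 0))) v1 \<le> ?R * d" using v1 n TR by simp
      show "runs d ?R update_code (80 * (d * d) + 100 * (Suc n * (d * d))) ?Q
          (v1(2 := ival (IPlus (IVar 2) (IConst (Suc 0))) v1)) A1"
      proof (rule runs_newton_update[where w = "iterate n"])
        show "interior (iterate n)" using iterate_invariant[OF d l400] by blast
        fix v2 A2 assume l2: "low 3 v2 (v1(2 := ival (IPlus (IVar 2) (IConst (Suc 0))) v1))"
          and a2: "agree ({0, 2, 15} \<union> {4..9} \<union> {16..<16 + d}) A1 A2"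
          and w: "\<And>i. i < d \<Longrightarrow> A2 0 i = newton_step 6 (Suc n) (iterate n) i"
        have "v2 0 = d" "v2 2 = Suc n" using lowD[OF l2, of 0] lowD[OF l2, of 2] v1 by simp_all
        moreover have "A2 3 = A1 3" "\<And>q. A2 (16 + d + q) = A1 (16 + d + q)"
          using a2 by (simp_all add: agree_def)
        ultimately show "?Q v2 A2" using w A A1 data by simp
      qed (use v1 d n l400 TR A A1 data in auto)
    qed
  qed (use v d n in auto)
  then have "runs d ?R next_code (200 * (d * d * T)) ?Q v (view d m)"
    unfolding A_def
  proof (rule runs_cost)
    have "d \<le> d * d" "1 \<le> d * d" using d by simp_all
    moreover have "Suc n * (d * d) + d * d \<le> d * d * T"
      using mult_le_mono2[of "Suc (Suc n)" T "d * d"] n by (simp add: algebra_simps)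
    moreover have "d * (Suc 0 + 2) = 3 * d" by simp
    ultimately show "(2 + d * (Suc 0 + 2)) + (Suc 0 + (80 * (d * d) + 100 * (Suc n * (d * d)))) \<le> 200 * (d * d * T)"
      by linarith
  qed
  then obtain k v' m' where "exec (?R * d) next_code (v, m) k (v', m')" "k \<le> 200 * (d * d * T)" "?Q v' (view d m')"
    by (rule runsE)
  then show ?thesis unfolding fs
    by (intro exI[of _ k] exI[of _ "(v', m')"]) (simp add: ready_def)
qed

lemma plays_iterate:
  assumes d: "d \<ge> 1" and T: "T \<ge> 1" and l400: "l = 400"
    and x: "\<And>t i. t < T \<Longrightarrow> i < d \<Longrightarrow> x (Suc t) i = b (d + t) i"
  shows "\<exists>k. plays ((16 + d + T) * d) (init_code, next_code) d T x (\<lambda>t. iterate (t - 1)) k \<and>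
    (\<forall>t\<in>{1..T}. k t \<le> 200 * (d * d * T))"
proof -
  let ?M = "(16 + d + T) * d" and ?K = "200 * (d * d * T)"
  \<comment> \<open>A run is a sequence of pairs of cost and state; index \<open>n\<close> is round \<open>n + 1\<close>, and beyond the horizon nothing is demanded.\<close>
  define P where "P n p \<longleftrightarrow> (n < T \<longrightarrow> ready n (snd p) \<and> fst p \<le> ?K \<and>
     (n = 0 \<longrightarrow> exec ?M init_code (start_state d T) (fst p) (snd p)))" for n and p :: "nat \<times> ram_state"
  define S where "S n p p' \<longleftrightarrow> (Suc n < T \<longrightarrow> exec ?M next_code (feed d (x (Suc n)) (snd p)) (fst p') (snd p'))"
    for n and p p' :: "nat \<times> ram_state"
  have "\<exists>f. \<forall>n. P n (f n) \<and> S n (f n) (f (Suc n))"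
  proof (rule dependent_nat_choice)
    obtain k s where "exec ?M init_code (start_state d T) k s" "k \<le> 4 + 4 * d" "ready 0 s"
      using first_round[OF d] by blast
    moreover have "4 + 4 * d \<le> ?K"
    proof -
      have "d \<le> d * d * T" "1 \<le> d * d * T" using d T by simp_all
      then show ?thesis by linarith
    qed
    ultimately show "\<exists>p. P 0 p" by (intro exI[of _ "(k, s)"]) (simp add: P_def)
  next
    fix p n assume p: "P n p"
    show "\<exists>p'. P (Suc n) p' \<and> S n p p'"
    proof (cases "Suc n < T")
      case True
      then have "ready n (snd p)" using p by (simp add: P_def)
      from next_round[OF d l400 True this, of "x (Suc n)"] x True
      obtain k s' where "exec ?M next_code (feed d (x (Suc n)) (snd p)) k s'" "k \<le> ?K" "ready (Suc n) s'"
        by fastforce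
      then show ?thesis by (intro exI[of _ "(k, s')"]) (simp add: P_def S_def)
    qed (simp add: P_def S_def)
  qed
  then obtain f where f: "\<And>n. P n (f n)" "\<And>n. S n (f n) (f (Suc n))" by blast
  define k \<sigma> where "k t = fst (f (t - 1))" and "\<sigma> t = snd (f (t - 1))" for t :: nat
  have ready: "ready (t - 1) (\<sigma> t)" "k t \<le> ?K" if "t \<in> {1..T}" for t
    using f(1)[of "t - 1"] that by (auto simp: P_def k_def \<sigma>_def)
  have "iterate (t - 1) = delivered d (\<sigma> t)" if t: "t \<in> {1..T}" for t
  proof
    fix i show "iterate (t - 1) i = delivered d (\<sigma> t) i"
      using ready(1)[OF t] iterate_outside[of i "t - 1"]
      by (cases "i < d") (auto simp: delivered_def ready_def view_def)
  qed
  moreover have "exec ?M init_code (start_state d T) (k 1) (\<sigma> 1)"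
    using f(1)[of 0] T by (simp add: P_def k_def \<sigma>_def)
  moreover have "exec ?M next_code (feed d (x t) (\<sigma> t)) (k (Suc t)) (\<sigma> (Suc t))" if "t \<in> {1..<T}" for t
    using f(2)[of "t - 1"] that by (simp add: S_def k_def \<sigma>_def)
  moreover have "2 * d \<le> ?M" "T \<le> ?M"
    using mult_le_mono[of T "16 + d + T" 1 d] d by simp_all
  ultimately show ?thesis using ready(2) unfolding plays_def
    by (intro exI[of _ k] conjI exI[of _ \<sigma>]) auto
qed

lemma iterate_in_simplex:
  assumes "d \<ge> 1" "l = 400"
  shows "iterate n \<in> prob_simplex d"
proof -
  have "interior (iterate n)" "one \<odot> iterate n = 1" using iterate_invariant[OF assms] by blast+
  then show ?thesis using iterate_outside
    by (auto simp: prob_simplex_def orthant_def interior_def one_def dot_prod_def less_imp_le)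
qed

lemma portfolio_regret_le:
  assumes d: "d \<ge> 1" and T: "T \<ge> 1" and l400: "l = 400"
    and x: "\<And>t i. t < T \<Longrightarrow> i < d \<Longrightarrow> x (Suc t) i = b (d + t) i"
    and x0: "\<And>t. t \<in> {1..T} \<Longrightarrow> x t \<in> orthant d - {\<lambda>_. 0}"
  shows "portfolio_regret d T x (\<lambda>t. iterate (t - 1)) \<le> ereal (1000 * real d * ln (real (T + d)))"
proof -
  obtain u where u: "u \<in> prob_simplex d"
    and inf: "(INF u \<in> prob_simplex d. \<Sum>t = 1..T. log_loss d (x t) u) = (\<Sum>t = 1..T. log_loss d (x t) u)"
    and fin: "\<bar>\<Sum>t = 1..T. log_loss d (x t) u\<bar> \<noteq> \<infinity>"
    by (rule best_portfolio_exists[of d T x, OF d x0])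
  have xb: "x (Suc s) \<odot> w = b (d + s) \<odot> w" if "s < T" for s w
    using x[OF that] by (intro dot_prod_cong) auto
  have u_pos: "b (d + s) \<odot> u > 0" if "s < T" for s
  proof (rule ccontr)
    assume "\<not> b (d + s) \<odot> u > 0"
    then have "log_loss d (x (Suc s)) u = \<infinity>" by (simp add: log_loss_def xb[OF that])
    then have "(\<Sum>t = 1..T. log_loss d (x t) u) = \<infinity>"
      unfolding sum_Pinfty using that by (auto intro!: bexI[of _ "Suc s"])
    then show False using fin by simp
  qed
  have sum: "(\<Sum>t = 1..T. log_loss d (x t) (p t)) = ereal (\<Sum>s<T. - ln (b (d + s) \<odot> p (Suc s)))"
    if "\<And>s. s < T \<Longrightarrow> b (d + s) \<odot> p (Suc s) > 0" for p
  proof -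
    have "(\<Sum>t = 1..T. log_loss d (x t) (p t)) = (\<Sum>s<T. log_loss d (x (Suc s)) (p (Suc s)))"
      using sum.atLeast1_atMost_eq[of "\<lambda>t. log_loss d (x t) (p t)" T] by simp
    also have "\<dots> = (\<Sum>s<T. ereal (- ln (b (d + s) \<odot> p (Suc s))))"
      using that by (intro sum.cong) (auto simp: log_loss_def xb)
    finally show ?thesis by simp
  qed
  have "b (d + s) \<odot> iterate (Suc s - 1) > 0" for s
    using iterate_invariant[OF d l400] ip_pos by blast
  then have "(\<Sum>t = 1..T. log_loss d (x t) (iterate (t - 1))) = ereal (\<Sum>s<T. - ln (b (d + s) \<odot> iterate s))"
    using sum[of "\<lambda>t. iterate (t - 1)"] by simp
  moreover have "(\<Sum>s<T. - ln (b (d + s) \<odot> iterate s))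
      \<le> (\<Sum>s<T. - ln (b (d + s) \<odot> u)) + 1000 * d * ln (real (T + d))"
    using u u_pos by (intro iterate_regret[OF d l400 T])
      (auto simp: prob_simplex_def orthant_def one_def dot_prod_def)
  ultimately show ?thesis
    unfolding portfolio_regret_def inf using sum[of "\<lambda>_. u"] u_pos by simp
qed

end

text \<open>
  The returns as data atoms.  Beyond the horizon any positive vector serves, so that the
  assumptions on atoms hold for every index.
\<close>

definition market :: "nat \<Rightarrow> nat \<Rightarrow> (nat \<Rightarrow> nat \<Rightarrow> real) \<Rightarrow> nat \<Rightarrow> nat \<Rightarrow> real" where
  "market d T x r = (if r < d then (\<lambda>j. if j = r then 1 else 0)
     else if r < d + T then x (Suc (r - d)) else (\<lambda>_. 1))"

lemma barrier_market:
  assumes d: "d \<ge> 1" and x: "\<And>t. t \<in> {1..T} \<Longrightarrow> x t \<in> orthant d - {\<lambda>_. 0}"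
  shows "barrier d (market d T x) 400"
proof
  show "market d T x i j = (if j = i then 1 else 0)" if "i < d" for i j
    using that by (simp add: market_def)
  show "0 \<le> market d T x r i" if "i < d" for r i
    using that x[of "Suc (r - d)"] by (auto simp: market_def orthant_def)
  show "\<exists>i<d. market d T x r i > 0" for r
  proof (cases "r < d \<or> r \<ge> d + T")
    case True
    then show ?thesis
      using d by (intro exI[of _ "if r < d then r else 0"]) (auto simp: market_def)
  next
    case False
    then have o: "x (Suc (r - d)) \<in> orthant d - {\<lambda>_. 0}" by (intro x) auto
    then obtain i where i: "x (Suc (r - d)) i \<noteq> 0" by fastforce
    then have "i < d" using o by (auto simp: orthant_def not_le[symmetric])
    then show ?thesis using o i False by (auto simp: market_def orthant_def order_less_le)
  qed
qed simp

theorem theorem1p1: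
  "\<exists>(C::real) (c::real) (A::algorithm). C > 0 \<and> c > 0 \<and>
     (\<forall>(d::nat) (T::nat). d \<ge> 1 \<longrightarrow> T \<ge> 1 \<longrightarrow>
       (\<exists>M::nat. real M \<le> C * (real d * real T + real d ^ 2) \<and>
         (\<forall>x :: nat \<Rightarrow> nat \<Rightarrow> real. (\<forall>t\<in>{1..T}. x t \<in> orthant d - {\<lambda>_. 0}) \<longrightarrow>
           (\<exists>(w :: nat \<Rightarrow> nat \<Rightarrow> real) (k :: nat \<Rightarrow> nat).
              plays M A d T x w k \<and>
              (\<forall>t\<in>{1..T}. w t \<in> prob_simplex d) \<and>
              portfolio_regret d T x w \<le> ereal (C * real d * ln (real (T + d))) \<and>
              (\<forall>t\<in>{1..T}. real (k t) \<le>
                 C * (real d ^ 2 * real T + real d ^ 3) * ln (exp 1 * real (T + d)) powr c)))))"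
proof (rule exI[of _ 1000], rule exI[of _ 1], rule exI[of _ "(init_code, next_code)"], intro conjI allI impI)
  fix d T :: nat assume d: "d \<ge> 1" and T: "T \<ge> 1"
  show "\<exists>M::nat. real M \<le> 1000 * (real d * real T + real d ^ 2) \<and>
         (\<forall>x :: nat \<Rightarrow> nat \<Rightarrow> real. (\<forall>t\<in>{1..T}. x t \<in> orthant d - {\<lambda>_. 0}) \<longrightarrow>
           (\<exists>(w :: nat \<Rightarrow> nat \<Rightarrow> real) (k :: nat \<Rightarrow> nat).
              plays M (init_code, next_code) d T x w k \<and>
              (\<forall>t\<in>{1..T}. w t \<in> prob_simplex d) \<and>
              portfolio_regret d T x w \<le> ereal (1000 * real d * ln (real (T + d))) \<and>
              (\<forall>t\<in>{1..T}. real (k t) \<le>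
                 1000 * (real d ^ 2 * real T + real d ^ 3) * ln (exp 1 * real (T + d)) powr 1)))"
  proof (rule exI[of _ "(16 + d + T) * d"], intro conjI allI impI)
    have "16 * a + p + q \<le> 1000 * (q + p)" if "a \<le> q" "0 \<le> a" "0 \<le> p" for a p q :: real
      using that by simp
    from this[of "real d" "real d * real T" "real d * real d"]
    have "(16 + real d + real T) * real d \<le> 1000 * (real d * real T + real d * real d)"
      using T d by (simp add: algebra_simps)
    then show "real ((16 + d + T) * d) \<le> 1000 * (real d * real T + real d ^ 2)"
      by (simp add: power2_eq_square)
    fix x :: "nat \<Rightarrow> nat \<Rightarrow> real" assume x: "\<forall>t\<in>{1..T}. x t \<in> orthant d - {\<lambda>_. 0}"
    interpret barrier d "market d T x" 400 using barrier_market[OF d] x by blast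
    have xm: "x (Suc t) i = market d T x (d + t) i" if "t < T" for t i
      using that by (simp add: market_def)
    obtain k where k: "plays ((16 + d + T) * d) (init_code, next_code) d T x (\<lambda>t. iterate (t - 1)) k"
      "\<forall>t\<in>{1..T}. k t \<le> 200 * (d * d * T)"
      using plays_iterate[OF d T refl xm] by blast
    have "real (k t) \<le> 1000 * (real d ^ 2 * real T + real d ^ 3) * ln (exp 1 * real (T + d)) powr 1"
      if "t \<in> {1..T}" for t
    proof -
      have "ln (exp 1 * real (T + d)) = 1 + ln (real (T + d))" using d by (simp add: ln_mult)
      then have L: "1 \<le> ln (exp 1 * real (T + d)) powr 1" using d by (simp add: ln_ge_zero)
      have "real (k t) \<le> real (200 * (d * d * T))" using k(2) that by (simp del: of_nat_mult)
      also have "\<dots> = 200 * (real d ^ 2 * real T)" by (simp add: power2_eq_square)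
      also have "\<dots> \<le> 1000 * (real d ^ 2 * real T + real d ^ 3) * 1" by simp
      also have "\<dots> \<le> 1000 * (real d ^ 2 * real T + real d ^ 3) * ln (exp 1 * real (T + d)) powr 1"
        using L by (intro mult_left_mono) auto
      finally show ?thesis .
    qed
    then show "\<exists>(w :: nat \<Rightarrow> nat \<Rightarrow> real) (k :: nat \<Rightarrow> nat).
              plays ((16 + d + T) * d) (init_code, next_code) d T x w k \<and>
              (\<forall>t\<in>{1..T}. w t \<in> prob_simplex d) \<and>
              portfolio_regret d T x w \<le> ereal (1000 * real d * ln (real (T + d))) \<and>
              (\<forall>t\<in>{1..T}. real (k t) \<le>
                 1000 * (real d ^ 2 * real T + real d ^ 3) * ln (exp 1 * real (T + d)) powr 1)"
      using k(1) iterate_in_simplex[OF d refl] portfolio_regret_le[OF d T refl xm] x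
      by (intro exI[of _ "\<lambda>t. iterate (t - 1)"] exI[of _ k]) auto
  qed
qed simp_all

end
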